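(* Let $T>0$. Assume that for some $M\ge0$: $\|F(0)\|\le M$ and $\|F(x)-F(y)\|\le M\|x-y\|_{-1}$ for all $x,y\in H$; $\|G(x)-G(y)\|\le M\|x-y\|_{-1}$ for all $x,y\in H$; $\|G(x)\|\le M$ for all $x\in H$; and $\int_H\|z\|^2e^{K\|z\|}\nu(dz)<+\infty$ for every $K>0$. Let $g\in{\rm Lip}_b(H_{-1})$. For $n=1,2,\dots$ let $v_n$ be a bounded viscosity solution of $$(v_n)_t+\langle-Ax+F(x),Dv_n\rangle+\int_H\Big[e^{n(v_n(t,x+\frac1nG(x)z)-v_n(t,x))}-1-\langle Dv_n,G(x)z\rangle\Big]\nu(dz)=0\ \text{ in }(0,T)\times H,\quad v_n(T,x)=g(x),$$ and let $v$ be a bounded viscosity solution of $$v_t+\langle-Ax+F(x),Dv\rangle+H_0(G^*(x)Dv)=0\ \text{ in }(0,T)\times H,\quad v(T,x)=g(x),$$ such that for every $n$ $$\lim_{t\to T}\{|v_n(t,x)-g(x)|+|v(t,x)-g(x)|\}=0\quad\text{uniformly on bounded subsets of }H,$$ and $$|v(t,x)-v(t,y)|\le D_1\|x-y\|_{-1}$$ for some $D_1\ge0$ and all $t\in(0,T]$, $x,y\in H$. Suppose $\|v\|_\infty+\sup_n\|v_n\|_\infty<+\infty$. Then $$\|v_n-v\|_\infty\to0\quad\text{as }n\to+\infty.$$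
   Context: $H$ is a real separable Hilbert space; $L(H)$ is the space of bounded linear operators on $H$; $F:H\to H$, $G:H\to L(H)$, $G^*(x)=G(x)^*$. $A$ is a linear, densely defined, maximal monotone operator in $H$. $B$ is a bounded, linear, (strictly) positive, self-adjoint operator on $H$ such that $A^*B$ is bounded and $\langle(A^*B+c_0B)x,x\rangle\ge0$ for all $x\in H$, for some $c_0\ge0$. $\|x\|_{-1}=\|B^{1/2}x\|$, $H_{-1}$ is the completion of $H$ under this norm, and ${\rm Lip}_b(H_{-1})$ is the set of bounded Lipschitz functions on $H_{-1}$. $\nu$ is a Borel measure on $H$ with $\nu(\{0\})=0$ and $\int_H\|z\|^2\nu(dz)<\infty$. $H_0(p)=\int_H[e^{\langle p,z\rangle}-1-\langle p,z\rangle]\nu(dz)$. The functions $v_n,v$ are real functions on $(0,T]\times H$ and $\|\cdot\|_\infty$ is the supremum norm. $B$-semicontinuity: $u:\Omega\to\mathbb{R}$, $\Omega\subset[0,T]\times H$, is $B$-upper (resp. $B$-lower) semicontinuous if whenever $t_k\to t$, $x_k\rightharpoonup x$ weakly, $Bx_k\to Bx$, $(t,x)\in\Omega$ (with $(t_k,x_k)\in\Omega$), then $\limsup u(t_k,x_k)\le u(t,x)$ (resp. $\liminf u(t_k,x_k)\ge u(t,x)$). Test functions for the integro-PDE: $\varphi\in C^{1,2}((0,T)\times H)$, $B$-lower semicontinuous, with $\varphi,\varphi_t,D\varphi,D^2\varphi,A^*D\varphi$ uniformly continuous on $[\epsilon,T-\epsilon]\times H$ for every $\epsilon>0$ and $\varphi$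 bounded on every set $[\epsilon,T-\epsilon]\times\{\|x\|_{-1}\le r\}$; and $h\in C^2([0,\infty))$ with $h'(0)=0$, $h'(r)\ge0$ for $r>0$, $h,h',h''$ uniformly continuous on $[0,\infty)$. For the first order equation the same, but only once continuously differentiable functions are required ($\varphi\in C^1$, $h\in C^1$, conditions on $D^2\varphi$ and $h''$ dropped). Viscosity solutions: write either equation as $v_t-\langle Ax,Dv\rangle+\mathcal{F}(t,x,Dv,v(t,\cdot))=0$, where for the integro-PDE $\mathcal{F}(t,x,D\psi(t,x),\psi(t,\cdot))=\langle F(x),D\psi(t,x)\rangle+\int_H[e^{n(\psi(t,x+\frac1nG(x)z)-\psi(t,x))}-1-\langle D\psi(t,x),G(x)z\rangle]\nu(dz)$ and for the first order equation $\mathcal{F}=\langle F(x),D\psi(t,x)\rangle+H_0(G^*(x)D\psi(t,x))$. A locally bounded $B$-upper semicontinuous $u:(0,T)\times H\to\mathbb{R}$ is a viscosity subsolution if whenever $u-\varphi-h(\|\cdot\|)$ has a maximum over $(0,T)\times H$ at $(t,x)$ for some test functions, then with $\psi=\varphi+h(\|\cdot\|)$, $\psi_t(t,x)-\langle x,A^*D\varphi(t,x)\rangle+\mathcal{F}(t,x,D\psi(t,x),\psi(t,\cdot))\ge0$. A locally bounded $B$-lower semicontinuous $u$ is a viscosity supersolution if whenever $u+\varphi+h(\|\cdot\|)$ has a minimum over $(0,T)\times H$ at $(t,x)$, then with $\psi=-\varphi-h(\|\cdot\|)$, $\psi_t(t,x)+\langle x,A^*D\varphi(t,x)\rangle+\mathcal{F}(t,x,D\psi(t,x),\psi(t,\cdot))\le0$.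 A viscosity solution is both. *)

theory Defs
  imports "HOL-Analysis.Analysis"
begin

text \<open>A real separable Hilbert space is a type of sort \<open>{real_inner, polish_space}\<close>. An unbounded
  operator is a pair of a domain \<open>D\<close> and a map \<open>A\<close> of which only the values on \<open>D\<close> matter.\<close>

definition linear_operator_on :: "'a::real_vector set \<Rightarrow> ('a \<Rightarrow> 'a) \<Rightarrow> bool" where
  "linear_operator_on D A \<longleftrightarrow> subspace D \<and>
     (\<forall>x\<in>D. \<forall>y\<in>D. A (x + y) = A x + A y) \<and> (\<forall>c. \<forall>x\<in>D. A (c *\<^sub>R x) = c *\<^sub>R A x)"

definition monotone_graph :: "('a::real_inner \<times> 'a) set \<Rightarrow> bool" where
  "monotone_graph S \<longleftrightarrow> (\<forall>(x, y)\<in>S. \<forall>(x', y')\<in>S. 0 \<le> (y - y') \<bullet> (x - x'))"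

definition maximal_monotone :: "'a::real_inner set \<Rightarrow> ('a \<Rightarrow> 'a) \<Rightarrow> bool" where
  "maximal_monotone D A \<longleftrightarrow> monotone_graph ((\<lambda>x. (x, A x)) ` D) \<and>
     (\<forall>S. monotone_graph S \<and> (\<lambda>x. (x, A x)) ` D \<subseteq> S \<longrightarrow> S = (\<lambda>x. (x, A x)) ` D)"

definition adj_dom :: "'a::real_inner set \<Rightarrow> ('a \<Rightarrow> 'a) \<Rightarrow> 'a set" where
  "adj_dom D A = {y. \<exists>w. \<forall>x\<in>D. A x \<bullet> y = x \<bullet> w}"

definition adj_op :: "'a::real_inner set \<Rightarrow> ('a \<Rightarrow> 'a) \<Rightarrow> 'a \<Rightarrow> 'a" where
  "adj_op D A y = (THE w. \<forall>x\<in>D. A x \<bullet> y = x \<bullet> w)"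

definition self_adjoint :: "('a::real_inner \<Rightarrow>\<^sub>L 'a) \<Rightarrow> bool" where
  "self_adjoint R \<longleftrightarrow> (\<forall>x y. R x \<bullet> y = x \<bullet> R y)"

definition op_sqrt :: "('a::real_inner \<Rightarrow>\<^sub>L 'a) \<Rightarrow> ('a \<Rightarrow>\<^sub>L 'a)" where
  "op_sqrt B = (THE R. self_adjoint R \<and> (\<forall>x. 0 \<le> R x \<bullet> x) \<and> R o\<^sub>L R = B)"

definition norm_m1 :: "('a::real_inner \<Rightarrow>\<^sub>L 'a) \<Rightarrow> 'a \<Rightarrow> real" where
  "norm_m1 B x = norm (op_sqrt B x)"

text \<open>The completion of \<open>H\<close> under \<open>norm_m1 B\<close> is represented by the Cauchy sequences for that norm,
  with the pseudometric \<open>dist_Hm1 B\<close>. Sequences at distance 0, which represent the same point, need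
  not be identified: a map that is Lipschitz for the pseudometric takes the same value on them.
  \<open>H\<close> is embedded by the constant sequences.\<close>

definition Hm1 :: "('a::real_inner \<Rightarrow>\<^sub>L 'a) \<Rightarrow> (nat \<Rightarrow> 'a) set" where
  "Hm1 B = {X. \<forall>e>0. \<exists>N. \<forall>m\<ge>N. \<forall>n\<ge>N. norm_m1 B (X m - X n) < e}"

definition dist_Hm1 :: "('a::real_inner \<Rightarrow>\<^sub>L 'a) \<Rightarrow> (nat \<Rightarrow> 'a) \<Rightarrow> (nat \<Rightarrow> 'a) \<Rightarrow> real" where
  "dist_Hm1 B X Y = lim (\<lambda>k. norm_m1 B (X k - Y k))"

text \<open>The restrictions to \<open>H\<close> of the bounded Lipschitz functions on the completion.\<close>

definition Lip_b_Hm1 :: "('a::real_inner \<Rightarrow>\<^sub>L 'a) \<Rightarrow> ('a \<Rightarrow> real) set" where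
  "Lip_b_Hm1 B = {g. \<exists>gc L. bounded (gc ` Hm1 B) \<and>
     (\<forall>X\<in>Hm1 B. \<forall>Y\<in>Hm1 B. \<bar>gc X - gc Y\<bar> \<le> L * dist_Hm1 B X Y) \<and> (\<forall>x. g x = gc (\<lambda>_. x))}"

definition weakly_to :: "(nat \<Rightarrow> 'a::real_inner) \<Rightarrow> 'a \<Rightarrow> bool" where
  "weakly_to X x \<longleftrightarrow> (\<forall>y. (\<lambda>k. X k \<bullet> y) \<longlonglongrightarrow> x \<bullet> y)"

definition B_usc_on ::
  "('a::real_inner \<Rightarrow>\<^sub>L 'a) \<Rightarrow> (real \<times> 'a) set \<Rightarrow> (real \<Rightarrow> 'a \<Rightarrow> real) \<Rightarrow> bool" where
  "B_usc_on B \<Omega> u \<longleftrightarrow>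
     (\<forall>\<tau> X t x. (\<forall>k. (\<tau> k, X k) \<in> \<Omega>) \<and> (t, x) \<in> \<Omega> \<and> \<tau> \<longlonglongrightarrow> t \<and> weakly_to X x \<and>
        (\<lambda>k. B (X k)) \<longlonglongrightarrow> B x \<longrightarrow> limsup (\<lambda>k. ereal (u (\<tau> k) (X k))) \<le> ereal (u t x))"

definition B_lsc_on ::
  "('a::real_inner \<Rightarrow>\<^sub>L 'a) \<Rightarrow> (real \<times> 'a) set \<Rightarrow> (real \<Rightarrow> 'a \<Rightarrow> real) \<Rightarrow> bool" where
  "B_lsc_on B \<Omega> u \<longleftrightarrow>
     (\<forall>\<tau> X t x. (\<forall>k. (\<tau> k, X k) \<in> \<Omega>) \<and> (t, x) \<in> \<Omega> \<and> \<tau> \<longlonglongrightarrow> t \<and> weakly_to X x \<and>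
        (\<lambda>k. B (X k)) \<longlonglongrightarrow> B x \<longrightarrow> ereal (u t x) \<le> liminf (\<lambda>k. ereal (u (\<tau> k) (X k))))"

definition locally_bounded_on ::
  "(real \<times> 'a::metric_space) set \<Rightarrow> (real \<Rightarrow> 'a \<Rightarrow> real) \<Rightarrow> bool" where
  "locally_bounded_on \<Omega> u \<longleftrightarrow>
     (\<forall>z\<in>\<Omega>. \<exists>e>0. bounded ((\<lambda>(t, x). u t x) ` (\<Omega> \<inter> ball z e)))"

definition gradient :: "('a::real_inner \<Rightarrow> real) \<Rightarrow> 'a \<Rightarrow> 'a" where
  "gradient f x = (THE p. GDERIV f x :> p)"

text \<open>In the conditions below, \<open>\<phi>t\<close>, \<open>D\<phi>\<close> and \<open>D2\<phi>\<close> are the derivatives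
  \<open>\<phi>\<^sub>t\<close>, \<open>D\<phi>\<close> and \<open>D\<^sup>2\<phi>\<close> of \<open>\<phi>\<close>.\<close>

definition test_conds1 ::
  "real \<Rightarrow> 'a::real_inner set \<Rightarrow> ('a \<Rightarrow> 'a) \<Rightarrow> ('a \<Rightarrow>\<^sub>L 'a) \<Rightarrow> (real \<Rightarrow> 'a \<Rightarrow> real) \<Rightarrow>
   (real \<Rightarrow> 'a \<Rightarrow> real) \<Rightarrow> (real \<Rightarrow> 'a \<Rightarrow> 'a) \<Rightarrow> bool" where
  "test_conds1 T D A B \<phi> \<phi>t D\<phi> \<longleftrightarrow>
     (\<forall>t\<in>{0<..<T}. \<forall>x. ((\<lambda>s. \<phi> s x) has_real_derivative \<phi>t t x) (at t)) \<and>
     (\<forall>t\<in>{0<..<T}. \<forall>x. GDERIV (\<phi> t) x :> (D\<phi> t x)) \<and>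
     continuous_on ({0<..<T} \<times> UNIV) (\<lambda>(t, x). \<phi> t x) \<and>
     continuous_on ({0<..<T} \<times> UNIV) (\<lambda>(t, x). \<phi>t t x) \<and>
     continuous_on ({0<..<T} \<times> UNIV) (\<lambda>(t, x). D\<phi> t x) \<and>
     B_lsc_on B ({0<..<T} \<times> UNIV) \<phi> \<and>
     (\<forall>t\<in>{0<..<T}. \<forall>x. D\<phi> t x \<in> adj_dom D A) \<and>
     (\<forall>\<epsilon>>0.
        uniformly_continuous_on ({\<epsilon>..T - \<epsilon>} \<times> UNIV) (\<lambda>(t, x). \<phi> t x) \<and>
        uniformly_continuous_on ({\<epsilon>..T - \<epsilon>} \<times> UNIV) (\<lambda>(t, x). \<phi>t t x) \<and>
        uniformly_continuous_on ({\<epsilon>..T - \<epsilon>} \<times> UNIV) (\<lambda>(t, x). D\<phi> t x) \<and>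
        uniformly_continuous_on ({\<epsilon>..T - \<epsilon>} \<times> UNIV) (\<lambda>(t, x). adj_op D A (D\<phi> t x)) \<and>
        (\<forall>r. bounded ((\<lambda>(t, x). \<phi> t x) ` ({\<epsilon>..T - \<epsilon>} \<times> {x. norm_m1 B x \<le> r}))))"

definition test_fun1 ::
  "real \<Rightarrow> 'a::real_inner set \<Rightarrow> ('a \<Rightarrow> 'a) \<Rightarrow> ('a \<Rightarrow>\<^sub>L 'a) \<Rightarrow> (real \<Rightarrow> 'a \<Rightarrow> real) \<Rightarrow> bool" where
  "test_fun1 T D A B \<phi> \<longleftrightarrow> (\<exists>\<phi>t D\<phi>. test_conds1 T D A B \<phi> \<phi>t D\<phi>)"

definition test_fun2 ::
  "real \<Rightarrow> 'a::real_inner set \<Rightarrow> ('a \<Rightarrow> 'a) \<Rightarrow> ('a \<Rightarrow>\<^sub>L 'a) \<Rightarrow> (real \<Rightarrow> 'a \<Rightarrow> real) \<Rightarrow> bool" where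
  "test_fun2 T D A B \<phi> \<longleftrightarrow>
     (\<exists>\<phi>t D\<phi>. \<exists>D2\<phi> :: real \<Rightarrow> 'a \<Rightarrow> 'a \<Rightarrow>\<^sub>L 'a.
        test_conds1 T D A B \<phi> \<phi>t D\<phi> \<and>
        (\<forall>t\<in>{0<..<T}. \<forall>x. (D\<phi> t has_derivative blinfun_apply (D2\<phi> t x)) (at x)) \<and>
        continuous_on ({0<..<T} \<times> UNIV) (\<lambda>(t, x). D2\<phi> t x) \<and>
        (\<forall>\<epsilon>>0. uniformly_continuous_on ({\<epsilon>..T - \<epsilon>} \<times> UNIV) (\<lambda>(t, x). D2\<phi> t x)))"

definition radial_conds1 :: "(real \<Rightarrow> real) \<Rightarrow> (real \<Rightarrow> real) \<Rightarrow> bool" where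
  "radial_conds1 h h' \<longleftrightarrow>
     (\<forall>r\<ge>0. (h has_real_derivative h' r) (at r within {0..})) \<and>
     h' 0 = 0 \<and> (\<forall>r>0. 0 \<le> h' r) \<and>
     uniformly_continuous_on {0..} h \<and> uniformly_continuous_on {0..} h'"

definition radial_fun1 :: "(real \<Rightarrow> real) \<Rightarrow> bool" where
  "radial_fun1 h \<longleftrightarrow> (\<exists>h'. radial_conds1 h h')"

definition radial_fun2 :: "(real \<Rightarrow> real) \<Rightarrow> bool" where
  "radial_fun2 h \<longleftrightarrow> (\<exists>h' h''. radial_conds1 h h' \<and>
     (\<forall>r\<ge>0. (h' has_real_derivative h'' r) (at r within {0..})) \<and>
     uniformly_continuous_on {0..} h'')"

text \<open>The argument \<open>\<F>\<close> is the nonlinearity \<open>\<F>(t, x, D\<psi>(t, x), \<psi>(t, \<cdot>))\<close>; \<open>\<Phi>\<close> and \<open>\<H>\<close> are the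
  classes of admissible test functions \<open>\<phi>\<close> and \<open>h\<close>.\<close>

definition viscosity_subsolution ::
  "real \<Rightarrow> 'a::real_inner set \<Rightarrow> ('a \<Rightarrow> 'a) \<Rightarrow> ('a \<Rightarrow>\<^sub>L 'a) \<Rightarrow>
   ((real \<Rightarrow> 'a \<Rightarrow> real) \<Rightarrow> bool) \<Rightarrow> ((real \<Rightarrow> real) \<Rightarrow> bool) \<Rightarrow>
   (real \<Rightarrow> 'a \<Rightarrow> 'a \<Rightarrow> ('a \<Rightarrow> real) \<Rightarrow> real) \<Rightarrow> (real \<Rightarrow> 'a \<Rightarrow> real) \<Rightarrow> bool" where
  "viscosity_subsolution T D A B \<Phi> \<H> \<F> u \<longleftrightarrow>
     locally_bounded_on ({0<..<T} \<times> UNIV) u \<and> B_usc_on B ({0<..<T} \<times> UNIV) u \<and>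
     (\<forall>\<phi> h. \<Phi> \<phi> \<and> \<H> h \<longrightarrow>
       (\<forall>t\<in>{0<..<T}. \<forall>x.
         (\<forall>s\<in>{0<..<T}. \<forall>y. u s y - \<phi> s y - h (norm y) \<le> u t x - \<phi> t x - h (norm x)) \<longrightarrow>
         (let \<psi> = (\<lambda>s y. \<phi> s y + h (norm y)) in
           deriv (\<lambda>s. \<psi> s x) t - x \<bullet> adj_op D A (gradient (\<phi> t) x)
             + \<F> t x (gradient (\<psi> t) x) (\<psi> t) \<ge> 0)))"

definition viscosity_supersolution ::
  "real \<Rightarrow> 'a::real_inner set \<Rightarrow> ('a \<Rightarrow> 'a) \<Rightarrow> ('a \<Rightarrow>\<^sub>L 'a) \<Rightarrow>
   ((real \<Rightarrow> 'a \<Rightarrow> real) \<Rightarrow> bool) \<Rightarrow> ((real \<Rightarrow> real) \<Rightarrow> bool) \<Rightarrow>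
   (real \<Rightarrow> 'a \<Rightarrow> 'a \<Rightarrow> ('a \<Rightarrow> real) \<Rightarrow> real) \<Rightarrow> (real \<Rightarrow> 'a \<Rightarrow> real) \<Rightarrow> bool" where
  "viscosity_supersolution T D A B \<Phi> \<H> \<F> u \<longleftrightarrow>
     locally_bounded_on ({0<..<T} \<times> UNIV) u \<and> B_lsc_on B ({0<..<T} \<times> UNIV) u \<and>
     (\<forall>\<phi> h. \<Phi> \<phi> \<and> \<H> h \<longrightarrow>
       (\<forall>t\<in>{0<..<T}. \<forall>x.
         (\<forall>s\<in>{0<..<T}. \<forall>y. u t x + \<phi> t x + h (norm x) \<le> u s y + \<phi> s y + h (norm y)) \<longrightarrow>
         (let \<psi> = (\<lambda>s y. - \<phi> s y - h (norm y)) in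
           deriv (\<lambda>s. \<psi> s x) t + x \<bullet> adj_op D A (gradient (\<phi> t) x)
             + \<F> t x (gradient (\<psi> t) x) (\<psi> t) \<le> 0)))"

definition levy_H0 :: "'a::real_inner measure \<Rightarrow> 'a \<Rightarrow> real" where
  "levy_H0 \<nu> p = (LINT z|\<nu>. exp (p \<bullet> z) - 1 - p \<bullet> z)"

definition nonlin_jump ::
  "('a::real_inner \<Rightarrow> 'a) \<Rightarrow> ('a \<Rightarrow> 'a \<Rightarrow>\<^sub>L 'a) \<Rightarrow> 'a measure \<Rightarrow> nat \<Rightarrow>
   real \<Rightarrow> 'a \<Rightarrow> 'a \<Rightarrow> ('a \<Rightarrow> real) \<Rightarrow> real" where
  "nonlin_jump F G \<nu> n t x p w = F x \<bullet> p +
     (LINT z|\<nu>. exp (real n * (w (x + (1 / real n) *\<^sub>R G x z) - w x)) - 1 - p \<bullet> G x z)"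

definition nonlin_first ::
  "('a::real_inner \<Rightarrow> 'a) \<Rightarrow> ('a \<Rightarrow> 'a \<Rightarrow>\<^sub>L 'a) \<Rightarrow> 'a measure \<Rightarrow>
   real \<Rightarrow> 'a \<Rightarrow> 'a \<Rightarrow> ('a \<Rightarrow> real) \<Rightarrow> real" where
  "nonlin_first F G \<nu> t x p w = F x \<bullet> p + levy_H0 \<nu> (adjoint (blinfun_apply (G x)) p)"

definition viscosity_solution_jump where
  "viscosity_solution_jump T D A B F G \<nu> n u \<longleftrightarrow>
     viscosity_subsolution T D A B (test_fun2 T D A B) radial_fun2 (nonlin_jump F G \<nu> n) u \<and>
     viscosity_supersolution T D A B (test_fun2 T D A B) radial_fun2 (nonlin_jump F G \<nu> n) u"

definition viscosity_solution_first where
  "viscosity_solution_first T D A B F G \<nu> u \<longleftrightarrow>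
     viscosity_subsolution T D A B (test_fun1 T D A B) radial_fun1 (nonlin_first F G \<nu>) u \<and>
     viscosity_supersolution T D A B (test_fun1 T D A B) radial_fun1 (nonlin_first F G \<nu>) u"

definition sup_norm :: "real \<Rightarrow> (real \<Rightarrow> 'a \<Rightarrow> real) \<Rightarrow> ereal" where
  "sup_norm T w = (SUP (t, x)\<in>{0<..T} \<times> UNIV. ereal \<bar>w t x\<bar>)"

end

theory Submission
  imports Defs
begin

text \<open>
  Along a test function with bounded first and second derivatives the jump operator differs from
  \<open>\<langle>F, p\<rangle> + H\<^sub>0(G\<^sup>* p)\<close> by \<open>O(1/n)\<close>, so \<open>v\<^sub>n\<close> solves the first order equation up to a small error, and the
  claim becomes a comparison of an approximate subsolution \<open>u\<close> with an approximate supersolution \<open>w\<close>,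
  one of which is Lipschitz for \<open>\<parallel>\<cdot>\<parallel>\<^sub>-\<^sub>1\<close>. This is done by doubling the variables with the penalty
  \<open>\<Lambda> (\<epsilon>\<^sup>2 + \<parallel>x - y\<parallel>\<^sup>2\<^sub>-\<^sub>1)\<^sup>1\<^sup>/\<^sup>2\<close>, where \<open>\<Lambda>\<close> exceeds the Lipschitz constant. The derivatives of the penalty are
  bounded in terms of \<open>\<Lambda>\<close> and \<open>\<epsilon>\<close> only, so the error is small for all large \<open>n\<close>, although all other
  parameters depend on \<open>n\<close>.

  Test functions have to be globally uniformly continuous together with \<open>A\<^sup>* D\<phi>\<close>, which excludes functions of
  \<open>\<parallel>x - y\<parallel>\<^sub>-\<^sub>1\<close>. The form \<open>\<langle>B z, z\<rangle>\<close> is therefore replaced by \<open>\<langle>B J\<^sub>m z, z\<rangle>\<close> with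
  \<open>J\<^sub>m = I - (I - B/\<beta>)\<^sup>m\<close>, and the inequality \<open>\<langle>A\<^sup>* B z, z\<rangle> \<ge> - c\<^sub>0 \<langle>B z, z\<rangle>\<close> is recovered in the limit \<open>m \<rightarrow> \<infinity>\<close>,
  because the maximum points converge strongly once the limit problem has a strict maximum.
\<close>

text \<open>The jump term is exponential and nonlocal, so its error is controlled only by derivative
  bounds valid on all of \<open>H\<close>, not just near the maximum point; hence a penalty of
  linear growth in place of a square. At a maximum point, the excess of \<Lambda> over the Lipschitz
  constant bounds \<open>\<parallel>x - y\<parallel>\<^sub>-\<^sub>1\<close> by \<Lambda> \<epsilon>
  plus small terms. Everything that the increments of \<open>F\<close> and \<open>G\<close> and the
  constant \<open>c0\<close> contribute is proportional to this distance, hence small, and is beaten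
  by the slope of a term that is linear in time. Maximum points are the second obstacle.
  \<open>B\<close> need not be compact, so a bounded sequence need not have a subsequence along
  which \<open>B x\<close> converges, and a maximum need not be attained. A variational principle in
  the variables \<open>(t, B x)\<close> supplies one: bounded sequences with convergent
  \<open>B x\<close> converge weakly, so balls are complete for this metric and B-semicontinuity
  fits it. The perturbations then depend on \<open>B x\<close>, so their gradients lie in the range
  of \<open>B\<close>, and \<open>A\<^sup>* B\<close> is bounded.\<close>

lemma quadratic_nonneg_imp_linear_zero:
  fixes b c :: real
  assumes "\<And>t. 0 \<le> 2 * t * b + t\<^sup>2 * c"
  shows "b = 0"
proof (rule ccontr)
  assume b: "b \<noteq> 0"
  define k where "k = \<bar>c\<bar> + 1"
  have k: "k > 0" "c < k" by (auto simp: k_def)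
  have "0 \<le> 2 * (- b / k) * b + (- b / k)\<^sup>2 * c" by (rule assms)
  also have "\<dots> = (b\<^sup>2 / k\<^sup>2) * (c - 2 * k)"
    using k by (simp add: field_simps power2_eq_square)
  also have "\<dots> < 0"
    using b k by (intro mult_pos_neg) auto
  finally show False by simp
qed

text \<open>Dirichlet's principle: the representing vector minimises
  \<open>J x = x \<bullet> x - 2 * f x\<close>. The parallelogram identity makes minimising
  sequences Cauchy, and the first variation of \<open>J\<close> vanishes at the minimiser.\<close>

lemma riesz_representation:
  fixes f :: "'a::{real_inner,complete_space} \<Rightarrow> real"
  assumes "bounded_linear f"
  shows "\<exists>y. \<forall>x. f x = x \<bullet> y"
proof -
  interpret bounded_linear f by fact
  obtain K where K: "\<And>x. norm (f x) \<le> norm x * K"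
    using bounded by blast
  define J where "J x = x \<bullet> x - 2 * f x" for x
  have J_ge: "- K\<^sup>2 \<le> J x" for x
  proof -
    have "0 \<le> (norm x - K)\<^sup>2" by simp
    moreover have "f x \<le> norm x * K" using K[of x] by auto
    ultimately show ?thesis
      by (simp add: J_def power2_diff power2_norm_eq_inner)
  qed
  define m where "m = Inf (range J)"
  have bdd: "bdd_below (range J)" by (rule bdd_belowI2[OF J_ge])
  have m_le: "m \<le> J x" for x unfolding m_def using bdd by (intro cInf_lower) auto
  have "\<exists>x. J x < m + 1 / real (Suc n)" for n
  proof -
    have "Inf (range J) < m + 1 / real (Suc n)" by (simp add: m_def)
    then show ?thesis using cInf_lessD[of "range J"] by auto
  qed
  then obtain X where X: "\<And>n. J (X n) < m + 1 / real (Suc n)" by metis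
  have par: "(norm (x - y))\<^sup>2 \<le> 2 * (J x - m) + 2 * (J y - m)" for x y
  proof -
    have "(norm (x - y))\<^sup>2 = 2 * J x + 2 * J y - 4 * J ((1/2) *\<^sub>R (x + y))"
      unfolding power2_norm_eq_inner J_def
      by (simp add: scaleR add inner_add_left inner_add_right inner_diff_left inner_diff_right
          inner_commute algebra_simps)
    with m_le[of "(1/2) *\<^sub>R (x + y)"] show ?thesis by simp
  qed
  have "Cauchy X"
  proof (rule metric_CauchyI)
    fix e :: real assume e: "0 < e"
    obtain N where N: "4 / e\<^sup>2 < real N" using reals_Archimedean2 by blast
    have "dist (X i) (X j) < e" if "N \<le> i" "N \<le> j" for i j
    proof -
      define r where "r = 1 / real (Suc N)"
      have near: "J (X k) < m + r" if "N \<le> k" for k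
      proof -
        have "1 / real (Suc k) \<le> r" unfolding r_def using that by (intro divide_left_mono) auto
        then show ?thesis by (intro less_le_trans[OF X[of k]] add_left_mono)
      qed
      have "(norm (X i - X j))\<^sup>2 \<le> 2 * (J (X i) - m) + 2 * (J (X j) - m)" by (rule par)
      also have "\<dots> < 2 * r + 2 * r"
        using near[OF that(1)] near[OF that(2)]
        by (intro add_strict_mono mult_strict_left_mono) (simp_all add: diff_less_eq add.commute)
      also have "\<dots> = 4 / real (Suc N)" by (simp add: r_def)
      also have "\<dots> < e\<^sup>2"
      proof -
        have "4 < real N * e\<^sup>2" using N e by (simp add: field_simps)
        also have "\<dots> \<le> real (Suc N) * e\<^sup>2" by (intro mult_right_mono) auto
        finally show ?thesis by (simp add: field_simps)
      qed
      finally show ?thesis using e by (simp add: dist_norm power2_less_imp_less)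
    qed
    then show "\<exists>M. \<forall>m\<ge>M. \<forall>n\<ge>M. dist (X m) (X n) < e" by blast
  qed
  then obtain y where y: "X \<longlonglongrightarrow> y" using Cauchy_convergent convergent_def by blast
  have "(\<lambda>n. J (X n)) \<longlonglongrightarrow> J y"
    unfolding J_def using y by (intro tendsto_intros tendsto)
  moreover have "(\<lambda>n. m + 1 / real (Suc n)) \<longlonglongrightarrow> m + 0"
    by (intro tendsto_intros LIMSEQ_Suc lim_1_over_n)
  ultimately have "J y \<le> m + 0"
    using X by (intro LIMSEQ_le) (auto intro: less_imp_le)
  have "x \<bullet> y - f x = 0" for x
  proof (rule quadratic_nonneg_imp_linear_zero)
    fix t :: real
    have "J y \<le> J (y + t *\<^sub>R x)" using m_le[of "y + t *\<^sub>R x"] \<open>J y \<le> m + 0\<close> by simp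
    then show "0 \<le> 2 * t * (x \<bullet> y - f x) + t\<^sup>2 * (x \<bullet> x)"
      by (simp add: J_def add scaleR inner_add_left inner_add_right inner_commute
          algebra_simps power2_eq_square)
  qed
  then show ?thesis by (intro exI[of _ y]) auto
qed

text \<open>\<open>adjoint\<close> is defined by choice, so its characteristic property holds as
  soon as Riesz supplies some adjoint.\<close>

lemma adjoint_works_hilbert:
  fixes f :: "'a::{real_inner,complete_space} \<Rightarrow>\<^sub>L 'a"
  shows "x \<bullet> adjoint (blinfun_apply f) y = f x \<bullet> y"
proof -
  have "\<exists>w. \<forall>x. f x \<bullet> y = x \<bullet> w" for y
    by (rule riesz_representation) (intro bounded_linear_intros blinfun.bounded_linear_right)
  then have "\<exists>f'. \<forall>x y. f x \<bullet> y = x \<bullet> f' y" by metis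
  then have "\<forall>x y. f x \<bullet> y = x \<bullet> adjoint (blinfun_apply f) y"
    unfolding adjoint_def by (rule someI_ex)
  then show ?thesis by simp
qed

section \<open>Quadratic forms of positive semidefinite operators\<close>

definition psd :: "('a::real_inner \<Rightarrow>\<^sub>L 'a) \<Rightarrow> bool" where
  "psd W \<longleftrightarrow> self_adjoint W \<and> (\<forall>x. 0 \<le> W x \<bullet> x)"

lemma psdD: "psd W \<Longrightarrow> W x \<bullet> y = x \<bullet> W y" "psd W \<Longrightarrow> 0 \<le> W x \<bullet> x"
  by (auto simp: psd_def self_adjoint_def)

lemma psd_form_add:
  "psd W \<Longrightarrow> W (x + y) \<bullet> (x + y) = W x \<bullet> x + 2 * (W x \<bullet> y) + W y \<bullet> y"
  using psdD(1)[of W y x] by (simp add: blinfun.bilinear_simps inner_simps inner_commute)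

lemma psd_Cauchy_Schwarz:
  assumes "psd W"
  shows "(W x \<bullet> y)\<^sup>2 \<le> (W x \<bullet> x) * (W y \<bullet> y)"
proof -
  have q: "0 \<le> W x \<bullet> x + 2 * t * (W x \<bullet> y) + t\<^sup>2 * (W y \<bullet> y)" for t
  proof -
    have "0 \<le> W (x + t *\<^sub>R y) \<bullet> (x + t *\<^sub>R y)" by (rule psdD[OF assms])
    then show ?thesis unfolding psd_form_add[OF assms]
      by (simp add: blinfun.scaleR_right power2_eq_square algebra_simps)
  qed
  show ?thesis
  proof (cases "W y \<bullet> y = 0")
    case True
    have "W x \<bullet> y = 0"
    proof (rule ccontr)
      assume n: "W x \<bullet> y \<noteq> 0"
      \<comment> \<open>With the quadratic coefficient zero the polynomial is affine, and it equals
        -1 at this \<open>t\<close>.\<close>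
      show False using q[of "- (W x \<bullet> x + 1) / (2 * (W x \<bullet> y))"] n True by (simp add: field_simps)
    qed
    then show ?thesis using True by simp
  next
    case False
    then have pos: "W y \<bullet> y > 0" using psdD(2)[OF assms, of y] by simp
    have "0 \<le> (W x \<bullet> x + 2 * (- (W x \<bullet> y) / (W y \<bullet> y)) * (W x \<bullet> y)
        + (- (W x \<bullet> y) / (W y \<bullet> y))\<^sup>2 * (W y \<bullet> y)) * (W y \<bullet> y)"
      using q pos by (intro mult_nonneg_nonneg) (simp_all only: less_imp_le)
    also have "\<dots> = (W x \<bullet> x) * (W y \<bullet> y) - (W x \<bullet> y)\<^sup>2"
      using pos by (simp add: field_simps power2_eq_square)
    finally show ?thesis by simp
  qed
qed

text \<open>Cauchy-Schwarz for the form of \<open>W\<close> with second vector \<open>W x\<close>,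
  divided by \<open>(norm (W x))\<^sup>2\<close>. It lets the form control the vector
  \<open>W x\<close> itself.\<close>

lemma psd_norm_sq_le:
  assumes "psd W" "\<And>x. W x \<bullet> x \<le> k * (norm x)\<^sup>2"
  shows "(norm (W x))\<^sup>2 \<le> k * (W x \<bullet> x)"
proof (cases "W x = 0")
  case False
  have "(W x \<bullet> W x)\<^sup>2 \<le> (W x \<bullet> x) * (W (W x) \<bullet> W x)"
    by (rule psd_Cauchy_Schwarz[OF assms(1)])
  also have "\<dots> \<le> (W x \<bullet> x) * (k * (norm (W x))\<^sup>2)"
    using assms(2) psdD(2)[OF assms(1)] by (intro mult_left_mono) auto
  finally have "(norm (W x))\<^sup>2 * (norm (W x))\<^sup>2 \<le> (k * (W x \<bullet> x)) * (norm (W x))\<^sup>2"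
    by (simp add: power2_norm_eq_inner) (simp add: power2_eq_square algebra_simps)
  moreover have "0 < (norm (W x))\<^sup>2" using False by simp
  ultimately show ?thesis by (rule mult_right_le_imp_le)
qed simp

lemma psd_norm_le:
  assumes "psd W" "\<And>x. W x \<bullet> x \<le> k * (norm x)\<^sup>2" "0 \<le> k"
  shows "norm W \<le> k"
proof (rule norm_blinfun_bound[OF \<open>0 \<le> k\<close>])
  fix x
  have "(norm (W x))\<^sup>2 \<le> k * (W x \<bullet> x)" by (rule psd_norm_sq_le[OF assms(1,2)])
  also have "\<dots> \<le> k * (k * (norm x)\<^sup>2)" using assms by (intro mult_left_mono) auto
  finally have "(norm (W x))\<^sup>2 \<le> (k * norm x)\<^sup>2" by (simp add: power2_eq_square algebra_simps)
  then show "norm (W x) \<le> k * norm x" by (rule power2_le_imp_le) (simp add: assms(3))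
qed

lemma blinfun_form_le: "(W :: 'a::real_inner \<Rightarrow>\<^sub>L 'a) x \<bullet> x \<le> norm W * (norm x)\<^sup>2"
proof -
  have "W x \<bullet> x \<le> norm (W x) * norm x" by (rule norm_cauchy_schwarz)
  also have "\<dots> \<le> (norm W * norm x) * norm x" by (intro mult_right_mono norm_blinfun) auto
  finally show ?thesis by (simp add: power2_eq_square algebra_simps)
qed

section \<open>Square roots of bounded positive operators\<close>

text \<open>Solving \<open>(I - Y)\<^sup>2 = I - C\<close> by the iteration \<open>Y \<mapsto> (C + Y\<^sup>2) / 2\<close>. Its increments are dominated
  in norm by those of the scalar iteration for \<open>c = 1\<close>, which increases to 1.\<close>

primrec sqrt_iter :: "('a::real_inner \<Rightarrow>\<^sub>L 'a) \<Rightarrow> nat \<Rightarrow> 'a \<Rightarrow>\<^sub>L 'a" where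
  "sqrt_iter C 0 = 0"
| "sqrt_iter C (Suc n) = (1/2) *\<^sub>R (C + (sqrt_iter C n o\<^sub>L sqrt_iter C n))"

primrec scalar_iter :: "nat \<Rightarrow> real" where
  "scalar_iter 0 = 0"
| "scalar_iter (Suc n) = (1 + (scalar_iter n)\<^sup>2) / 2"

lemma scalar_iter_bounds: "0 \<le> scalar_iter n \<and> scalar_iter n \<le> 1"
proof (induction n)
  case (Suc n)
  then have "(scalar_iter n)\<^sup>2 \<le> 1" by (simp add: power_le_one)
  then show ?case by simp
qed simp

lemma scalar_iter_mono: "scalar_iter n \<le> scalar_iter (Suc n)"
  using sum_squares_bound[of 1 "scalar_iter n"] by simp

text \<open>Every iterate is a polynomial in \<open>C\<close>, so whatever commutes with
  \<open>C\<close> commutes with it. In the limit this becomes the commutation clause of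
  \<open>psd_sqrt_exists\<close>.\<close>

lemma sqrt_iter_commute:
  fixes S C :: "'a::real_inner \<Rightarrow>\<^sub>L 'a"
  assumes "\<And>x. S (C x) = C (S x)"
  shows "S (sqrt_iter C n x) = sqrt_iter C n (S x)"
  by (induction n arbitrary: x) (simp_all add: assms blinfun.bilinear_simps)

lemma sqrt_iter_commute_self: "sqrt_iter C m (sqrt_iter C n x) = sqrt_iter C n (sqrt_iter C m x)"
  by (rule sqrt_iter_commute) (metis sqrt_iter_commute)

lemma sqrt_iter_selfadjoint:
  assumes "self_adjoint C"
  shows "sqrt_iter C n x \<bullet> y = x \<bullet> sqrt_iter C n y"
proof (induction n arbitrary: x y)
  case (Suc n)
  then show ?case using assms
    by (simp add: self_adjoint_def blinfun.scaleR_left blinfun.add_left inner_add_left inner_add_right)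
qed (simp add: blinfun.bilinear_simps)

lemma sqrt_iter_norm_le:
  assumes "norm C \<le> 1"
  shows "norm (sqrt_iter C n) \<le> scalar_iter n"
proof (induction n)
  case (Suc n)
  have "norm (C + (sqrt_iter C n o\<^sub>L sqrt_iter C n))
      \<le> norm C + norm (sqrt_iter C n) * norm (sqrt_iter C n)"
    using norm_triangle_ineq[of C "sqrt_iter C n o\<^sub>L sqrt_iter C n"]
      norm_blinfun_compose[of "sqrt_iter C n" "sqrt_iter C n"] by linarith
  also have "\<dots> \<le> 1 + (scalar_iter n)\<^sup>2"
    unfolding power2_eq_square using assms Suc scalar_iter_bounds[of n]
    by (intro add_mono mult_mono) auto
  finally show ?case by simp
qed simp

text \<open>The iterates commute, so the difference of two squares factors into sum times
  difference; the scalar iteration satisfies the same recursion with equality.\<close>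

lemma sqrt_iter_increment:
  assumes "norm C \<le> 1"
  shows "norm (sqrt_iter C (Suc n) - sqrt_iter C n) \<le> scalar_iter (Suc n) - scalar_iter n"
proof (induction n)
  case 0
  then show ?case using assms by simp
next
  case (Suc n)
  let ?Y = "sqrt_iter C" and ?y = "scalar_iter"
  have "?Y (Suc (Suc n)) - ?Y (Suc n)
      = (1/2) *\<^sub>R ((?Y (Suc n) o\<^sub>L ?Y (Suc n)) - (?Y n o\<^sub>L ?Y n))"
    by (simp only: sqrt_iter.simps(2)[of C "Suc n"])
       (simp add: scaleR_diff_right scaleR_right_distrib)
  also have "\<dots> = (1/2) *\<^sub>R ((?Y (Suc n) + ?Y n) o\<^sub>L (?Y (Suc n) - ?Y n))"
    by (intro arg_cong[where f="scaleR (1/2)"] blinfun_eqI)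
       (simp only: blinfun.bilinear_simps blinfun_apply_blinfun_compose
          sqrt_iter_commute_self[of C n "Suc n"], simp)
  finally have "norm (?Y (Suc (Suc n)) - ?Y (Suc n))
      = (1/2) * norm ((?Y (Suc n) + ?Y n) o\<^sub>L (?Y (Suc n) - ?Y n))"
    by simp
  also have "\<dots> \<le> (1/2) * ((norm (?Y (Suc n)) + norm (?Y n)) * norm (?Y (Suc n) - ?Y n))"
    by (intro mult_left_mono order.trans[OF norm_blinfun_compose] mult_right_mono norm_triangle_ineq)
       auto
  also have "\<dots> \<le> (1/2) * ((?y (Suc n) + ?y n) * (?y (Suc n) - ?y n))"
    using sqrt_iter_norm_le[OF assms] Suc scalar_iter_bounds[of n] scalar_iter_bounds[of "Suc n"]
    by (intro mult_left_mono mult_mono add_mono) (auto simp del: scalar_iter.simps sqrt_iter.simps)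
  also have "\<dots> = ?y (Suc (Suc n)) - ?y (Suc n)"
    by (simp only: scalar_iter.simps(2)[of "Suc n"])
       (simp add: power2_eq_square algebra_simps)
  finally show ?case .
qed

lemma sqrt_iter_Cauchy:
  assumes "norm C \<le> 1" "n \<le> m"
  shows "norm (sqrt_iter C m - sqrt_iter C n) \<le> scalar_iter m - scalar_iter n"
  using assms(2)
proof (induction m rule: dec_induct)
  case (step m)
  have "norm (sqrt_iter C (Suc m) - sqrt_iter C n)
      \<le> norm (sqrt_iter C (Suc m) - sqrt_iter C m) + norm (sqrt_iter C m - sqrt_iter C n)"
    using norm_triangle_ineq[of "sqrt_iter C (Suc m) - sqrt_iter C m" "sqrt_iter C m - sqrt_iter C n"]
    by simp
  then show ?case using sqrt_iter_increment[OF assms(1), of m] step.IH by linarith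
qed simp

lemma blinfun_pointwise_limit:
  fixes Y :: "nat \<Rightarrow> 'a::{real_inner,complete_space} \<Rightarrow>\<^sub>L 'a"
  assumes cauchy: "\<And>x. Cauchy (\<lambda>n. Y n x)" and bound: "\<And>n. norm (Y n) \<le> K"
  shows "\<exists>L. (\<forall>x. (\<lambda>n. Y n x) \<longlonglongrightarrow> blinfun_apply L x) \<and> norm L \<le> K"
proof -
  define l where "l x = lim (\<lambda>n. Y n x)" for x
  have l: "(\<lambda>n. Y n x) \<longlonglongrightarrow> l x" for x
    using Cauchy_convergent[OF cauchy, of x] by (simp add: l_def convergent_LIMSEQ_iff)
  have K: "0 \<le> K" using bound[of 0] norm_ge_zero order.trans by blast
  have nl: "norm (l x) \<le> K * norm x" for x
    by (rule LIMSEQ_le_const2[OF tendsto_norm[OF l]])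
       (use bound norm_blinfun[of "Y _" x] in \<open>meson mult_right_mono norm_ge_zero order.trans\<close>)
  have bl: "bounded_linear l"
  proof (rule bounded_linear_intro[where K=K])
    fix x y
    have "(\<lambda>n. Y n x + Y n y) \<longlonglongrightarrow> l x + l y" by (intro tendsto_add l)
    then show "l (x + y) = l x + l y"
      using l[of "x + y"] LIMSEQ_unique by (simp add: blinfun.bilinear_simps) blast
  next
    fix r x
    have "(\<lambda>n. r *\<^sub>R Y n x) \<longlonglongrightarrow> r *\<^sub>R l x" by (intro tendsto_intros l)
    then show "l (r *\<^sub>R x) = r *\<^sub>R l x"
      using l[of "r *\<^sub>R x"] LIMSEQ_unique by (simp add: blinfun.bilinear_simps) blast
  qed (use nl in \<open>simp add: mult.commute\<close>)
  have "norm (Blinfun l) \<le> K"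
    by (rule norm_blinfun_bound[OF K]) (simp add: bounded_linear_Blinfun_apply[OF bl] nl)
  then show ?thesis
    using l by (intro exI[of _ "Blinfun l"]) (simp add: bounded_linear_Blinfun_apply[OF bl])
qed

text \<open>The last clause is kept for uniqueness: any other positive root commutes with its square
  \<open>B\<close>, hence with this root.\<close>

lemma psd_sqrt_exists:
  fixes B :: "'a::{real_inner,complete_space} \<Rightarrow>\<^sub>L 'a"
  assumes "psd B"
  shows "\<exists>R. psd R \<and> R o\<^sub>L R = B \<and>
    (\<forall>S. (\<forall>y. blinfun_apply S (B y) = B (S y)) \<longrightarrow> (\<forall>x. S (R x) = R (S x)))"
proof -
  \<comment> \<open>Then \<open>0 \<le> B \<le> \<beta>\<close> as forms, so
    \<open>C = I - B / \<beta>\<close> has norm at most 1; the root of \<open>B\<close> is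
    \<open>sqrt \<beta>\<close> times the root \<open>I - L\<close> of \<open>I - C\<close>.\<close>
  define \<beta> where "\<beta> = norm B + 1"
  have \<beta>: "\<beta> > 0" by (simp add: \<beta>_def add_nonneg_pos)
  define C where "C = id_blinfun - (1/\<beta>) *\<^sub>R B"
  have C: "C x = x - (1/\<beta>) *\<^sub>R B x" for x by (simp add: C_def blinfun.bilinear_simps)
  have B_le: "B x \<bullet> x \<le> \<beta> * (norm x)\<^sup>2" for x
    using blinfun_form_le[of B x] by (simp add: \<beta>_def algebra_simps add_increasing)
  have psdC: "psd C"
    using psdD[OF assms] B_le \<beta>
    by (auto simp: psd_def self_adjoint_def C inner_simps power2_norm_eq_inner field_simps)
  have C1: "norm C \<le> 1"
    using psdD(2)[OF assms] \<beta>
    by (intro psd_norm_le psdC) (auto simp: C inner_simps power2_norm_eq_inner)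
  let ?Y = "sqrt_iter C"
  have "Cauchy scalar_iter"
  proof -
    have "incseq scalar_iter" by (rule incseq_SucI) (rule scalar_iter_mono)
    from incseq_convergent[OF this, of 1] obtain l where "scalar_iter \<longlonglongrightarrow> l"
      using scalar_iter_bounds by blast
    then show ?thesis by (rule LIMSEQ_imp_Cauchy)
  qed
  have "Cauchy (\<lambda>n. ?Y n x)" for x
  proof (rule metric_CauchyI)
    fix e :: real assume e: "0 < e"
    then have "0 < e / (norm x + 1)" by (simp add: add_nonneg_pos)
    then obtain N where N: "\<And>i j. i \<ge> N \<Longrightarrow> j \<ge> N \<Longrightarrow> dist (scalar_iter i) (scalar_iter j) < e / (norm x + 1)"
      using \<open>Cauchy scalar_iter\<close> by (meson metric_CauchyD)
    have *: "dist (?Y i x) (?Y j x) < e" if "N \<le> j" "j \<le> i" for i j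
    proof -
      have "norm (?Y i - ?Y j) \<le> e / (norm x + 1)"
        using sqrt_iter_Cauchy[OF C1 that(2)] N[of i j] that by (simp add: dist_real_def)
      then have "norm ((?Y i - ?Y j) x) \<le> e / (norm x + 1) * norm x"
        by (meson norm_blinfun mult_right_mono norm_ge_zero order.trans)
      also have "\<dots> < e"
      proof -
        have "e * norm x < e * (norm x + 1)" using e by simp
        then show ?thesis by (simp add: pos_divide_less_eq add_nonneg_pos)
      qed
      finally show ?thesis by (simp add: dist_norm blinfun.bilinear_simps)
    qed
    show "\<exists>M. \<forall>m\<ge>M. \<forall>n\<ge>M. dist (?Y m x) (?Y n x) < e"
    proof (intro exI allI impI)
      fix i j assume "N \<le> i" "N \<le> j"
      then show "dist (?Y i x) (?Y j x) < e"
        using *[of i j] *[of j i] by (cases "j \<le> i") (auto simp: dist_commute)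
    qed
  qed
  moreover have "norm (?Y n) \<le> 1" for n
    using sqrt_iter_norm_le[OF C1, of n] scalar_iter_bounds[of n] by linarith
  ultimately obtain L where L: "\<And>x. (\<lambda>n. ?Y n x) \<longlonglongrightarrow> blinfun_apply L x" and L1: "norm L \<le> 1"
    using blinfun_pointwise_limit[of ?Y 1] by blast
  have L_comm: "S (L x) = L (S x)" if "\<And>y. blinfun_apply S (B y) = B (S y)" for S x
  proof -
    have "S (C y) = C (S y)" for y by (simp add: C blinfun.bilinear_simps that)
    then have "(\<lambda>n. S (?Y n x)) = (\<lambda>n. ?Y n (S x))" by (simp add: sqrt_iter_commute)
    moreover have "(\<lambda>n. S (?Y n x)) \<longlonglongrightarrow> S (L x)"
      by (intro blinfun.tendsto tendsto_const L)
    ultimately show ?thesis using L[of "S x"] by (simp add: LIMSEQ_unique)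
  qed
  have L_sa: "L x \<bullet> y = x \<bullet> L y" for x y
  proof -
    have "(\<lambda>n. ?Y n x \<bullet> y) \<longlonglongrightarrow> L x \<bullet> y" "(\<lambda>n. x \<bullet> ?Y n y) \<longlonglongrightarrow> x \<bullet> L y"
      by (intro tendsto_intros L)+
    moreover have "self_adjoint C" using psdC by (simp add: psd_def)
    ultimately show ?thesis using LIMSEQ_unique by (simp add: sqrt_iter_selfadjoint)
  qed
  have L_eq: "L x = (1/2) *\<^sub>R (C x + L (L x))" for x
  proof -
    \<comment> \<open>Strong convergence passes to the square because the iterates are uniformly
      bounded: \<open>?Y n (?Y n x) - ?Y n (L x)\<close> tends to 0.\<close>
    have "(\<lambda>n. ?Y n (?Y n x)) \<longlonglongrightarrow> L (L x)"
    proof -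
      have "(\<lambda>n. ?Y n (?Y n x - L x)) \<longlonglongrightarrow> 0"
      proof (rule tendsto_norm_zero_cancel, rule tendsto_sandwich[where f="\<lambda>_. 0" and h="\<lambda>n. norm (?Y n x - L x)"])
        show "\<forall>\<^sub>F n in sequentially. norm (?Y n (?Y n x - L x)) \<le> norm (?Y n x - L x)"
          by (rule always_eventually)
             (meson \<open>\<And>n. norm (?Y n) \<le> 1\<close> norm_blinfun mult_left_le_one_le norm_ge_zero order.trans)
        show "(\<lambda>n. norm (?Y n x - L x)) \<longlonglongrightarrow> 0"
          using L[of x] by (simp add: LIM_zero tendsto_norm_zero)
      qed auto
      from tendsto_add[OF this L[of "L x"]] show ?thesis by (simp add: blinfun.bilinear_simps)
    qed
    then have "(\<lambda>n. (1/2) *\<^sub>R (C x + ?Y n (?Y n x))) \<longlonglongrightarrow> (1/2) *\<^sub>R (C x + L (L x))"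
      by (rule tendsto_scaleR[OF tendsto_const tendsto_add[OF tendsto_const]])
    then have "(\<lambda>n. ?Y (Suc n) x) \<longlonglongrightarrow> (1/2) *\<^sub>R (C x + L (L x))"
      by (simp add: blinfun.scaleR_left blinfun.add_left)
    moreover have "(\<lambda>n. ?Y (Suc n) x) \<longlonglongrightarrow> L x" by (rule LIMSEQ_Suc[OF L])
    ultimately show ?thesis by (simp add: LIMSEQ_unique)
  qed
  define R where "R = sqrt \<beta> *\<^sub>R (id_blinfun - L)"
  have R: "R x = sqrt \<beta> *\<^sub>R (x - L x)" for x by (simp add: R_def blinfun.bilinear_simps)
  have "psd R"
  proof -
    have "L x \<bullet> x \<le> x \<bullet> x" for x
      using blinfun_form_le[of L x] L1 mult_right_mono[OF L1, of "(norm x)\<^sup>2"]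
      by (simp add: power2_norm_eq_inner)
    then show ?thesis using \<beta> by (auto simp: psd_def self_adjoint_def R inner_simps L_sa)
  qed
  moreover have "R o\<^sub>L R = B"
  proof (rule blinfun_eqI)
    fix x
    have "L x + L x = C x + L (L x)" using L_eq[of x]
      by (metis scaleR_half_double scaleR_right_distrib)
    then have *: "L (L x) = L x + L x - C x" by simp
    have "(R o\<^sub>L R) x = \<beta> *\<^sub>R (x - L x - (L x - L (L x)))"
      using \<beta> by (simp add: R blinfun.bilinear_simps scaleR_diff_right)
    also have "\<dots> = \<beta> *\<^sub>R (x - C x)" by (simp add: *)
    also have "\<dots> = B x" using \<beta> by (simp add: C)
    finally show "(R o\<^sub>L R) x = B x" .
  qed
  moreover have "S (R x) = R (S x)" if "\<And>y. blinfun_apply S (B y) = B (S y)" for S x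
    by (simp add: R blinfun.bilinear_simps L_comm[OF that])
  ultimately show ?thesis by (intro exI[of _ R]) simp
qed

text \<open>Makes the definite description in \<open>op_sqrt\<close> explicit. If \<open>S\<close>
  and \<open>R\<close> are commuting positive roots and \<open>d = S x - R x\<close>, then
  \<open>(S + R) d = 0\<close>, so both forms vanish at \<open>d\<close>; hence
  \<open>B d = 0\<close>, and injectivity gives \<open>d = 0\<close>.\<close>

lemma norm_m1_eq:
  fixes B :: "'a::{real_inner,complete_space} \<Rightarrow>\<^sub>L 'a"
  assumes "psd B" and inj: "\<And>x. B x = 0 \<Longrightarrow> x = 0"
  shows "norm_m1 B x = sqrt (B x \<bullet> x)"
proof -
  obtain R where R: "psd R" "R o\<^sub>L R = B"
    and comm: "\<And>S x. (\<And>y. blinfun_apply S (B y) = B (S y)) \<Longrightarrow> S (R x) = R (S x)"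
    using psd_sqrt_exists[OF assms(1)] by auto
  have RR: "R (R x) = B x" for x using R(2) by (metis blinfun_apply_blinfun_compose)
  have uniq: "S = R" if S: "psd S" "S o\<^sub>L S = B" for S
  proof (rule blinfun_eqI)
    fix x
    have SS: "S (S x) = B x" for x using S(2) by (metis blinfun_apply_blinfun_compose)
    have SR: "S (R x) = R (S x)" for x by (rule comm) (metis SS)
    define d where "d = S x - R x"
    have "S d + R d = 0" by (simp add: d_def blinfun.bilinear_simps SS RR SR)
    then have "S d \<bullet> d + R d \<bullet> d = 0" by (metis inner_add_left inner_zero_left)
    then have "R d \<bullet> d = 0" using psdD(2)[OF R(1), of d] psdD(2)[OF S(1), of d] by linarith
    then have "(norm (R d))\<^sup>2 \<le> 0"
      using psd_norm_sq_le[OF R(1) blinfun_form_le, of d] by simp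
    then have "B d = 0" by (simp flip: RR)
    then show "S x = R x" using inj[of d] by (simp add: d_def)
  qed
  have "op_sqrt B = R"
    unfolding op_sqrt_def
  proof (rule the_equality)
    show "self_adjoint R \<and> (\<forall>x. 0 \<le> R x \<bullet> x) \<and> R o\<^sub>L R = B"
      using R(1) by (simp add: psd_def R(2))
  next
    fix S assume "self_adjoint S \<and> (\<forall>x. 0 \<le> blinfun_apply S x \<bullet> x) \<and> S o\<^sub>L S = B"
    then show "S = R" by (intro uniq) (auto simp: psd_def)
  qed
  then have "(norm_m1 B x)\<^sup>2 = B x \<bullet> x"
    using psdD(1)[OF R(1), of "R x" x] by (simp add: norm_m1_def power2_norm_eq_inner RR)
  then show ?thesis by (metis norm_ge_zero norm_m1_def real_sqrt_unique)
qed

section \<open>Regularisation and weak limits\<close>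

primrec blinfun_pow :: "('a::real_normed_vector \<Rightarrow>\<^sub>L 'a) \<Rightarrow> nat \<Rightarrow> 'a \<Rightarrow>\<^sub>L 'a" where
  "blinfun_pow C 0 = id_blinfun"
| "blinfun_pow C (Suc m) = C o\<^sub>L blinfun_pow C m"

lemma blinfun_pow_commute:
  fixes S C :: "'a::real_normed_vector \<Rightarrow>\<^sub>L 'a"
  assumes "\<And>x. S (C x) = C (S x)"
  shows "S (blinfun_pow C m x) = blinfun_pow C m (S x)"
  by (induction m) (simp_all add: assms)

lemma blinfun_pow_add: "blinfun_pow C (m + k) x = blinfun_pow C m (blinfun_pow C k x)"
  by (induction m) simp_all

lemma blinfun_pow_selfadjoint:
  assumes "self_adjoint C"
  shows "blinfun_pow C m x \<bullet> y = x \<bullet> blinfun_pow C m y"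
proof (induction m arbitrary: x y)
  case (Suc m)
  have "blinfun_pow C (Suc m) x \<bullet> y = x \<bullet> blinfun_pow C m (C y)"
    using assms by (simp add: self_adjoint_def Suc)
  then show ?case by (simp add: blinfun_pow_commute)
qed simp

lemma blinfun_pow_norm_le: "norm C \<le> 1 \<Longrightarrow> norm (blinfun_pow C m x) \<le> norm x"
proof (induction m)
  case (Suc m)
  have "norm (C (blinfun_pow C m x)) \<le> norm C * norm (blinfun_pow C m x)" by (rule norm_blinfun)
  also have "\<dots> \<le> 1 * norm x" using Suc by (intro mult_mono) auto
  finally show ?case by simp
qed simp

locale pos_operator =
  fixes B :: "'a::{real_inner,complete_space} \<Rightarrow>\<^sub>L 'a"
  assumes B_selfadj: "self_adjoint B"
    and B_pos: "\<And>x. x \<noteq> 0 \<Longrightarrow> 0 < B x \<bullet> x"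
begin

lemma psd_B: "psd B"
  unfolding psd_def using B_selfadj B_pos
  by (metis inner_zero_right less_imp_le order_refl)

lemmas B_adj = psdD(1)[OF psd_B]

lemma B_inj: "B x = 0 \<Longrightarrow> x = 0"
  using B_pos[of x] by auto

definition "nm x = sqrt (B x \<bullet> x)"

lemma norm_m1_nm: "norm_m1 B x = nm x"
  unfolding nm_def by (rule norm_m1_eq[OF psd_B B_inj])

text \<open>The added 1 keeps \<open>\<beta>\<close> positive in every case, so that
  \<open>B\<close> can be divided by it.\<close>

definition "\<beta> = norm B + 1"

definition "b = sqrt \<beta>"

lemma \<beta>_pos: "0 < \<beta>" "1 \<le> \<beta>" by (auto simp: \<beta>_def add_nonneg_pos)

lemma b_pos: "0 < b" "b\<^sup>2 = \<beta>" using \<beta>_pos by (auto simp: b_def)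

lemma B_form_le: "B x \<bullet> x \<le> \<beta> * (norm x)\<^sup>2"
  using blinfun_form_le[of B x] by (simp add: \<beta>_def algebra_simps add_increasing)

lemma B_norm_sq_le: "(norm (B x))\<^sup>2 \<le> \<beta> * (B x \<bullet> x)"
  by (rule psd_norm_sq_le[OF psd_B B_form_le])

lemma nm_sq: "(nm x)\<^sup>2 = B x \<bullet> x"
  using psdD(2)[OF psd_B, of x] by (simp add: nm_def)

lemma nm_nonneg: "0 \<le> nm x" using psdD(2)[OF psd_B, of x] by (simp add: nm_def)

lemma nm_le: "nm x \<le> b * norm x"
  by (rule power2_le_imp_le) (use B_form_le[of x] b_pos in \<open>simp_all add: nm_sq power_mult_distrib\<close>)

lemma B_norm_le_nm: "norm (B x) \<le> b * nm x"
  by (rule power2_le_imp_le)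
     (use B_norm_sq_le[of x] b_pos nm_nonneg[of x] in \<open>simp_all add: nm_sq power_mult_distrib\<close>)

lemma nm_zero: "nm 0 = 0" by (simp add: nm_def)

text \<open>A positive nonexpansive operator whose only fixed points are the zeros of
  \<open>B\<close>; its powers are the gap between \<open>J\<^sub>m\<close> and the
  identity.\<close>

definition "C = id_blinfun - (1/\<beta>) *\<^sub>R B"

lemma C_apply: "C x = x - (1/\<beta>) *\<^sub>R B x"
  by (simp add: C_def blinfun.bilinear_simps)

lemma psd_C: "psd C"
  using B_adj B_form_le \<beta>_pos
  by (auto simp: psd_def self_adjoint_def C_apply inner_simps power2_norm_eq_inner field_simps)

lemma C_norm: "norm C \<le> 1"
  using psdD(2)[OF psd_B] \<beta>_pos
  by (intro psd_norm_le psd_C) (auto simp: C_apply inner_simps power2_norm_eq_inner)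

abbreviation "Cp m \<equiv> blinfun_pow C m"

lemmas Cp_norm_le = blinfun_pow_norm_le[OF C_norm]

lemma Cp_adj: "Cp m x \<bullet> y = x \<bullet> Cp m y"
  using psd_C by (intro blinfun_pow_selfadjoint) (simp add: psd_def)

lemma B_Cp: "B (Cp m x) = Cp m (B x)"
  by (rule blinfun_pow_commute) (simp add: C_apply blinfun.bilinear_simps)

text \<open>Splitting the power into two halves and moving one to the other side leaves a squared
  norm for even \<open>m\<close> and the form of \<open>C\<close> for odd \<open>m\<close>.\<close>

lemma Cp_form_nonneg: "0 \<le> Cp m x \<bullet> x"
proof (cases "even m")
  case True
  then obtain k where "m = k + k" by (metis evenE mult_2)
  then have "Cp m x \<bullet> x = Cp k x \<bullet> Cp k x" by (simp add: blinfun_pow_add Cp_adj)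
  then show ?thesis by simp
next
  case False
  then obtain k where "m = Suc (k + k)" by (metis oddE mult_2 Suc_eq_plus1)
  then have "Cp m x \<bullet> x = C (Cp k (Cp k x)) \<bullet> x" by (simp add: blinfun_pow_add)
  also have "\<dots> = C (Cp k x) \<bullet> Cp k x"
    using blinfun_pow_commute[of C C k "Cp k x"] by (simp add: Cp_adj)
  finally show ?thesis using psdD(2)[OF psd_C] by simp
qed

lemma Cp_Suc: "Cp (Suc m) x = Cp m x - (1/\<beta>) *\<^sub>R Cp m (B x)"
  by (simp add: C_apply B_Cp)

text \<open>The same halving leaves the form of \<open>B\<close> for even \<open>m\<close> and
  \<open>B y \<bullet> C y\<close> for odd \<open>m\<close>; the latter is nonnegative because
  \<open>(norm (B y))\<^sup>2 \<le> \<beta> * (B y \<bullet> y)\<close>.\<close>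

lemma CpB_form_nonneg: "0 \<le> Cp m (B x) \<bullet> x"
proof (cases "even m")
  case True
  then obtain k where "m = k + k" by (metis evenE mult_2)
  then have "Cp m (B x) \<bullet> x = B (Cp k x) \<bullet> Cp k x" by (simp add: blinfun_pow_add Cp_adj B_Cp)
  then show ?thesis using psdD(2)[OF psd_B] by simp
next
  case False
  then obtain k where m: "m = Suc (k + k)" by (metis oddE mult_2 Suc_eq_plus1)
  have BC: "0 \<le> B y \<bullet> C y" for y
    using B_norm_sq_le[of y] \<beta>_pos
    by (simp add: C_apply inner_simps power2_norm_eq_inner[symmetric] field_simps)
  have "Cp m (B x) \<bullet> x = C (Cp k (Cp k (B x))) \<bullet> x" by (simp add: m blinfun_pow_add)
  also have "\<dots> = Cp k (B x) \<bullet> Cp k (C x)" by (simp only: psdD(1)[OF psd_C] Cp_adj)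
  also have "\<dots> = Cp k (B x) \<bullet> C (Cp k x)" by (simp only: blinfun_pow_commute[of C C])
  finally show ?thesis using BC[of "Cp k x"] by (simp add: B_Cp)
qed

lemma Cp_form_decreasing: "decseq (\<lambda>m. Cp m x \<bullet> x)"
proof (rule decseq_SucI)
  fix m
  show "Cp (Suc m) x \<bullet> x \<le> Cp m x \<bullet> x"
    using CpB_form_nonneg[of m x] \<beta>_pos unfolding Cp_Suc by (simp add: inner_diff_left)
qed

text \<open>The squared distance of two terms is a second difference of the convergent sequence
  \<open>\<langle>C\<^sup>m x, x\<rangle>\<close>, and a limit is a fixed point of \<open>C\<close>, that is, a zero of \<open>B\<close>.\<close>

lemma Cp_tendsto_zero: "(\<lambda>m. Cp m x) \<longlonglongrightarrow> 0"
proof -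
  define a where "a m = Cp m x \<bullet> x" for m
  have "decseq a" unfolding a_def by (rule Cp_form_decreasing)
  moreover have "0 \<le> a m" for m by (simp add: a_def Cp_form_nonneg)
  ultimately obtain l where l: "a \<longlonglongrightarrow> l" "\<And>i. l \<le> a i"
    using decseq_convergent[of a 0] by blast
  have dist_sq: "(norm (Cp m x - Cp k x))\<^sup>2 = a (m + m) + a (k + k) - 2 * a (m + k)" for m k
  proof -
    have *: "Cp i x \<bullet> Cp j x = a (i + j)" for i j
      unfolding a_def inner_commute[of _ x] by (simp only: Cp_adj blinfun_pow_add)
    show ?thesis
      by (simp add: power2_norm_eq_inner inner_diff_left inner_diff_right * add.commute)
  qed
  have "Cauchy (\<lambda>m. Cp m x)"
  proof (rule metric_CauchyI)
    fix e :: real assume e: "0 < e"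
    then obtain N where N: "\<And>m. m \<ge> N \<Longrightarrow> \<bar>a m - l\<bar> < e\<^sup>2 / 2"
      using l(1) LIMSEQ_D[of a l "e\<^sup>2/2"] by auto
    have "dist (Cp m x) (Cp k x) < e" if "m \<ge> N" "k \<ge> N" for m k
    proof -
      have "(norm (Cp m x - Cp k x))\<^sup>2 < e\<^sup>2"
        unfolding dist_sq using N[of "m + m"] N[of "k + k"] l(2)[of "m + k"] that by linarith
      then show ?thesis using e by (simp add: dist_norm power2_less_imp_less)
    qed
    then show "\<exists>M. \<forall>m\<ge>M. \<forall>n\<ge>M. dist (Cp m x) (Cp n x) < e" by blast
  qed
  then obtain y where y: "(\<lambda>m. Cp m x) \<longlonglongrightarrow> y" using Cauchy_convergent convergent_def by blast
  have "(\<lambda>m. C (Cp m x)) \<longlonglongrightarrow> C y" by (intro blinfun.tendsto tendsto_const y)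
  moreover have "(\<lambda>m. C (Cp m x)) \<longlonglongrightarrow> y" using LIMSEQ_Suc[OF y] by simp
  ultimately have "C y = y" by (rule LIMSEQ_unique)
  then have "B y = 0" using \<beta>_pos by (simp add: C_apply)
  then show ?thesis using y B_inj[of y] by simp
qed

text \<open>\<open>W\<^sub>m B = I - C\<^sup>m\<close> is the operator \<open>J\<^sub>m\<close> that regularises the form of \<open>B\<close>.\<close>

definition "Wm m = (1/\<beta>) *\<^sub>R (\<Sum>k<m. Cp k)"

lemma Wm_apply: "Wm m x = (1/\<beta>) *\<^sub>R (\<Sum>k<m. Cp k x)"
  by (simp add: Wm_def blinfun.bilinear_simps blinfun.sum_left)

text \<open>A telescoping geometric sum, since \<open>I - C = B / \<beta>\<close>.\<close>

lemma Wm_B: "Wm m (B x) = x - Cp m x"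
proof (induction m)
  case (Suc m)
  have "Wm (Suc m) (B x) = Wm m (B x) + (1/\<beta>) *\<^sub>R Cp m (B x)"
    by (simp add: Wm_apply scaleR_add_right)
  then show ?case by (simp only: Suc Cp_Suc) simp
qed (simp add: Wm_apply)

lemma B_Wm: "B (Wm m x) = x - Cp m x"
proof -
  have "B (Wm m x) = Wm m (B x)"
    by (simp add: Wm_apply blinfun.scaleR_right blinfun.sum_right B_Cp)
  then show ?thesis by (simp add: Wm_B)
qed

lemma psd_Wm: "psd (Wm m)"
proof -
  have "Wm m x \<bullet> y = x \<bullet> Wm m y" for x y
    by (simp add: Wm_apply inner_sum_left inner_sum_right Cp_adj)
  moreover have "0 \<le> Wm m x \<bullet> x" for x
    using \<beta>_pos Cp_form_nonneg by (simp add: Wm_apply inner_sum_left sum_nonneg)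
  ultimately show ?thesis by (simp add: psd_def self_adjoint_def)
qed

lemma Wm_form: "Wm m (B x) \<bullet> B x = B x \<bullet> x - Cp m (B x) \<bullet> x"
proof -
  have "Cp m x \<bullet> B x = Cp m (B x) \<bullet> x" by (simp only: B_adj[symmetric] B_Cp)
  moreover have "x \<bullet> B x = B x \<bullet> x" by (rule inner_commute)
  ultimately show ?thesis by (simp only: Wm_B inner_diff_left)
qed

text \<open>The terms \<open>Cp k (B x) \<bullet> x\<close> decrease in \<open>k\<close>, and the
  first \<open>m + 1\<close> of them telescope to at most \<open>\<beta> * (norm x)\<^sup>2\<close>,
  so the last is at most their mean. This gives a rate that is uniform on bounded sets, beyond the
  pointwise convergence of \<open>Cp m\<close>.\<close>

lemma CpB_form_le: "Cp m (B x) \<bullet> x \<le> \<beta> / (real m + 1) * (norm x)\<^sup>2"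
proof -
  have dec: "decseq (\<lambda>k. Cp k (B x) \<bullet> x)"
  proof (rule decseq_SucI)
    fix k
    have "Cp k (B (B x)) \<bullet> x = Cp k (B x) \<bullet> B x" by (simp add: B_Cp[symmetric] B_adj)
    then have "0 \<le> Cp k (B (B x)) \<bullet> x" using Cp_form_nonneg by simp
    then show "Cp (Suc k) (B x) \<bullet> x \<le> Cp k (B x) \<bullet> x"
      using \<beta>_pos by (simp only: Cp_Suc) (simp add: inner_simps)
  qed
  have "(real m + 1) * (Cp m (B x) \<bullet> x) = (\<Sum>k<Suc m. Cp m (B x) \<bullet> x)" by simp
  also have "\<dots> \<le> (\<Sum>k<Suc m. Cp k (B x) \<bullet> x)"
    by (intro sum_mono decseqD[OF dec]) auto
  also have "\<dots> = \<beta> * (Wm (Suc m) (B x) \<bullet> x)"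
    using \<beta>_pos by (simp only: Wm_apply inner_scaleR_left inner_sum_left) simp
  also have "\<dots> \<le> \<beta> * (norm x)\<^sup>2"
    using \<beta>_pos Cp_form_nonneg[of "Suc m" x]
    by (intro mult_left_mono) (auto simp only: Wm_B inner_diff_left power2_norm_eq_inner)
  finally show ?thesis by (simp add: field_simps)
qed

text \<open>Takes the place of weak compactness. Every \<open>z\<close> is
  \<open>B w + Cp m z\<close> with a remainder as small as desired, so convergence of
  \<open>B (X k)\<close> and the bound on \<open>X k\<close> make \<open>X k \<bullet> z\<close>
  Cauchy. Riesz represents the limit functional.\<close>

lemma weak_limit_exists:
  assumes bound: "\<And>k. norm (X k) \<le> R" and conv: "(\<lambda>k. B (X k)) \<longlonglongrightarrow> y"
  shows "\<exists>x. weakly_to X x \<and> B x = y \<and> norm x \<le> R"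
proof -
  have R: "0 \<le> R" using bound[of 0] norm_ge_zero order.trans by blast
  have "Cauchy (\<lambda>k. X k \<bullet> z)" for z
  proof (rule metric_CauchyI)
    fix e :: real assume e: "0 < e"
    have "(\<lambda>m. 2 * R * norm (Cp m z)) \<longlonglongrightarrow> 2 * R * 0"
      by (intro tendsto_intros tendsto_norm_zero Cp_tendsto_zero)
    then obtain m where m: "2 * R * norm (Cp m z) < e / 2"
      using order_tendstoD(2)[of "\<lambda>m. 2 * R * norm (Cp m z)" "2 * R * 0" sequentially "e / 2"] e
      by (auto simp: eventually_sequentially simp del: less_divide_eq_numeral1)
    define w where "w = Wm m z"
    have z: "z = B w + Cp m z" by (simp add: w_def B_Wm)
    have "Cauchy (\<lambda>k. B (X k) \<bullet> w)"
      by (rule LIMSEQ_imp_Cauchy[OF tendsto_inner[OF conv tendsto_const]])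
    then obtain N where N: "\<And>k l. k \<ge> N \<Longrightarrow> l \<ge> N \<Longrightarrow> dist (B (X k) \<bullet> w) (B (X l) \<bullet> w) < e / 2"
      using e by (meson half_gt_zero metric_CauchyD)
    have "dist (X k \<bullet> z) (X l \<bullet> z) < e" if "k \<ge> N" "l \<ge> N" for k l
    proof -
      have "X k \<bullet> z - X l \<bullet> z = (B (X k) \<bullet> w - B (X l) \<bullet> w) + (X k - X l) \<bullet> Cp m z"
        by (subst (1 2) z) (simp add: inner_simps B_adj)
      moreover have "\<bar>(X k - X l) \<bullet> Cp m z\<bar> \<le> norm (X k - X l) * norm (Cp m z)"
        by (rule Cauchy_Schwarz_ineq2)
      moreover have "norm (X k - X l) * norm (Cp m z) \<le> 2 * R * norm (Cp m z)"
        using norm_triangle_ineq4[of "X k" "X l"] bound[of k] bound[of l] by (intro mult_right_mono) auto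
      ultimately show ?thesis using N[OF that] m unfolding dist_real_def by linarith
    qed
    then show "\<exists>M. \<forall>m\<ge>M. \<forall>n\<ge>M. dist (X m \<bullet> z) (X n \<bullet> z) < e" by blast
  qed
  define f where "f z = lim (\<lambda>k. X k \<bullet> z)" for z
  have f: "(\<lambda>k. X k \<bullet> z) \<longlonglongrightarrow> f z" for z
    using Cauchy_convergent[OF \<open>Cauchy (\<lambda>k. X k \<bullet> z)\<close>] by (simp add: f_def convergent_LIMSEQ_iff)
  have f_le: "\<bar>f z\<bar> \<le> norm z * R" for z
  proof (rule LIMSEQ_le_const2[OF tendsto_rabs[OF f]], intro exI allI impI)
    fix n
    have "\<bar>X n \<bullet> z\<bar> \<le> norm (X n) * norm z" by (rule Cauchy_Schwarz_ineq2)
    also have "\<dots> \<le> R * norm z" using bound by (intro mult_right_mono) auto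
    finally show "\<bar>X n \<bullet> z\<bar> \<le> norm z * R" by (simp add: mult.commute)
  qed
  have "bounded_linear f"
  proof (rule bounded_linear_intro[where K=R])
    fix x z
    show "f (x + z) = f x + f z"
      using LIMSEQ_unique[OF f[of "x + z"]] tendsto_add[OF f[of x] f[of z]]
      by (simp add: inner_add_right)
  next
    fix r x
    show "f (r *\<^sub>R x) = r *\<^sub>R f x"
      using LIMSEQ_unique[OF f[of "r *\<^sub>R x"]] tendsto_mult_left[OF f[of x], of r] by simp
  qed (use f_le in simp)
  from riesz_representation[OF this] obtain x where x: "\<And>z. f z = z \<bullet> x" by blast
  have "weakly_to X x" using f by (simp add: weakly_to_def x inner_commute)
  moreover have "B x = y"
  proof -
    have "B x \<bullet> z = y \<bullet> z" for z
    proof -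
      have "(\<lambda>k. B (X k) \<bullet> z) \<longlonglongrightarrow> B x \<bullet> z" using f[of "B z"]
        by (simp only: x B_adj inner_commute[of z])
      moreover have "(\<lambda>k. B (X k) \<bullet> z) \<longlonglongrightarrow> y \<bullet> z" by (intro tendsto_inner conv tendsto_const)
      ultimately show ?thesis by (rule LIMSEQ_unique)
    qed
    then show ?thesis using vector_eq_rdot[of "B x" y] by blast
  qed
  moreover have "norm x \<le> R"
  proof (cases "x = 0")
    case False
    have "norm x * norm x \<le> norm x * R"
      using f_le[of x] by (simp add: x power2_norm_eq_inner[symmetric] power2_eq_square)
    then show ?thesis using False by simp
  qed (simp add: R)
  ultimately show ?thesis by blast
qed

text \<open>Injectivity of \<open>B\<close> identifies the weak limit. B-semicontinuity can thus be
  applied to bounded sequences once \<open>B (X k)\<close> converges.\<close>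

lemma weakly_toI:
  assumes "\<And>k. norm (X k) \<le> R" "(\<lambda>k. B (X k)) \<longlonglongrightarrow> B x"
  shows "weakly_to X x"
proof -
  obtain x' where x': "weakly_to X x'" "B x' = B x" using weak_limit_exists[OF assms] by blast
  have "B (x' - x) = 0" by (simp add: blinfun.diff_right x'(2))
  then show ?thesis using B_inj[of "x' - x"] x'(1) by simp
qed

text \<open>A strongly convergent factor is paired with a weakly convergent one. This makes the
  unregularised penalty continuous along bounded sequences with convergent
  \<open>B (X k)\<close>.\<close>

lemma B_form_tendsto:
  assumes bound: "\<And>k. norm (X k) \<le> R" and conv: "(\<lambda>k. B (X k)) \<longlonglongrightarrow> B x"
  shows "(\<lambda>k. B (X k) \<bullet> X k) \<longlonglongrightarrow> B x \<bullet> x"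
proof -
  have "(\<lambda>k. (B (X k) - B x) \<bullet> X k) \<longlonglongrightarrow> 0"
  proof (rule Lim_null_comparison)
    show "\<forall>\<^sub>F k in sequentially. norm ((B (X k) - B x) \<bullet> X k) \<le> norm (B (X k) - B x) * R"
    proof (intro always_eventually allI)
      fix k
      have "\<bar>(B (X k) - B x) \<bullet> X k\<bar> \<le> norm (B (X k) - B x) * norm (X k)"
        by (rule Cauchy_Schwarz_ineq2)
      also have "\<dots> \<le> norm (B (X k) - B x) * R" using bound by (intro mult_left_mono) auto
      finally show "norm ((B (X k) - B x) \<bullet> X k) \<le> norm (B (X k) - B x) * R" by simp
    qed
    show "(\<lambda>k. norm (B (X k) - B x) * R) \<longlonglongrightarrow> 0"
      using conv by (intro tendsto_mult_left_zero tendsto_norm_zero) (simp add: LIM_zero)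
  qed
  moreover have "(\<lambda>k. X k \<bullet> B x) \<longlonglongrightarrow> x \<bullet> B x"
    using weakly_toI[OF assms] by (simp add: weakly_to_def)
  ultimately have "(\<lambda>k. (B (X k) - B x) \<bullet> X k + X k \<bullet> B x) \<longlonglongrightarrow> 0 + x \<bullet> B x"
    by (rule tendsto_add)
  moreover have "(B (X k) - B x) \<bullet> X k + X k \<bullet> B x = B (X k) \<bullet> X k" for k
    unfolding inner_commute[of "X k" "B x"] by (simp add: inner_diff_left)
  ultimately show ?thesis by (simp add: inner_commute)
qed

lemma weakly_norm_lsc:
  assumes "weakly_to X x" "0 < e"
  shows "\<forall>\<^sub>F k in sequentially. norm x \<le> norm (X k) + e"
proof (cases "x = 0")
  case False
  have "(\<lambda>k. X k \<bullet> x) \<longlonglongrightarrow> x \<bullet> x" using assms(1) by (simp add: weakly_to_def)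
  moreover have "x \<bullet> x - e * norm x < x \<bullet> x" using False assms(2) by simp
  ultimately have "\<forall>\<^sub>F k in sequentially. x \<bullet> x - e * norm x < X k \<bullet> x" by (rule order_tendstoD)
  then show ?thesis
  proof eventually_elim
    case (elim k)
    have "(norm x - e) * norm x \<le> norm (X k) * norm x"
      using elim norm_cauchy_schwarz[of "X k" x]
      by (simp add: algebra_simps power2_norm_eq_inner[symmetric] power2_eq_square)
    then show ?case using False by simp
  qed
qed (use assms in simp)

text \<open>The Radon-Riesz property: weak lower semicontinuity turns the upper bound on the norms
  into their convergence, and expanding \<open>(norm (X k - x))\<^sup>2\<close> does the
  rest.\<close>

lemma strong_limit:
  assumes weak: "weakly_to X x" and norm: "\<And>e. 0 < e \<Longrightarrow> \<forall>\<^sub>F k in sequentially. norm (X k) \<le> norm x + e"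
  shows "X \<longlonglongrightarrow> x"
proof -
  have "(\<lambda>k. norm (X k)) \<longlonglongrightarrow> norm x"
  proof (rule LIMSEQ_I)
    fix e :: real assume e: "0 < e"
    have "\<forall>\<^sub>F k in sequentially. norm (norm (X k) - norm x) < e"
      using norm[OF half_gt_zero[OF e]] weakly_norm_lsc[OF weak half_gt_zero[OF e]]
      by eventually_elim (use e in auto)
    then show "\<exists>no. \<forall>n\<ge>no. norm (norm (X n) - norm x) < e" by (simp add: eventually_sequentially)
  qed
  moreover have "(\<lambda>k. X k \<bullet> x) \<longlonglongrightarrow> x \<bullet> x" using weak by (simp add: weakly_to_def)
  ultimately have "(\<lambda>k. (norm (X k))\<^sup>2 - 2 * (X k \<bullet> x) + (norm x)\<^sup>2) \<longlonglongrightarrow> (norm x)\<^sup>2 - 2 * (x \<bullet> x) + (norm x)\<^sup>2"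
    by (intro tendsto_add tendsto_diff tendsto_mult tendsto_power tendsto_const)
  then have "(\<lambda>k. (norm (X k - x))\<^sup>2) \<longlonglongrightarrow> 0"
    by (simp add: power2_norm_eq_inner inner_simps inner_commute algebra_simps)
  then have "(\<lambda>k. norm (X k - x)) \<longlonglongrightarrow> 0"
    using tendsto_real_sqrt by fastforce
  then show ?thesis by (rule LIM_zero_cancel[OF tendsto_norm_zero_cancel])
qed

end

section \<open>Gradients and bounded Lipschitz maps\<close>

lemma GDERIV_quadraticI:
  fixes f :: "'a::real_inner \<Rightarrow> real"
  assumes "\<And>y. \<bar>f (x + y) - f x - p \<bullet> y\<bar> \<le> K * (norm y)\<^sup>2"
  shows "GDERIV f x :> p"
  unfolding gderiv_def has_derivative_at
proof (intro conjI)
  show "bounded_linear (\<lambda>h. h \<bullet> p)" by (rule bounded_linear_inner_left)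
  show "(\<lambda>h. norm (f (x + h) - f x - h \<bullet> p) / norm h) \<midarrow>0\<rightarrow> 0"
  proof (rule Lim_null_comparison)
    show "\<forall>\<^sub>F h in at 0. norm (norm (f (x + h) - f x - h \<bullet> p) / norm h) \<le> K * norm h"
      unfolding eventually_at_topological
      using assms by (auto simp: divide_le_eq inner_commute power2_eq_square mult.assoc intro!: exI[of _ UNIV])
    show "(\<lambda>h. K * norm h) \<midarrow>0\<rightarrow> 0"
      by (intro tendsto_mult_right_zero tendsto_norm_zero tendsto_ident_at)
  qed
qed

lemma GDERIV_unique:
  assumes "GDERIV f x :> p" "GDERIV f x :> q"
  shows "p = q"
proof -
  have "(\<lambda>h. h \<bullet> p) = (\<lambda>h. h \<bullet> q)"
    using assms unfolding gderiv_def by (rule has_derivative_unique)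
  then show ?thesis using vector_eq_ldot[of p q] by metis
qed

lemma gradient_eq: "GDERIV f x :> p \<Longrightarrow> gradient f x = p"
  unfolding gradient_def by (rule the_equality) (auto intro: GDERIV_unique)

text \<open>Boundedness is included because products of functions that are merely Lipschitz need not
  be Lipschitz. The aim is uniform continuity of second derivatives and of
  \<open>A\<^sup>* D\<phi>\<close>.\<close>

definition bdd_lip :: "('a::real_normed_vector \<Rightarrow> 'b::real_normed_vector) \<Rightarrow> bool" where
  "bdd_lip f \<longleftrightarrow> (\<exists>K\<ge>0. (\<forall>x. norm (f x) \<le> K) \<and> (\<forall>x y. norm (f x - f y) \<le> K * norm (x - y)))"

lemma bdd_lipI:
  assumes "\<And>x. norm (f x) \<le> K" "\<And>x y. norm (f x - f y) \<le> L * norm (x - y)"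
  shows "bdd_lip f"
  unfolding bdd_lip_def
proof (intro exI[of _ "max K \<bar>L\<bar>"] conjI allI)
  show "norm (f x - f y) \<le> max K \<bar>L\<bar> * norm (x - y)" for x y
    using assms(2)[of x y] mult_right_mono[of L "max K \<bar>L\<bar>" "norm (x - y)"] by fastforce
qed (use assms(1) in \<open>auto simp: le_max_iff_disj\<close>)

lemma bdd_lip_uniformly_continuous:
  assumes "bdd_lip f" shows "uniformly_continuous_on UNIV f"
proof -
  obtain K where K: "0 \<le> K" "\<And>x y. norm (f x - f y) \<le> K * norm (x - y)"
    using assms unfolding bdd_lip_def by blast
  show ?thesis unfolding uniformly_continuous_on_def
  proof (intro allI impI)
    fix e :: real assume e: "0 < e"
    have "dist (f y) (f x) < e" if "dist y x < e / (K + 1)" for x y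
    proof -
      have "norm (f y - f x) \<le> (K + 1) * norm (y - x)"
        using K(2)[of y x] by (simp add: algebra_simps add_increasing)
      also have "\<dots> < e" using that K(1) by (simp add: dist_norm pos_less_divide_eq mult.commute)
      finally show ?thesis by (simp add: dist_norm)
    qed
    moreover have "0 < e / (K + 1)" using e K(1) by simp
    ultimately show "\<exists>d>0. \<forall>x\<in>UNIV. \<forall>x'\<in>UNIV. dist x' x < d \<longrightarrow> dist (f x') (f x) < e" by blast
  qed
qed

lemma bdd_lip_const: "bdd_lip (\<lambda>x. c)"
  by (rule bdd_lipI[where L=0 and K="norm c"]) auto

lemma bdd_lip_bilinear:
  assumes "bounded_bilinear prd" "bdd_lip f" "bdd_lip g"
  shows "bdd_lip (\<lambda>x. prd (f x) (g x))"
proof -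
  interpret bounded_bilinear prd by fact
  obtain P where P: "0 \<le> P" "\<And>a b. norm (prd a b) \<le> norm a * norm b * P" using nonneg_bounded by blast
  obtain K where K: "0 \<le> K" "\<And>x. norm (f x) \<le> K" "\<And>x y. norm (f x - f y) \<le> K * norm (x - y)"
    using assms(2) unfolding bdd_lip_def by blast
  obtain L where L: "0 \<le> L" "\<And>x. norm (g x) \<le> L" "\<And>x y. norm (g x - g y) \<le> L * norm (x - y)"
    using assms(3) unfolding bdd_lip_def by blast
  have bnd: "norm (prd a b) \<le> A * B * P" if "norm a \<le> A" "norm b \<le> B" for a b A B
  proof -
    have "0 \<le> A" "0 \<le> B" using that norm_ge_zero order.trans by blast+
    then have "norm a * norm b * P \<le> A * B * P"
      using that P(1) by (intro mult_mono) auto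
    with P(2)[of a b] show ?thesis by linarith
  qed
  show ?thesis
  proof (rule bdd_lipI)
    show "norm (prd (f x) (g x)) \<le> K * L * P" for x by (rule bnd[OF K(2) L(2)])
    fix x y
    have "prd (f x) (g x) - prd (f y) (g y) = prd (f x - f y) (g x) + prd (f y) (g x - g y)"
      by (simp add: diff_left diff_right)
    then have "norm (prd (f x) (g x) - prd (f y) (g y))
        \<le> norm (prd (f x - f y) (g x)) + norm (prd (f y) (g x - g y))"
      by (metis norm_triangle_ineq)
    also have "\<dots> \<le> (K * norm (x - y)) * L * P + K * (L * norm (x - y)) * P"
      by (intro add_mono bnd K L)
    finally show "norm (prd (f x) (g x) - prd (f y) (g y)) \<le> (2 * K * L * P) * norm (x - y)"
      by (simp add: algebra_simps)
  qed
qed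

lemma bdd_lip_linear:
  assumes "bounded_linear l" "bdd_lip f"
  shows "bdd_lip (\<lambda>x. l (f x))"
proof -
  have "bounded_bilinear (\<lambda>(r::real) x. r *\<^sub>R l x)"
    by (rule bounded_bilinear.comp[OF bounded_bilinear_scaleR bounded_linear_ident assms(1)])
  from bdd_lip_bilinear[OF this bdd_lip_const[of 1] assms(2)] show ?thesis by simp
qed

lemma bdd_lip_add: "bdd_lip f \<Longrightarrow> bdd_lip g \<Longrightarrow> bdd_lip (\<lambda>x. f x + g x)"
proof -
  assume "bdd_lip f" "bdd_lip g"
  then obtain K L where K: "\<And>x. norm (f x) \<le> K" "\<And>x y. norm (f x - f y) \<le> K * norm (x - y)"
    and L: "\<And>x. norm (g x) \<le> L" "\<And>x y. norm (g x - g y) \<le> L * norm (x - y)"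
    unfolding bdd_lip_def by meson
  show ?thesis
  proof (rule bdd_lipI[where K="K + L" and L="K + L"])
    fix x y
    show "norm (f x + g x) \<le> K + L"
      using norm_triangle_ineq[of "f x" "g x"] K(1)[of x] L(1)[of x] by linarith
    have "norm (f x + g x - (f y + g y)) \<le> norm (f x - f y) + norm (g x - g y)"
      using norm_triangle_ineq[of "f x - f y" "g x - g y"] by (simp add: algebra_simps)
    then show "norm (f x + g x - (f y + g y)) \<le> (K + L) * norm (x - y)"
      using K(2)[of x y] L(2)[of x y] by (simp add: algebra_simps)
  qed
qed

lemma bdd_lip_shift: "bdd_lip f \<Longrightarrow> bdd_lip (\<lambda>x. f (x - c))"
proof -
  assume "bdd_lip f"
  then obtain K where "\<And>x. norm (f x) \<le> K" and K: "\<And>x y. norm (f x - f y) \<le> K * norm (x - y)"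
    unfolding bdd_lip_def by blast
  then show ?thesis using K[of "_ - c" "_ - c"] by (intro bdd_lipI[where K=K and L=K]) simp_all
qed

definition rank_one :: "'a::real_inner \<Rightarrow> 'a \<Rightarrow> 'a \<Rightarrow>\<^sub>L 'a" where
  "rank_one a w = blinfun_scaleR_left w o\<^sub>L blinfun_inner_right a"

lemma rank_one_apply: "rank_one a w h = (a \<bullet> h) *\<^sub>R w"
  by (simp add: rank_one_def blinfun_inner_right.rep_eq)

lemma bounded_bilinear_rank_one: "bounded_bilinear rank_one"
  unfolding rank_one_def
  by (rule bounded_bilinear.flip[OF bounded_bilinear.comp[OF bounded_bilinear_blinfun_compose
          bounded_linear_blinfun_scaleR_left bounded_linear_blinfun_inner_right]])

section \<open>Smoothed seminorms\<close>

definition sroot :: "('a::real_inner \<Rightarrow>\<^sub>L 'a) \<Rightarrow> 'a \<Rightarrow> real" where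
  "sroot Q z = sqrt (1 + Q z \<bullet> z)"

text \<open>The Hessian of \<open>s = sroot Q\<close>, that is
  \<open>Q / s - (Q z \<otimes> Q z) / s\<^sup>3\<close>, with each factor \<open>Q z\<close>
  divided by \<open>s\<close> so that it is visibly bounded.\<close>

definition sroot_D2 :: "('a::real_inner \<Rightarrow>\<^sub>L 'a) \<Rightarrow> 'a \<Rightarrow> 'a \<Rightarrow>\<^sub>L 'a" where
  "sroot_D2 Q z = (1 / sroot Q z) *\<^sub>R (Q - rank_one ((1 / sroot Q z) *\<^sub>R Q z) ((1 / sroot Q z) *\<^sub>R Q z))"

context
  fixes Q :: "'a::real_inner \<Rightarrow>\<^sub>L 'a" and d :: real
  assumes psd_Q: "psd Q" and d: "0 \<le> d" and Q_le: "\<And>x. Q x \<bullet> x \<le> d\<^sup>2 * (norm x)\<^sup>2"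
begin

lemma Q_sqrt_le: "sqrt (Q x \<bullet> x) \<le> d * norm x"
  using real_sqrt_le_mono[OF Q_le[of x]] d by (simp add: real_sqrt_mult)

lemma sroot_ge_1: "1 \<le> sroot Q z" and sroot_pos: "0 < sroot Q z"
  and sroot_sq: "(sroot Q z)\<^sup>2 = 1 + Q z \<bullet> z" and sroot_ge: "sqrt (Q z \<bullet> z) \<le> sroot Q z"
  using psdD(2)[OF psd_Q, of z] by (auto simp: sroot_def add_pos_nonneg)

lemma Q_inner_le: "\<bar>Q z \<bullet> y\<bar> \<le> sroot Q z * sqrt (Q y \<bullet> y)"
proof -
  have "\<bar>Q z \<bullet> y\<bar> = sqrt ((Q z \<bullet> y)\<^sup>2)" by simp
  also have "\<dots> \<le> sqrt ((Q z \<bullet> z) * (Q y \<bullet> y))"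
    using psd_Cauchy_Schwarz[OF psd_Q, of z y] by (simp only: real_sqrt_le_mono)
  also have "\<dots> = sqrt (Q z \<bullet> z) * sqrt (Q y \<bullet> y)" by (simp add: real_sqrt_mult)
  also have "\<dots> \<le> sroot Q z * sqrt (Q y \<bullet> y)"
    using sroot_ge psdD(2)[OF psd_Q, of y] by (intro mult_right_mono) auto
  finally show ?thesis .
qed

text \<open>\<open>sroot Q z\<close> is the seminorm of the pair \<open>(1, z)\<close>, so this is
  the triangle inequality for the increment \<open>(0, y)\<close>.\<close>

lemma sroot_triangle: "sroot Q (z + y) \<le> sroot Q z + sqrt (Q y \<bullet> y)"
proof (rule power2_le_imp_le)
  have "(sroot Q (z + y))\<^sup>2 = (sroot Q z)\<^sup>2 + 2 * (Q z \<bullet> y) + Q y \<bullet> y"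
    by (simp add: sroot_sq psd_form_add[OF psd_Q])
  also have "\<dots> \<le> (sroot Q z)\<^sup>2 + 2 * (sroot Q z * sqrt (Q y \<bullet> y)) + Q y \<bullet> y"
    using Q_inner_le[of z y] by simp
  also have "\<dots> = (sroot Q z + sqrt (Q y \<bullet> y))\<^sup>2"
    using psdD(2)[OF psd_Q, of y] by (simp add: power2_sum)
  finally show "(sroot Q (z + y))\<^sup>2 \<le> (sroot Q z + sqrt (Q y \<bullet> y))\<^sup>2" .
qed (use sroot_pos[of z] psdD(2)[OF psd_Q, of y] in \<open>simp add: less_imp_le\<close>)

lemma sroot_diff_le: "\<bar>sroot Q (z + y) - sroot Q z\<bar> \<le> sqrt (Q y \<bullet> y)"
  using sroot_triangle[of z y] sroot_triangle[of "z + y" "- y"] by (simp add: blinfun.minus_right)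

text \<open>Multiplying by \<open>s * (S + s)\<close>, with \<open>s\<close> and \<open>S\<close>
  the old and the new root, rationalises the difference. What remains is at most
  \<open>2 * s\<close> times the form of \<open>y\<close>, and \<open>S + s \<ge> 2\<close>.\<close>

lemma sroot_remainder: "\<bar>sroot Q (z + y) - sroot Q z - (Q z \<bullet> y) / sroot Q z\<bar> \<le> Q y \<bullet> y"
proof -
  let ?S = "sroot Q (z + y)" and ?s = "sroot Q z" and ?r = "sqrt (Q y \<bullet> y)"
  have r: "?r * ?r = Q y \<bullet> y" "0 \<le> ?r" using psdD(2)[OF psd_Q, of y] by auto
  have eq: "?S\<^sup>2 = ?s\<^sup>2 + 2 * (Q z \<bullet> y) + Q y \<bullet> y" by (simp add: sroot_sq psd_form_add[OF psd_Q])
  have "(?S - ?s - (Q z \<bullet> y) / ?s) * (?s * (?S + ?s)) = (?S\<^sup>2 - ?s\<^sup>2) * ?s - (Q z \<bullet> y) * (?S + ?s)"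
    using sroot_pos[of z] by (simp add: field_simps power2_eq_square)
  also have "\<dots> = (Q z \<bullet> y) * (?s - ?S) + (Q y \<bullet> y) * ?s" by (subst eq) (simp add: algebra_simps)
  finally have "\<bar>?S - ?s - (Q z \<bullet> y) / ?s\<bar> * (?s * (?S + ?s)) = \<bar>(Q z \<bullet> y) * (?s - ?S) + (Q y \<bullet> y) * ?s\<bar>"
    using sroot_pos[of z] sroot_pos[of "z + y"] by (metis abs_mult abs_of_pos add_pos_pos mult_pos_pos)
  also have "\<dots> \<le> \<bar>Q z \<bullet> y\<bar> * \<bar>?s - ?S\<bar> + (Q y \<bullet> y) * ?s"
    using sroot_pos[of z] psdD(2)[OF psd_Q, of y]
      abs_triangle_ineq[of "(Q z \<bullet> y) * (?s - ?S)" "(Q y \<bullet> y) * ?s"] by (simp add: abs_mult)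
  also have "\<dots> \<le> (?s * ?r) * ?r + (Q y \<bullet> y) * ?s"
    using Q_inner_le[of z y] sroot_diff_le[of z y] sroot_pos[of z] r
    by (intro add_right_mono mult_mono) auto
  also have "\<dots> = (Q y \<bullet> y) * (?s * 2)" by (simp only: mult.assoc r(1)) simp
  also have "\<dots> \<le> (Q y \<bullet> y) * (?s * (?S + ?s))"
    using sroot_ge_1[of z] sroot_ge_1[of "z + y"] psdD(2)[OF psd_Q, of y]
    by (intro mult_left_mono) auto
  finally show ?thesis
    using sroot_pos[of z] sroot_pos[of "z + y"] by (simp add: mult_le_cancel_right)
qed

lemma sroot_inverse_lip: "\<bar>1 / sroot Q z - 1 / sroot Q y\<bar> \<le> d * norm (z - y) / sroot Q y"
proof -
  have "\<bar>sroot Q z - sroot Q y\<bar> \<le> d * norm (z - y)"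
    using sroot_diff_le[of y "z - y"] Q_sqrt_le[of "z - y"] by simp
  then have "\<bar>sroot Q y - sroot Q z\<bar> / (sroot Q z * sroot Q y) \<le> d * norm (z - y) / (1 * sroot Q y)"
    using sroot_ge_1[of z] sroot_pos[of y] d
    by (intro frac_le mult_mono) (auto simp: abs_minus_commute)
  moreover have "1 / sroot Q z - 1 / sroot Q y = (sroot Q y - sroot Q z) / (sroot Q z * sroot Q y)"
    using sroot_pos[of z] sroot_pos[of y] by (simp add: field_simps)
  ultimately show ?thesis
    using sroot_pos[of z] sroot_pos[of y] by (simp add: abs_mult)
qed

lemma bdd_lip_inverse_sroot: "bdd_lip (\<lambda>z. 1 / sroot Q z)"
proof (rule bdd_lipI[where K=1 and L=d])
  show "norm (1 / sroot Q z) \<le> 1" for z using sroot_ge_1[of z] by simp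
  fix z y
  have "d * norm (z - y) / sroot Q y \<le> d * norm (z - y) / 1"
    using sroot_ge_1[of y] d by (intro divide_left_mono) auto
  then show "norm (1 / sroot Q z - 1 / sroot Q y) \<le> d * norm (z - y)"
    using sroot_inverse_lip[of z y] by simp
qed

text \<open>\<open>l\<close> is unbounded, so a plain Lipschitz bound for \<open>1 / sroot Q\<close>
  would not do; \<open>sroot_inverse_lip\<close> keeps a factor \<open>1 / sroot Q y\<close>, which
  absorbs \<open>l y\<close>.\<close>

lemma bdd_lip_linear_div_sroot:
  fixes l :: "'a \<Rightarrow> 'a"
  assumes "bounded_linear l" and l: "\<And>z. norm (l z) \<le> c * sqrt (Q z \<bullet> z)" and c: "0 \<le> c"
  shows "bdd_lip (\<lambda>z. (1 / sroot Q z) *\<^sub>R l z)"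
proof (rule bdd_lipI[where K=c])
  interpret l: bounded_linear l by fact
  have l_le: "norm (l z) / sroot Q z \<le> c" for z
    using l[of z] mult_left_mono[OF sroot_ge[of z] c] sroot_pos[of z] by (simp add: divide_le_eq)
  show "norm ((1 / sroot Q z) *\<^sub>R l z) \<le> c" for z
    using l_le[of z] sroot_pos[of z] by simp
  fix z y
  have "(1 / sroot Q z) *\<^sub>R l z - (1 / sroot Q y) *\<^sub>R l y
      = (1 / sroot Q z) *\<^sub>R l (z - y) + (1 / sroot Q z - 1 / sroot Q y) *\<^sub>R l y"
    by (simp add: l.diff scaleR_diff_right scaleR_diff_left)
  then have "norm ((1 / sroot Q z) *\<^sub>R l z - (1 / sroot Q y) *\<^sub>R l y)
      \<le> norm (l (z - y)) / sroot Q z + \<bar>1 / sroot Q z - 1 / sroot Q y\<bar> * norm (l y)"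
    using norm_triangle_ineq[of "(1 / sroot Q z) *\<^sub>R l (z - y)" "(1 / sroot Q z - 1 / sroot Q y) *\<^sub>R l y"]
      sroot_pos[of z] by simp
  also have "norm (l (z - y)) / sroot Q z \<le> norm (l (z - y)) / 1"
    using sroot_ge_1[of z] by (intro divide_left_mono) auto
  also have "norm (l (z - y)) / 1 \<le> c * (d * norm (z - y))"
    using l[of "z - y"] mult_left_mono[OF Q_sqrt_le[of "z - y"] c] by simp
  also have "\<bar>1 / sroot Q z - 1 / sroot Q y\<bar> * norm (l y) \<le> (d * norm (z - y) / sroot Q y) * norm (l y)"
    by (intro mult_right_mono sroot_inverse_lip) auto
  also have "\<dots> = d * norm (z - y) * (norm (l y) / sroot Q y)" by simp
  also have "\<dots> \<le> d * norm (z - y) * c" using d l_le by (intro mult_left_mono) auto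
  finally show "norm ((1 / sroot Q z) *\<^sub>R l z - (1 / sroot Q y) *\<^sub>R l y) \<le> (2 * c * d) * norm (z - y)"
    by (simp add: algebra_simps)
qed

lemma Q_norm_le: "norm (Q z) \<le> d * sqrt (Q z \<bullet> z)"
proof (rule power2_le_imp_le)
  show "(norm (Q z))\<^sup>2 \<le> (d * sqrt (Q z \<bullet> z))\<^sup>2"
    using psd_norm_sq_le[OF psd_Q Q_le, of z] psdD(2)[OF psd_Q, of z] by (simp add: power_mult_distrib)
qed (use d psdD(2)[OF psd_Q, of z] in simp)

lemma sroot_GDERIV: "GDERIV (sroot Q) z :> (1 / sroot Q z) *\<^sub>R Q z"
proof (rule GDERIV_quadraticI)
  fix y
  show "\<bar>sroot Q (z + y) - sroot Q z - ((1 / sroot Q z) *\<^sub>R Q z) \<bullet> y\<bar> \<le> d\<^sup>2 * (norm y)\<^sup>2"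
    using sroot_remainder[of z y] Q_le[of y] by simp
qed

lemma sroot_has_D2: "((\<lambda>z. (1 / sroot Q z) *\<^sub>R Q z) has_derivative blinfun_apply (sroot_D2 Q z)) (at z)"
proof -
  have s: "(sroot Q has_derivative (\<lambda>h. h \<bullet> (1 / sroot Q z) *\<^sub>R Q z)) (at z)"
    using sroot_GDERIV[of z] by (simp add: gderiv_def)
  have "((\<lambda>z. inverse (sroot Q z) *\<^sub>R Q z) has_derivative
      (\<lambda>h. inverse (sroot Q z) *\<^sub>R Q h + (- (inverse (sroot Q z) * (h \<bullet> (1 / sroot Q z) *\<^sub>R Q z) * inverse (sroot Q z))) *\<^sub>R Q z)) (at z)"
  proof (rule has_derivative_scaleR)
    show "((\<lambda>z. inverse (sroot Q z)) has_derivative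
        (\<lambda>h. - (inverse (sroot Q z) * (h \<bullet> (1 / sroot Q z) *\<^sub>R Q z) * inverse (sroot Q z)))) (at z)"
      by (rule Deriv.has_derivative_inverse[OF _ s]) (use sroot_pos[of z] in simp)
    show "(blinfun_apply Q has_derivative blinfun_apply Q) (at z)"
      by (rule bounded_linear_imp_has_derivative[OF blinfun.bounded_linear_right])
  qed
  moreover have "blinfun_apply (sroot_D2 Q z) = (\<lambda>h. inverse (sroot Q z) *\<^sub>R Q h
      + (- (inverse (sroot Q z) * (h \<bullet> (1 / sroot Q z) *\<^sub>R Q z) * inverse (sroot Q z))) *\<^sub>R Q z)"
    by (rule ext) (simp add: sroot_D2_def blinfun.bilinear_simps rank_one_apply scaleR_diff_right
        inner_commute divide_inverse mult.commute mult.left_commute)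
  ultimately show ?thesis by (simp add: divide_inverse)
qed

lemma bdd_lip_sroot_D2: "bdd_lip (sroot_D2 Q)"
proof -
  have n: "bdd_lip (\<lambda>z. (1 / sroot Q z) *\<^sub>R Q z)"
    by (rule bdd_lip_linear_div_sroot[OF blinfun.bounded_linear_right Q_norm_le d])
  have "bdd_lip (\<lambda>z. - rank_one ((1 / sroot Q z) *\<^sub>R Q z) ((1 / sroot Q z) *\<^sub>R Q z))"
    by (intro bdd_lip_linear[OF bounded_linear_minus[OF bounded_linear_ident]]
        bdd_lip_bilinear[OF bounded_bilinear_rank_one] n)
  from bdd_lip_add[OF bdd_lip_const[of Q] this]
  have "bdd_lip (\<lambda>z. Q - rank_one ((1 / sroot Q z) *\<^sub>R Q z) ((1 / sroot Q z) *\<^sub>R Q z))" by simp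
  from bdd_lip_bilinear[OF bounded_bilinear_scaleR bdd_lip_inverse_sroot this]
  show ?thesis unfolding sroot_D2_def[abs_def] .
qed

end

section \<open>Admissible test functions\<close>

text \<open>The logarithm makes \<open>h\<^sub>0'(\<parallel>x\<parallel>) \<parallel>F x\<parallel>\<close> bounded although \<open>F\<close> grows linearly.\<close>

definition h0 :: "real \<Rightarrow> real" where "h0 r = ln (1 + r\<^sup>2) / 2"

lemma lipschitz_imp_uniformly_continuous:
  fixes f :: "'a::metric_space \<Rightarrow> 'b::metric_space"
  assumes "\<And>x y. x \<in> S \<Longrightarrow> y \<in> S \<Longrightarrow> dist (f x) (f y) \<le> K * dist x y"
  shows "uniformly_continuous_on S f"
proof (rule lipschitz_on_uniformly_continuous)
  show "(max K 0)-lipschitz_on S f"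
  proof (rule lipschitz_onI)
    fix x y assume "x \<in> S" "y \<in> S"
    then show "dist (f x) (f y) \<le> max K 0 * dist x y"
      using assms[of x y] mult_right_mono[of K "max K 0" "dist x y"] by fastforce
  qed simp
qed

lemma bounded_derivative_lipschitz:
  fixes f :: "real \<Rightarrow> real"
  assumes "\<And>r. 0 \<le> r \<Longrightarrow> (f has_real_derivative f' r) (at r within {0..})"
    and "\<And>r. 0 \<le> r \<Longrightarrow> \<bar>f' r\<bar> \<le> K" and "0 \<le> r" "0 \<le> s"
  shows "dist (f r) (f s) \<le> K * dist r s"
  using field_differentiable_bound[of "{0..}" f f' K r s] assms by (simp add: dist_norm)

lemma h0_deriv: "(h0 has_real_derivative r / (1 + r\<^sup>2)) (at r within S)"
proof -
  have "1 + r\<^sup>2 > 0" by (simp add: add_pos_nonneg)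
  then show ?thesis unfolding h0_def by (auto intro!: derivative_eq_intros simp: field_simps)
qed

lemma h0_deriv_le: "\<bar>r / (1 + r\<^sup>2)\<bar> \<le> 1" for r :: real
proof -
  have "\<bar>r\<bar> \<le> 1 + r\<^sup>2" using sum_squares_bound[of 1 "\<bar>r\<bar>"] by simp
  moreover have "0 < 1 + r\<^sup>2" by (simp add: add_pos_nonneg)
  ultimately show ?thesis unfolding abs_divide by (subst pos_divide_le_eq) auto
qed

lemma h0_nonneg: "0 \<le> h0 r" by (simp add: h0_def)

lemma h0_mono: "0 \<le> r \<Longrightarrow> r \<le> s \<Longrightarrow> h0 r \<le> h0 s"
proof -
  assume "0 \<le> r" "r \<le> s"
  then have "r\<^sup>2 \<le> s\<^sup>2" by (intro power_mono)
  then show ?thesis by (simp add: h0_def add_pos_nonneg)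
qed

lemma h0_ge: "1 \<le> r \<Longrightarrow> ln r \<le> h0 r"
proof -
  assume r: "1 \<le> r"
  have "2 * ln r = ln (r\<^sup>2)" using r by (simp add: ln_realpow)
  also have "\<dots> \<le> ln (1 + r\<^sup>2)" using r by (intro ln_mono) (auto simp: add_pos_nonneg)
  finally show ?thesis by (simp add: h0_def)
qed

lemma h0_lip: "0 \<le> r \<Longrightarrow> 0 \<le> s \<Longrightarrow> \<bar>h0 r - h0 s\<bar> \<le> \<bar>r - s\<bar>"
  using bounded_derivative_lipschitz[OF h0_deriv h0_deriv_le, of r s] by (simp add: dist_real_def)

lemma radial_fun2_h0:
  assumes "0 \<le> \<delta>"
  shows "radial_fun2 (\<lambda>r. \<delta> * h0 r)"
proof -
  define h' where "h' r = \<delta> * (r / (1 + r\<^sup>2))" for r :: real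
  define h'' where "h'' r = \<delta> * ((1 - r\<^sup>2) / (1 + r\<^sup>2)\<^sup>2)" for r :: real
  \<comment> \<open>The third derivative; its bound makes \<open>h''\<close> Lipschitz, hence
    uniformly continuous.\<close>
  define h3 where "h3 r = \<delta> * (2 * r * (r\<^sup>2 - 3) / (1 + r\<^sup>2)^3)" for r :: real
  have nz: "1 + r\<^sup>2 \<noteq> 0" "1 + r\<^sup>2 > 0" for r :: real
    using add_pos_nonneg[of 1 "r\<^sup>2"] by auto
  have d1: "((\<lambda>r. \<delta> * h0 r) has_real_derivative h' r) (at r within {0..})" for r
    unfolding h'_def by (intro DERIV_cmult h0_deriv)
  have d2: "(h' has_real_derivative h'' r) (at r within {0..})" for r
    unfolding h'_def h''_def using nz[of r]
    by (auto intro!: derivative_eq_intros simp: power2_eq_square field_simps)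
  have d3: "(h'' has_real_derivative h3 r) (at r within {0..})" for r
  proof -
    have "(h'' has_real_derivative \<delta> * (((- (2 * r)) * (1 + r\<^sup>2)\<^sup>2 - (1 - r\<^sup>2) * (2 * (1 + r\<^sup>2) * (2 * r)))
        / ((1 + r\<^sup>2)\<^sup>2 * (1 + r\<^sup>2)\<^sup>2))) (at r within {0..})"
      unfolding h''_def using nz[of r]
      by (intro DERIV_cmult) (auto intro!: derivative_eq_intros simp: algebra_simps)
    also have "((- (2 * r)) * (1 + r\<^sup>2)\<^sup>2 - (1 - r\<^sup>2) * (2 * (1 + r\<^sup>2) * (2 * r)))
        / ((1 + r\<^sup>2)\<^sup>2 * (1 + r\<^sup>2)\<^sup>2) = 2 * r * (r\<^sup>2 - 3) / (1 + r\<^sup>2)^3"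
    proof -
      define w where "w = 1 + r\<^sup>2"
      have w: "w \<noteq> 0" "r\<^sup>2 = w - 1" using nz[of r] by (auto simp: w_def)
      show ?thesis unfolding w_def[symmetric] w(2) using w(1)
        by (simp add: field_simps power2_eq_square power3_eq_cube)
    qed
    finally show ?thesis by (simp add: h3_def)
  qed
  have b1: "\<bar>h' r\<bar> \<le> \<delta>" for r
    using mult_left_mono[OF h0_deriv_le[of r] assms] assms by (simp add: h'_def abs_mult)
  have b2: "\<bar>h'' r\<bar> \<le> \<delta>" for r
  proof -
    have "\<bar>1 - r\<^sup>2\<bar> \<le> (1 + r\<^sup>2)^1" by (simp add: abs_if)
    also have "\<dots> \<le> (1 + r\<^sup>2)\<^sup>2" by (intro power_increasing) auto
    finally have "\<bar>1 - r\<^sup>2\<bar> \<le> (1 + r\<^sup>2)\<^sup>2" .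
    moreover have "0 < (1 + r\<^sup>2)\<^sup>2" using nz[of r] by simp
    ultimately have "\<bar>(1 - r\<^sup>2) / (1 + r\<^sup>2)\<^sup>2\<bar> \<le> 1"
      unfolding abs_divide by (subst pos_divide_le_eq) auto
    from mult_left_mono[OF this assms] show ?thesis using assms by (simp add: h''_def abs_mult)
  qed
  have b3: "\<bar>h3 r\<bar> \<le> \<delta> * 3" for r
  proof -
    have "\<bar>2 * r\<bar> \<le> 1 + r\<^sup>2" using sum_squares_bound[of 1 "\<bar>r\<bar>"] by simp
    moreover have "\<bar>r\<^sup>2 - 3\<bar> \<le> 3 * (1 + r\<^sup>2)" by (simp add: abs_if)
    ultimately have "\<bar>2 * r\<bar> * \<bar>r\<^sup>2 - 3\<bar> \<le> (1 + r\<^sup>2) * (3 * (1 + r\<^sup>2))" by (intro mult_mono) auto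
    also have "\<dots> = 3 * (1 + r\<^sup>2)\<^sup>2" by (simp add: power2_eq_square)
    also have "\<dots> \<le> 3 * (1 + r\<^sup>2)^3" by (intro mult_left_mono power_increasing) auto
    finally have "\<bar>2 * r * (r\<^sup>2 - 3) / (1 + r\<^sup>2)^3\<bar> \<le> 3"
      using nz[of r] by (simp add: abs_mult abs_div_pos divide_le_eq)
    from mult_left_mono[OF this assms] show ?thesis using assms by (simp add: h3_def abs_mult)
  qed
  have "radial_conds1 (\<lambda>r. \<delta> * h0 r) h'"
    unfolding radial_conds1_def
  proof (intro conjI allI impI)
    show "uniformly_continuous_on {0..} (\<lambda>r. \<delta> * h0 r)" "uniformly_continuous_on {0..} h'"
      by (rule lipschitz_imp_uniformly_continuous, rule bounded_derivative_lipschitz[OF d1 b1] bounded_derivative_lipschitz[OF d2 b2], auto)+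
  qed (use d1 assms nz in \<open>auto simp: h'_def\<close>)
  moreover have "uniformly_continuous_on {0..} h''"
    by (rule lipschitz_imp_uniformly_continuous, rule bounded_derivative_lipschitz[OF d3 b3]) auto
  ultimately show ?thesis unfolding radial_fun2_def using d2 by blast
qed

lemma radial_fun2_imp_radial_fun1: "radial_fun2 h \<Longrightarrow> radial_fun1 h"
  unfolding radial_fun2_def radial_fun1_def by blast

lemma test_fun2_imp_test_fun1: "test_fun2 T D A B \<phi> \<Longrightarrow> test_fun1 T D A B \<phi>"
  unfolding test_fun2_def test_fun1_def by blast

lemma h0_norm_lip: "\<bar>h0 (norm (x + y)) - h0 (norm x)\<bar> \<le> norm y" for x y :: "'a::real_inner"
  using h0_lip[of "norm (x + y)" "norm x"] norm_triangle_ineq3[of "x + y" x] by simp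

text \<open>The inequality \<open>ln s \<le> s - 1\<close> at \<open>w / a\<close> and at
  \<open>a / w\<close> encloses the logarithm between its linearisation \<open>r\<close> and
  \<open>r - (w - a)\<^sup>2 / (a * w)\<close>. The gap is at most
  \<open>2 * (norm y)\<^sup>2\<close> for all \<open>x\<close>, since \<open>w - a\<close> is a
  difference of squared norms and both norms are controlled by \<open>a * w\<close>.\<close>

lemma h0_norm_remainder:
  fixes x y :: "'a::real_inner"
  shows "\<bar>h0 (norm (x + y)) - h0 (norm x) - ((1 / (1 + (norm x)\<^sup>2)) *\<^sub>R x) \<bullet> y\<bar> \<le> (norm y)\<^sup>2"
proof -
  define a where "a = 1 + (norm x)\<^sup>2"
  define w where "w = 1 + (norm (x + y))\<^sup>2"
  define r where "r = (w - a) / a"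
  have a: "a \<ge> 1" and w: "w \<ge> 1" by (auto simp: a_def w_def)
  have wa: "w - a = 2 * (x \<bullet> y) + (norm y)\<^sup>2"
    by (simp add: w_def a_def power2_norm_eq_inner inner_simps inner_commute)
  have "ln w - ln a = ln (w / a)" using a w by (simp add: ln_div)
  then have lhs: "2 * (h0 (norm (x + y)) - h0 (norm x) - ((1 / (1 + (norm x)\<^sup>2)) *\<^sub>R x) \<bullet> y)
      = ln (w / a) - r + (norm y)\<^sup>2 / a"
    using a wa by (simp add: h0_def w_def[symmetric] a_def[symmetric] r_def field_simps)
  have up: "ln (w / a) \<le> r"
    using ln_le_minus_one[of "w / a"] a w by (simp add: r_def diff_divide_distrib)
  have "ln (a / w) \<le> a / w - 1" using a w by (intro ln_le_minus_one) auto
  then have "1 - a / w \<le> ln (w / a)" using a w by (simp add: ln_div)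
  moreover have "1 - a / w - r = - ((w - a)\<^sup>2 / (a * w))"
    using a w by (simp add: r_def field_simps power2_eq_square)
  moreover have "(w - a)\<^sup>2 / (a * w) \<le> 2 * (norm y)\<^sup>2"
  proof -
    have "\<bar>w - a\<bar> = \<bar>(x + (x + y)) \<bullet> y\<bar>"
      by (simp add: wa inner_simps power2_norm_eq_inner)
    also have "\<dots> \<le> norm (x + (x + y)) * norm y" by (rule Cauchy_Schwarz_ineq2)
    also have "\<dots> \<le> (norm x + norm (x + y)) * norm y"
      by (intro mult_right_mono norm_triangle_ineq) auto
    finally have "(w - a)\<^sup>2 \<le> ((norm x + norm (x + y)) * norm y)\<^sup>2"
      by (metis abs_ge_zero power2_abs power_mono)
    also have "\<dots> = (norm x + norm (x + y))\<^sup>2 * (norm y)\<^sup>2" by (rule power_mult_distrib)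
    also have "\<dots> \<le> (2 * (a * w)) * (norm y)\<^sup>2"
    proof (intro mult_right_mono)
      have "(norm x + norm (x + y))\<^sup>2 \<le> 2 * (norm x)\<^sup>2 + 2 * (norm (x + y))\<^sup>2"
        using sum_squares_bound[of "norm x" "norm (x + y)"] by (simp add: power2_sum)
      also have "\<dots> \<le> 2 * (a * w)" by (simp add: a_def w_def algebra_simps)
      finally show "(norm x + norm (x + y))\<^sup>2 \<le> 2 * (a * w)" .
    qed auto
    finally show ?thesis using a w by (simp add: divide_le_eq mult.commute mult.left_commute)
  qed
  ultimately have low: "- (2 * (norm y)\<^sup>2) \<le> ln (w / a) - r" by linarith
  have "0 \<le> (norm y)\<^sup>2 / a" "(norm y)\<^sup>2 / a \<le> (norm y)\<^sup>2"
    using a mult_left_mono[of 1 a "(norm y)\<^sup>2"] by (auto simp: divide_le_eq)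
  with up low zero_le_power2[of "norm y"]
  have "\<bar>2 * E\<bar> \<le> 2 * (norm y)\<^sup>2" if "2 * E = ln (w / a) - r + (norm y)\<^sup>2 / a" for E
    unfolding that abs_le_iff by linarith
  from this[OF lhs] show ?thesis by (simp only: abs_mult) simp
qed

definition time_test :: "real \<Rightarrow> (real \<Rightarrow> real) \<Rightarrow> (real \<Rightarrow> real) \<Rightarrow> bool" where
  "time_test T a a' \<longleftrightarrow> (\<forall>t\<in>{0<..<T}. (a has_real_derivative a' t) (at t)) \<and> continuous_on {0<..<T} a'"

section \<open>The adjoint of A and test functions of the space variable\<close>

locale setting = pos_operator B for B :: "'a::{real_inner,complete_space} \<Rightarrow>\<^sub>L 'a" +
  fixes D :: "'a set" and A :: "'a \<Rightarrow> 'a" and c0 :: real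
  assumes A_dense: "closure D = UNIV"
    and AB_dom: "range (blinfun_apply B) \<subseteq> adj_dom D A"
    and AB_bounded: "bounded_linear (\<lambda>x. adj_op D A (B x))"
    and c0: "0 \<le> c0"
    and AB_ge: "\<And>x. 0 \<le> (adj_op D A (B x) + c0 *\<^sub>R B x) \<bullet> x"
begin

lemma dense_inner_eq:
  assumes "\<forall>x\<in>D. x \<bullet> w = x \<bullet> w'"
  shows "w = w'"
proof -
  have "closed {x. x \<bullet> w = x \<bullet> w'}" by (intro closed_Collect_eq continuous_intros)
  then have "closure D \<subseteq> {x. x \<bullet> w = x \<bullet> w'}" using assms by (intro closure_minimal) auto
  then show ?thesis using A_dense vector_eq_ldot[of w w'] by auto
qed

lemma adj_op_eq:
  assumes "\<forall>x\<in>D. A x \<bullet> y = x \<bullet> w"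
  shows "adj_op D A y = w"
  unfolding adj_op_def by (rule the_equality) (use assms in \<open>auto intro: dense_inner_eq\<close>)

lemma adj_op_works: "y \<in> adj_dom D A \<Longrightarrow> x \<in> D \<Longrightarrow> A x \<bullet> y = x \<bullet> adj_op D A y"
  unfolding adj_dom_def using adj_op_eq by fastforce

lemma adj_add:
  assumes "y \<in> adj_dom D A" "z \<in> adj_dom D A"
  shows "y + z \<in> adj_dom D A" "adj_op D A (y + z) = adj_op D A y + adj_op D A z"
proof -
  have "\<forall>x\<in>D. A x \<bullet> (y + z) = x \<bullet> (adj_op D A y + adj_op D A z)"
    by (simp add: inner_add_right adj_op_works assms)
  then show "y + z \<in> adj_dom D A" "adj_op D A (y + z) = adj_op D A y + adj_op D A z"
    by (auto simp: adj_dom_def intro: adj_op_eq)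
qed

lemma adj_B_scaleR:
  "k *\<^sub>R B x \<in> adj_dom D A" "adj_op D A (k *\<^sub>R B x) = k *\<^sub>R adj_op D A (B x)"
proof -
  have "B x \<in> adj_dom D A" using AB_dom by auto
  then have "\<forall>z\<in>D. A z \<bullet> (k *\<^sub>R B x) = z \<bullet> (k *\<^sub>R adj_op D A (B x))"
    by (simp add: adj_op_works)
  then show "k *\<^sub>R B x \<in> adj_dom D A" "adj_op D A (k *\<^sub>R B x) = k *\<^sub>R adj_op D A (B x)"
    unfolding adj_dom_def by (blast, rule adj_op_eq)
qed

definition "AB x = adj_op D A (B x)"

lemma bounded_linear_AB: "bounded_linear AB"
  using AB_bounded by (simp add: AB_def[abs_def])

definition "KAB = (SOME K. 0 < K \<and> (\<forall>x. norm (AB x) \<le> norm x * K))"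

lemma KAB: "0 < KAB" "norm (AB x) \<le> KAB * norm x"
proof -
  have "\<exists>K. 0 < K \<and> (\<forall>x. norm (AB x) \<le> norm x * K)"
    using bounded_linear.pos_bounded[OF bounded_linear_AB] by blast
  from someI_ex[OF this] show "0 < KAB" "norm (AB x) \<le> KAB * norm x"
    unfolding KAB_def[symmetric] by (auto simp: mult.commute)
qed

lemma AB_form_ge: "- c0 * (B x \<bullet> x) \<le> x \<bullet> AB x"
  using AB_ge[of x] unfolding inner_commute[of x] by (simp add: AB_def inner_add_left)

text \<open>\<open>L1\<close> and \<open>L2\<close> bound the gradient and the second-order
  remainder on all of \<open>H\<close>; these two numbers enter the error of the jump term, while
  the remaining clauses are qualitative. Growth is measured by \<open>norm (B x)\<close>, which
  gives boundedness where \<open>norm_m1 B x\<close> is bounded.\<close>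

definition stest :: "real \<Rightarrow> real \<Rightarrow> ('a \<Rightarrow> real) \<Rightarrow> ('a \<Rightarrow> 'a) \<Rightarrow> bool" where
  "stest L1 L2 f f' \<longleftrightarrow>
     (\<forall>x y. \<bar>f (x + y) - f x\<bar> \<le> L1 * norm y) \<and>
     (\<forall>x y. \<bar>f (x + y) - f x - f' x \<bullet> y\<bar> \<le> L2 * (norm y)\<^sup>2) \<and>
     (\<forall>x. norm (f' x) \<le> L1) \<and>
     (\<exists>D2. (\<forall>x. (f' has_derivative blinfun_apply (D2 x)) (at x)) \<and> uniformly_continuous_on UNIV D2) \<and>
     uniformly_continuous_on UNIV f' \<and>
     (\<forall>x. f' x \<in> adj_dom D A) \<and>
     uniformly_continuous_on UNIV (\<lambda>x. adj_op D A (f' x)) \<and>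
     (\<forall>X x. (\<lambda>k. B (X k)) \<longlonglongrightarrow> B x \<longrightarrow> (\<lambda>k. f (X k)) \<longlonglongrightarrow> f x) \<and>
     (\<exists>K. \<forall>x. \<bar>f x\<bar> \<le> K * (1 + norm (B x)))"

lemma stestD:
  assumes "stest L1 L2 f f'"
  shows "\<bar>f (x + y) - f x\<bar> \<le> L1 * norm y" "\<bar>f (x + y) - f x - f' x \<bullet> y\<bar> \<le> L2 * (norm y)\<^sup>2"
    "norm (f' x) \<le> L1" "f' x \<in> adj_dom D A" "(\<lambda>k. B (X k)) \<longlonglongrightarrow> B x \<Longrightarrow> (\<lambda>k. f (X k)) \<longlonglongrightarrow> f x"
  using assms unfolding stest_def by auto

lemma stest_mono:
  assumes "stest L1 L2 f f'" "L1 \<le> L1'" "L2 \<le> L2'"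
  shows "stest L1' L2' f f'"
proof -
  have "\<bar>f (x + y) - f x\<bar> \<le> L1' * norm y" "\<bar>f (x + y) - f x - f' x \<bullet> y\<bar> \<le> L2' * (norm y)\<^sup>2"
    "norm (f' x) \<le> L1'" for x y
    using stestD(1,2,3)[OF assms(1), of x] mult_right_mono[OF assms(2), of "norm y"]
      mult_right_mono[OF assms(3), of "(norm y)\<^sup>2"] assms(2) by (fastforce intro: order.trans)+
  then show ?thesis using assms(1) unfolding stest_def by auto
qed

lemma stest_add:
  assumes f: "stest L1 L2 f f'" and g: "stest K1 K2 g g'"
  shows "stest (L1 + K1) (L2 + K2) (\<lambda>x. f x + g x) (\<lambda>x. f' x + g' x)"
proof -
  obtain D2f where D2f: "\<And>x. (f' has_derivative blinfun_apply (D2f x)) (at x)" "uniformly_continuous_on UNIV D2f"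
    using f unfolding stest_def by blast
  obtain D2g where D2g: "\<And>x. (g' has_derivative blinfun_apply (D2g x)) (at x)" "uniformly_continuous_on UNIV D2g"
    using g unfolding stest_def by blast
  obtain Kf where Kf: "\<And>x. \<bar>f x\<bar> \<le> Kf * (1 + norm (B x))" using f unfolding stest_def by blast
  obtain Kg where Kg: "\<And>x. \<bar>g x\<bar> \<le> Kg * (1 + norm (B x))" using g unfolding stest_def by blast
  show ?thesis unfolding stest_def
  proof (intro conjI allI impI)
    fix x y
    show "\<bar>f (x + y) + g (x + y) - (f x + g x)\<bar> \<le> (L1 + K1) * norm y"
      using stestD(1)[OF f, of x y] stestD(1)[OF g, of x y] by (simp add: distrib_right)
    show "\<bar>f (x + y) + g (x + y) - (f x + g x) - (f' x + g' x) \<bullet> y\<bar> \<le> (L2 + K2) * (norm y)\<^sup>2"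
      using stestD(2)[OF f, of x y] stestD(2)[OF g, of x y] by (simp add: distrib_right inner_add_left)
    show "norm (f' x + g' x) \<le> L1 + K1"
      using norm_triangle_ineq[of "f' x" "g' x"] stestD(3)[OF f, of x] stestD(3)[OF g, of x] by linarith
    show "f' x + g' x \<in> adj_dom D A" by (intro adj_add stestD(4)[OF f] stestD(4)[OF g])
  next
    have "((\<lambda>x. f' x + g' x) has_derivative blinfun_apply (D2f x + D2g x)) (at x)" for x
      using has_derivative_add[OF D2f(1)[of x] D2g(1)[of x]] by (simp add: plus_blinfun.rep_eq)
    moreover have "uniformly_continuous_on UNIV (\<lambda>x. D2f x + D2g x)"
      by (intro uniformly_continuous_on_add D2f D2g)
    ultimately show "\<exists>D2. (\<forall>x. ((\<lambda>x. f' x + g' x) has_derivative blinfun_apply (D2 x)) (at x)) \<and>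
        uniformly_continuous_on UNIV D2" by (intro exI[of _ "\<lambda>x. D2f x + D2g x"]) simp
  next
    show "uniformly_continuous_on UNIV (\<lambda>x. f' x + g' x)"
      using f g unfolding stest_def by (intro uniformly_continuous_on_add) auto
    have "adj_op D A (f' x + g' x) = adj_op D A (f' x) + adj_op D A (g' x)" for x
      by (intro adj_add stestD(4)[OF f] stestD(4)[OF g])
    then show "uniformly_continuous_on UNIV (\<lambda>x. adj_op D A (f' x + g' x))"
      using f g unfolding stest_def by (auto intro: uniformly_continuous_on_add)
  next
    fix X x assume "(\<lambda>k. B (X k)) \<longlonglongrightarrow> B x"
    then show "(\<lambda>k. f (X k) + g (X k)) \<longlonglongrightarrow> f x + g x"
      by (intro tendsto_add stestD(5)[OF f] stestD(5)[OF g])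
  next
    have "\<bar>f x + g x\<bar> \<le> (Kf + Kg) * (1 + norm (B x))" for x
      using Kf[of x] Kg[of x] by (simp add: distrib_right)
    then show "\<exists>K. \<forall>x. \<bar>f x + g x\<bar> \<le> K * (1 + norm (B x))" by blast
  qed
qed

text \<open>Since \<open>\<parallel>W B z\<parallel>\<^sup>2 \<le> \<parallel>W\<parallel> \<langle>W B z, B z\<rangle>\<close>, the vector \<open>A\<^sup>* B W B z\<close> is controlled by the form under the root. There
  is no such bound for \<open>A\<^sup>* B z\<close> in terms of \<open>\<langle>B z, z\<rangle>\<close>.\<close>

definition root_fn :: "('a \<Rightarrow>\<^sub>L 'a) \<Rightarrow> real \<Rightarrow> 'a \<Rightarrow> 'a \<Rightarrow> real" where
  "root_fn W k c x = k * sqrt (1 + W (B (x - c)) \<bullet> B (x - c))"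

definition root_grad :: "('a \<Rightarrow>\<^sub>L 'a) \<Rightarrow> real \<Rightarrow> 'a \<Rightarrow> 'a \<Rightarrow> 'a" where
  "root_grad W k c x = (k / sqrt (1 + W (B (x - c)) \<bullet> B (x - c))) *\<^sub>R B (W (B (x - c)))"

lemma root_grad_adj:
  "adj_op D A (root_grad W k c x) = (k / sqrt (1 + W (B (x - c)) \<bullet> B (x - c))) *\<^sub>R AB (W (B (x - c)))"
  unfolding root_grad_def AB_def by (rule adj_B_scaleR)

lemma root_adj_le:
  assumes W: "psd W" and w: "0 \<le> w"
    and W': "\<And>y. W y \<bullet> y \<le> w * (norm y)\<^sup>2" and k: "0 \<le> k"
  shows "norm (adj_op D A (root_grad W k c x)) \<le> k * KAB * sqrt w"
proof -
  let ?y = "B (x - c)"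
  have nn: "0 \<le> W ?y \<bullet> ?y" by (rule psdD(2)[OF W])
  have "norm (W ?y) \<le> sqrt (w * (W ?y \<bullet> ?y))"
    using psd_norm_sq_le[OF W W', of ?y] by (simp add: real_le_rsqrt)
  also have "\<dots> = sqrt w * sqrt (W ?y \<bullet> ?y)" by (rule real_sqrt_mult)
  also have "\<dots> \<le> sqrt w * sqrt (1 + W ?y \<bullet> ?y)" using w by (intro mult_left_mono) auto
  finally have *: "norm (W ?y) / sqrt (1 + W ?y \<bullet> ?y) \<le> sqrt w"
    using nn by (simp add: divide_le_eq)
  have "norm (adj_op D A (root_grad W k c x)) = (k / sqrt (1 + W ?y \<bullet> ?y)) * norm (AB (W ?y))"
    using k nn by (simp add: root_grad_adj)
  also have "\<dots> \<le> (k / sqrt (1 + W ?y \<bullet> ?y)) * (KAB * norm (W ?y))"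
    using k nn by (intro mult_left_mono KAB) auto
  also have "\<dots> = k * KAB * (norm (W ?y) / sqrt (1 + W ?y \<bullet> ?y))" by simp
  also have "\<dots> \<le> k * KAB * sqrt w" using * k KAB(1) by (intro mult_left_mono) auto
  finally show ?thesis .
qed

text \<open>With \<open>Q = B W B\<close> the function is a multiple of a shifted
  \<open>sroot Q\<close>. Both its gradient and the image of the gradient under the adjoint are
  linear maps divided by \<open>sroot Q\<close>, and each is bounded by the root of the form, as
  \<open>bdd_lip_linear_div_sroot\<close> asks.\<close>

lemma stest_root:
  assumes W: "psd W" and d: "0 \<le> d" and le: "\<And>y. W (B y) \<bullet> B y \<le> d\<^sup>2 * (norm y)\<^sup>2" and k: "0 \<le> k"
  shows "stest (k * d) (k * d\<^sup>2) (root_fn W k c) (root_grad W k c)"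
proof -
  define Q where "Q = B o\<^sub>L W o\<^sub>L B"
  have Q: "Q x = B (W (B x))" for x by (simp add: Q_def)
  have Qf: "Q x \<bullet> y = W (B x) \<bullet> B y" for x y by (simp add: Q B_adj)
  have psdQ: "psd Q"
    unfolding psd_def self_adjoint_def
    using psdD[OF W] by (simp add: Qf) (simp add: Q B_adj[symmetric])
  have Qle: "Q x \<bullet> x \<le> d\<^sup>2 * (norm x)\<^sup>2" for x using le by (simp add: Qf)
  note ctx = psdQ d Qle
  have fn: "root_fn W k c x = k * sroot Q (x - c)" for x
    by (simp add: root_fn_def sroot_def Qf)
  have gr: "root_grad W k c x = k *\<^sub>R ((1 / sroot Q (x - c)) *\<^sub>R Q (x - c))" for x
    by (simp add: root_grad_def sroot_def Qf) (simp add: Q)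
  have Wn: "(norm (W y))\<^sup>2 \<le> norm W * (W y \<bullet> y)" for y
    by (rule psd_norm_sq_le[OF W blinfun_form_le])
  show ?thesis unfolding stest_def
  proof (intro conjI allI impI)
    fix x y
    show "\<bar>root_fn W k c (x + y) - root_fn W k c x\<bar> \<le> k * d * norm y"
    proof -
      have "\<bar>sroot Q (x - c + y) - sroot Q (x - c)\<bar> \<le> d * norm y"
        using sroot_diff_le[OF ctx, of "x - c" y] Q_sqrt_le[OF ctx, of y] by linarith
      from mult_left_mono[OF this k]
      have "\<bar>k * (sroot Q (x - c + y) - sroot Q (x - c))\<bar> \<le> k * d * norm y"
        using k by (simp add: abs_mult)
      moreover have "x + y - c = x - c + y" by simp
      ultimately show ?thesis by (simp only: fn right_diff_distrib)
    qed
    show "\<bar>root_fn W k c (x + y) - root_fn W k c x - root_grad W k c x \<bullet> y\<bar> \<le> k * d\<^sup>2 * (norm y)\<^sup>2"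
    proof -
      have "\<bar>sroot Q (x - c + y) - sroot Q (x - c) - Q (x - c) \<bullet> y / sroot Q (x - c)\<bar> \<le> d\<^sup>2 * (norm y)\<^sup>2"
        using sroot_remainder[OF ctx, of "x - c" y] Qle[of y] by linarith
      from mult_left_mono[OF this k]
      have "\<bar>k * (sroot Q (x - c + y) - sroot Q (x - c) - Q (x - c) \<bullet> y / sroot Q (x - c))\<bar> \<le> k * d\<^sup>2 * (norm y)\<^sup>2"
        using k by (simp add: abs_mult)
      moreover have "x + y - c = x - c + y" by simp
      ultimately show ?thesis by (simp only: fn gr) (simp add: right_diff_distrib)
    qed
    show "norm (root_grad W k c x) \<le> k * d"
    proof -
      have "norm (Q (x - c)) \<le> d * sroot Q (x - c)"
        using Q_norm_le[OF ctx, of "x - c"] mult_left_mono[OF sroot_ge[OF ctx, of "x - c"] d] by linarith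
      then have "norm (Q (x - c)) / sroot Q (x - c) \<le> d"
        using sroot_pos[OF ctx, of "x - c"] by (simp add: divide_le_eq)
      from mult_left_mono[OF this k] show ?thesis
        using k sroot_pos[OF ctx, of "x - c"] by (simp add: gr)
    qed
    show "root_grad W k c x \<in> adj_dom D A" unfolding root_grad_def by (rule adj_B_scaleR)
  next
    let ?D2 = "\<lambda>x. k *\<^sub>R sroot_D2 Q (x - c)"
    have "(root_grad W k c has_derivative blinfun_apply (?D2 x)) (at x)" for x
    proof -
      have "((\<lambda>x. x - c) has_derivative (\<lambda>h. h)) (at x)"
        by (auto intro!: derivative_eq_intros)
      from has_derivative_compose[OF this sroot_has_D2[OF ctx, of "x - c"]]
      have "((\<lambda>x. (1 / sroot Q (x - c)) *\<^sub>R Q (x - c)) has_derivative blinfun_apply (sroot_D2 Q (x - c))) (at x)" .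
      from has_derivative_scaleR_right[OF this, of k] show ?thesis
        unfolding gr[abs_def] by (simp add: scaleR_blinfun.rep_eq)
    qed
    moreover have "bdd_lip ?D2"
      by (rule bdd_lip_linear[OF bounded_linear_scaleR_right bdd_lip_shift[OF bdd_lip_sroot_D2[OF ctx]]])
    ultimately show "\<exists>D2. (\<forall>x. (root_grad W k c has_derivative blinfun_apply (D2 x)) (at x)) \<and>
        uniformly_continuous_on UNIV D2"
      by (intro exI[of _ ?D2]) (simp add: bdd_lip_uniformly_continuous)
  next
    have "bdd_lip (\<lambda>z. (1 / sroot Q z) *\<^sub>R Q z)"
      by (rule bdd_lip_linear_div_sroot[OF ctx blinfun.bounded_linear_right Q_norm_le[OF ctx] d])
    from bdd_lip_linear[OF bounded_linear_scaleR_right bdd_lip_shift[OF this]]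
    show "uniformly_continuous_on UNIV (root_grad W k c)"
      unfolding gr[abs_def] by (rule bdd_lip_uniformly_continuous)
  next
    have bl: "bounded_linear (\<lambda>z. AB (W (B z)))"
      by (rule bounded_linear_compose[OF bounded_linear_AB
            bounded_linear_compose[OF blinfun.bounded_linear_right blinfun.bounded_linear_right]])
    have "norm (AB (W (B z))) \<le> (KAB * sqrt (norm W)) * sqrt (Q z \<bullet> z)" for z
    proof -
      have "norm (W (B z)) \<le> sqrt (norm W * (W (B z) \<bullet> B z))"
        using Wn[of "B z"] by (simp add: real_le_rsqrt)
      then have "KAB * norm (W (B z)) \<le> KAB * (sqrt (norm W) * sqrt (Q z \<bullet> z))"
        using KAB(1) by (intro mult_left_mono) (auto simp: Qf real_sqrt_mult)
      then show ?thesis using KAB(2)[of "W (B z)"] by (simp add: mult.assoc)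
    qed
    from bdd_lip_linear_div_sroot[OF ctx bl this]
    have "bdd_lip (\<lambda>z. (1 / sroot Q z) *\<^sub>R AB (W (B z)))" using KAB(1) by simp
    from bdd_lip_linear[OF bounded_linear_scaleR_right[of k] bdd_lip_shift[OF this, of c]]
    have "bdd_lip (\<lambda>x. adj_op D A (root_grad W k c x))"
      by (simp add: root_grad_adj sroot_def Qf)
    then show "uniformly_continuous_on UNIV (\<lambda>x. adj_op D A (root_grad W k c x))"
      by (rule bdd_lip_uniformly_continuous)
  next
    fix X x assume X: "(\<lambda>k. B (X k)) \<longlonglongrightarrow> B x"
    have Xc: "(\<lambda>n. B (X n - c)) \<longlonglongrightarrow> B (x - c)"
      unfolding blinfun.diff_right by (intro tendsto_diff X tendsto_const)
    have "(\<lambda>n. W (B (X n - c)) \<bullet> B (X n - c)) \<longlonglongrightarrow> W (B (x - c)) \<bullet> B (x - c)"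
      by (rule tendsto_inner[OF bounded_linear.tendsto[OF blinfun.bounded_linear_right Xc] Xc])
    then show "(\<lambda>n. root_fn W k c (X n)) \<longlonglongrightarrow> root_fn W k c x"
      unfolding root_fn_def by (intro tendsto_mult tendsto_real_sqrt tendsto_add tendsto_const)
  next
    have "\<bar>root_fn W k c x\<bar> \<le> (k * (1 + sqrt (norm W) * (1 + norm (B c)))) * (1 + norm (B x))" for x
    proof -
      have "W (B (x - c)) \<bullet> B (x - c) \<le> norm W * (norm (B (x - c)))\<^sup>2" by (rule blinfun_form_le)
      then have "sqrt (Q (x - c) \<bullet> (x - c)) \<le> sqrt (norm W) * norm (B (x - c))"
        using real_sqrt_le_mono by (fastforce simp: Qf real_sqrt_mult)
      moreover have "sroot Q (x - c) \<le> 1 + sqrt (Q (x - c) \<bullet> (x - c))"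
        using sroot_triangle[OF ctx, of 0 "x - c"] by (simp add: sroot_def)
      moreover have "sqrt (norm W) * norm (B (x - c)) \<le> sqrt (norm W) * (norm (B x) + norm (B c))"
        by (intro mult_left_mono) (simp_all add: blinfun.diff_right norm_triangle_ineq4)
      moreover have "1 + sqrt (norm W) * (norm (B x) + norm (B c))
          \<le> (1 + sqrt (norm W) * (1 + norm (B c))) * (1 + norm (B x))"
        by (simp add: algebra_simps)
      ultimately have "sroot Q (x - c) \<le> (1 + sqrt (norm W) * (1 + norm (B c))) * (1 + norm (B x))"
        by linarith
      from mult_left_mono[OF this k] show ?thesis
        using k sroot_pos[OF ctx, of "x - c"] by (simp add: fn abs_mult mult.assoc)
    qed
    then show "\<exists>K. \<forall>x. \<bar>root_fn W k c x\<bar> \<le> K * (1 + norm (B x))" by blast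
  qed
qed

end

section \<open>Sine test functions, and sums of a function of time and one of space\<close>

lemma cos_lip: "\<bar>cos x - cos y\<bar> \<le> \<bar>x - y\<bar>" for x y :: real
  using field_differentiable_bound[of UNIV cos "\<lambda>x. - sin x" 1 x y]
  by (simp add: DERIV_cos)

lemma sin_lip: "\<bar>sin x - sin y\<bar> \<le> \<bar>x - y\<bar>" for x y :: real
  using field_differentiable_bound[of UNIV sin cos 1 x y] by (simp add: DERIV_sin)

lemma sin_remainder: "\<bar>sin (a + t) - sin a - t * cos a\<bar> \<le> t\<^sup>2" for a t :: real
proof -
  let ?f = "\<lambda>s. sin (a + s) - sin a - s * cos a"
  have "norm (?f t - ?f 0) \<le> \<bar>t\<bar> * norm (t - 0)"
  proof (rule field_differentiable_bound[of "{-\<bar>t\<bar>..\<bar>t\<bar>}"])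
    fix s assume s: "s \<in> {-\<bar>t\<bar>..\<bar>t\<bar>}"
    show "(?f has_field_derivative (cos (a + s) - cos a)) (at s within {-\<bar>t\<bar>..\<bar>t\<bar>})"
      by (auto intro!: derivative_eq_intros)
    show "norm (cos (a + s) - cos a) \<le> \<bar>t\<bar>" using cos_lip[of "a + s" a] s by auto
  qed auto
  then show ?thesis by (simp add: power2_eq_square flip: abs_mult)
qed

context setting begin

text \<open>A bounded function tangent at \<open>c\<close> to the linear functional
  \<open>k * (p \<bullet> B (x - c))\<close>. Its gradient is a bounded multiple of the fixed vector
  \<open>B p\<close>.\<close>

definition sin_fn :: "real \<Rightarrow> 'a \<Rightarrow> 'a \<Rightarrow> 'a \<Rightarrow> real" where
  "sin_fn k p c x = k * sin (p \<bullet> B (x - c))"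

definition sin_grad :: "real \<Rightarrow> 'a \<Rightarrow> 'a \<Rightarrow> 'a \<Rightarrow> 'a" where
  "sin_grad k p c x = (k * cos (p \<bullet> B (x - c))) *\<^sub>R B p"

lemma sin_grad_adj: "adj_op D A (sin_grad k p c x) = (k * cos (p \<bullet> B (x - c))) *\<^sub>R AB p"
  unfolding sin_grad_def AB_def by (rule adj_B_scaleR)

lemma sin_adj_le:
  assumes "0 \<le> k"
  shows "norm (adj_op D A (sin_grad k p c x)) \<le> k * KAB * norm p"
proof -
  have "norm (adj_op D A (sin_grad k p c x)) = (k * \<bar>cos (p \<bullet> B (x - c))\<bar>) * norm (AB p)"
    using assms by (simp add: sin_grad_adj abs_mult)
  also have "\<dots> \<le> (k * 1) * (KAB * norm p)"
    using assms by (intro mult_mono KAB mult_left_mono) auto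
  finally show ?thesis by simp
qed

lemma stest_sin:
  assumes k: "0 \<le> k"
  shows "stest (k * norm (B p)) (k * (norm (B p))\<^sup>2) (sin_fn k p c) (sin_grad k p c)"
proof -
  define l where "l x = p \<bullet> B (x - c)" for x
  have l_add: "l (x + y) = l x + B p \<bullet> y" for x y
    by (simp add: l_def blinfun.diff_right blinfun.add_right inner_simps B_adj)
  have l_diff: "\<bar>l x - l y\<bar> \<le> norm (B p) * norm (x - y)" for x y
  proof -
    have "l x - l y = B p \<bullet> (x - y)" using l_add[of y "x - y"] by simp
    then show ?thesis using Cauchy_Schwarz_ineq2[of "B p" "x - y"] by simp
  qed
  have fn: "sin_fn k p c x = k * sin (l x)" for x by (simp add: sin_fn_def l_def)
  have gr: "sin_grad k p c x = (k * cos (l x)) *\<^sub>R B p" for x by (simp add: sin_grad_def l_def)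
  have cs: "\<bar>B p \<bullet> y\<bar> \<le> norm (B p) * norm y" for y by (rule Cauchy_Schwarz_ineq2)
  have lip_sin: "bdd_lip (\<lambda>x. sin (l x))"
    by (rule bdd_lipI[where K=1 and L="norm (B p)"])
       (simp, use order.trans[OF sin_lip l_diff] in simp)
  have lip_cos: "bdd_lip (\<lambda>x. cos (l x))"
    by (rule bdd_lipI[where K=1 and L="norm (B p)"])
       (simp, use order.trans[OF cos_lip l_diff] in simp)
  show ?thesis unfolding stest_def
  proof (intro conjI allI impI)
    fix x y
    show "\<bar>sin_fn k p c (x + y) - sin_fn k p c x\<bar> \<le> k * norm (B p) * norm y"
    proof -
      have "\<bar>sin (l (x + y)) - sin (l x)\<bar> \<le> norm (B p) * norm y"
        using order.trans[OF sin_lip l_diff, of "x + y" x] by simp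
      from mult_left_mono[OF this k] show ?thesis
        unfolding fn right_diff_distrib[symmetric] abs_mult using k by simp
    qed
    show "\<bar>sin_fn k p c (x + y) - sin_fn k p c x - sin_grad k p c x \<bullet> y\<bar> \<le> k * (norm (B p))\<^sup>2 * (norm y)\<^sup>2"
    proof -
      have "\<bar>sin (l (x + y)) - sin (l x) - (B p \<bullet> y) * cos (l x)\<bar> \<le> (B p \<bullet> y)\<^sup>2"
        unfolding l_add by (rule sin_remainder)
      also have "\<dots> \<le> (norm (B p) * norm y)\<^sup>2" using cs[of y] by (rule abs_le_square_iff[THEN iffD1, OF order.trans[OF _ abs_ge_self]])
      finally have "k * \<bar>sin (l (x + y)) - sin (l x) - (B p \<bullet> y) * cos (l x)\<bar> \<le> k * (norm (B p) * norm y)\<^sup>2"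
        using k by (intro mult_left_mono)
      then have "\<bar>k * (sin (l (x + y)) - sin (l x) - (B p \<bullet> y) * cos (l x))\<bar> \<le> k * (norm (B p))\<^sup>2 * (norm y)\<^sup>2"
        using k by (simp add: abs_mult power_mult_distrib mult.assoc)
      then show ?thesis unfolding fn gr by (simp add: algebra_simps)
    qed
    show "norm (sin_grad k p c x) \<le> k * norm (B p)"
    proof -
      have "k * \<bar>cos (l x)\<bar> \<le> k * 1" using k by (intro mult_left_mono) auto
      from mult_right_mono[OF this, of "norm (B p)"] show ?thesis using k by (simp add: gr abs_mult)
    qed
    show "sin_grad k p c x \<in> adj_dom D A" unfolding sin_grad_def by (rule adj_B_scaleR)
  next
    let ?D2 = "\<lambda>x. (- (k * sin (l x))) *\<^sub>R rank_one (B p) (B p)"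
    have l_der: "(l has_derivative (\<lambda>h. B p \<bullet> h)) (at x)" for x
    proof -
      have "l = (\<lambda>x. B p \<bullet> (x - c))" by (rule ext) (simp add: l_def B_adj)
      then show ?thesis by (auto intro!: derivative_eq_intros)
    qed
    have "(sin_grad k p c has_derivative blinfun_apply (?D2 x)) (at x)" for x
    proof -
      have "((\<lambda>x. (k * cos (l x)) *\<^sub>R B p) has_derivative (\<lambda>h. (k * (- sin (l x) * (B p \<bullet> h))) *\<^sub>R B p)) (at x)"
        by (intro has_derivative_scaleR_left has_derivative_mult_right)
           (auto intro!: derivative_eq_intros l_der)
      moreover have "blinfun_apply (?D2 x) = (\<lambda>h. (k * (- sin (l x) * (B p \<bullet> h))) *\<^sub>R B p)"
        by (rule ext) (simp add: blinfun.bilinear_simps rank_one_apply)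
      ultimately show ?thesis unfolding gr[abs_def] by simp
    qed
    moreover have "uniformly_continuous_on UNIV ?D2"
    proof (rule bdd_lip_uniformly_continuous)
      have bl: "bounded_linear (\<lambda>r. (- (k * r)) *\<^sub>R rank_one (B p) (B p))"
        by (intro bounded_linear_scaleR_const bounded_linear_minus bounded_linear_mult_right)
      from bdd_lip_linear[OF bl lip_sin] show "bdd_lip ?D2" .
    qed
    ultimately show "\<exists>D2. (\<forall>x. (sin_grad k p c has_derivative blinfun_apply (D2 x)) (at x)) \<and>
        uniformly_continuous_on UNIV D2" by (intro exI[of _ ?D2]) simp
  next
    have bl: "bounded_linear (\<lambda>r. (k * r) *\<^sub>R w)" for w :: 'a
      by (intro bounded_linear_scaleR_const bounded_linear_mult_right)
    show "uniformly_continuous_on UNIV (sin_grad k p c)"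
      unfolding gr[abs_def] by (rule bdd_lip_uniformly_continuous[OF bdd_lip_linear[OF bl lip_cos]])
    show "uniformly_continuous_on UNIV (\<lambda>x. adj_op D A (sin_grad k p c x))"
      unfolding sin_grad_adj l_def[symmetric]
      by (rule bdd_lip_uniformly_continuous[OF bdd_lip_linear[OF bl lip_cos]])
  next
    fix X x assume X: "(\<lambda>k. B (X k)) \<longlonglongrightarrow> B x"
    then have "(\<lambda>n. p \<bullet> (B (X n) - B c)) \<longlonglongrightarrow> p \<bullet> (B x - B c)"
      by (intro tendsto_inner tendsto_diff tendsto_const)
    then show "(\<lambda>n. sin_fn k p c (X n)) \<longlonglongrightarrow> sin_fn k p c x"
      unfolding sin_fn_def blinfun.diff_right by (intro tendsto_mult tendsto_sin tendsto_const)
  next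
    have "\<bar>sin_fn k p c x\<bar> \<le> k * (1 + norm (B x))" for x
    proof -
      have "k * \<bar>sin (l x)\<bar> \<le> k * (1 + norm (B x))"
        using k by (intro mult_left_mono order.trans[OF abs_sin_le_one]) auto
      then show ?thesis using k by (simp add: fn abs_mult)
    qed
    then show "\<exists>K. \<forall>x. \<bar>sin_fn k p c x\<bar> \<le> K * (1 + norm (B x))" by blast
  qed
qed

lemma stest_GDERIV: "stest L1 L2 f f' \<Longrightarrow> GDERIV f x :> f' x"
  by (rule GDERIV_quadraticI) (rule stestD(2))

lemma stest_uniformly_continuous:
  assumes "stest L1 L2 f f'"
  shows "uniformly_continuous_on UNIV f"
proof (rule lipschitz_imp_uniformly_continuous)
  fix x y
  show "dist (f x) (f y) \<le> L1 * dist x y"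
    using stestD(1)[OF assms, of y "x - y"] by (simp add: dist_norm)
qed

lemma uniformly_continuous_on_mono:
  fixes f :: "'m::metric_space \<Rightarrow> 'n::metric_space"
  shows "uniformly_continuous_on S f \<Longrightarrow> R \<subseteq> S \<Longrightarrow> uniformly_continuous_on R f"
  unfolding uniformly_continuous_on_def by (meson subsetD)

lemma uniformly_continuous_on_separated:
  fixes g :: "real \<Rightarrow> 'b::real_normed_vector" and f :: "'a \<Rightarrow> 'b"
  assumes "uniformly_continuous_on I g" "uniformly_continuous_on UNIV f"
  shows "uniformly_continuous_on (I \<times> UNIV) (\<lambda>(t, x). g t + f x)"
proof -
  have "uniformly_continuous_on (I \<times> UNIV) (\<lambda>z. g (fst z) + f (snd z))"
  proof (intro uniformly_continuous_on_add)
    have 1: "uniformly_continuous_on (I \<times> (UNIV :: 'a set)) fst" "uniformly_continuous_on (I \<times> (UNIV :: 'a set)) snd"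
      by (intro bounded_linear.uniformly_continuous_on[OF bounded_linear_fst] uniformly_continuous_on_id
          bounded_linear.uniformly_continuous_on[OF bounded_linear_snd])+
    show "uniformly_continuous_on (I \<times> (UNIV :: 'a set)) (\<lambda>z. g (fst z))"
      by (rule uniformly_continuous_on_compose[OF 1(1) uniformly_continuous_on_mono[OF assms(1)]]) auto
    show "uniformly_continuous_on (I \<times> (UNIV :: 'a set)) (\<lambda>z. f (snd z))"
      by (rule uniformly_continuous_on_compose[OF 1(2) uniformly_continuous_on_mono[OF assms(2)]]) auto
  qed
  then show ?thesis by (simp add: case_prod_beta')
qed

lemma continuous_on_separated:
  fixes g :: "real \<Rightarrow> 'b::real_normed_vector" and f :: "'a \<Rightarrow> 'b"
  assumes "continuous_on I g" "uniformly_continuous_on UNIV f"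
  shows "continuous_on (I \<times> UNIV) (\<lambda>(t, x). g t + f x)"
  unfolding case_prod_beta'
  by (intro continuous_on_add continuous_on_compose2[OF assms(1)] continuous_on_fst continuous_on_snd continuous_on_id
      continuous_on_compose2[OF uniformly_continuous_imp_continuous[OF assms(2)]]) auto

text \<open>Uniform continuity in time comes from compactness of
  \<open>[\<epsilon>, T - \<epsilon>]\<close>, in space from \<open>stest\<close>. Nothing is asked
  of \<open>a\<close> near 0 or \<open>T\<close>, so barriers such as \<open>\<mu> / t\<close> are
  admissible.\<close>

lemma test_fun2_separated:
  assumes a: "time_test T a a'" and f: "stest L1 L2 f f'"
  shows "test_fun2 T D A B (\<lambda>t x. a t + f x)"
proof -
  have a_der: "(a has_real_derivative a' t) (at t)" if "t \<in> {0<..<T}" for t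
    using a that by (simp add: time_test_def)
  have a_cont: "continuous_on {0<..<T} a"
    using a_der by (intro continuous_at_imp_continuous_on) (blast intro: DERIV_isCont)
  have a'_cont: "continuous_on {0<..<T} a'" using a by (simp add: time_test_def)
  have sub: "{\<epsilon>..T - \<epsilon>} \<subseteq> {0<..<T}" if "\<epsilon> > 0" for \<epsilon> using that by auto
  have a_uc: "uniformly_continuous_on {\<epsilon>..T - \<epsilon>} a" "uniformly_continuous_on {\<epsilon>..T - \<epsilon>} a'" if "\<epsilon> > 0" for \<epsilon>
    using sub[OF that] a_cont a'_cont by (auto intro!: compact_uniformly_continuous intro: continuous_on_subset)
  note uc_f = stest_uniformly_continuous[OF f]
  have uc_f': "uniformly_continuous_on UNIV f'" "uniformly_continuous_on UNIV (\<lambda>x. adj_op D A (f' x))"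
    using f unfolding stest_def by auto
  obtain D2 where D2: "\<And>x. (f' has_derivative blinfun_apply (D2 x)) (at x)" "uniformly_continuous_on UNIV D2"
    using f unfolding stest_def by blast
  obtain K where K: "\<And>x. \<bar>f x\<bar> \<le> K * (1 + norm (B x))" using f unfolding stest_def by blast
  have "test_conds1 T D A B (\<lambda>t x. a t + f x) (\<lambda>t x. a' t) (\<lambda>t x. f' x)"
    unfolding test_conds1_def
  proof (intro conjI ballI allI impI)
    fix t x assume t: "t \<in> {0<..<T}"
    show "((\<lambda>s. a s + f x) has_real_derivative a' t) (at t)"
      using DERIV_add[OF a_der[OF t] DERIV_const[of "f x"]] by simp
    show "GDERIV (\<lambda>x. a t + f x) x :> f' x"
      using GDERIV_add[OF GDERIV_const stest_GDERIV[OF f], of "a t" x] by simp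
    show "f' x \<in> adj_dom D A" by (rule stestD(4)[OF f])
  next
    show "continuous_on ({0<..<T} \<times> UNIV) (\<lambda>(t, x). a t + f x)"
      by (rule continuous_on_separated[OF a_cont uc_f])
    show "continuous_on ({0<..<T} \<times> UNIV) (\<lambda>(t, x::'a). a' t)"
      using continuous_on_separated[OF a'_cont uniformly_continuous_on_const[of UNIV 0]] by simp
    show "continuous_on ({0<..<T} \<times> UNIV) (\<lambda>(t, x). f' x)"
      using continuous_on_separated[OF continuous_on_const[of _ 0] uc_f'(1)] by simp
  next
    show "B_lsc_on B ({0<..<T} \<times> UNIV) (\<lambda>t x. a t + f x)"
      unfolding B_lsc_on_def
    proof (intro allI impI, elim conjE)
      fix \<tau> X t x assume *: "(t, x) \<in> {0<..<T} \<times> UNIV" "\<tau> \<longlonglongrightarrow> t" "(\<lambda>k. B (X k)) \<longlonglongrightarrow> B x"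
      have "(\<lambda>k. a (\<tau> k)) \<longlonglongrightarrow> a t"
        using *(1,2) a_der[of t] by (intro isCont_tendsto_compose[of t a] DERIV_isCont) auto
      then have "(\<lambda>k. ereal (a (\<tau> k) + f (X k))) \<longlonglongrightarrow> ereal (a t + f x)"
        by (intro tendsto_intros stestD(5)[OF f] *)
      then have "liminf (\<lambda>k. ereal (a (\<tau> k) + f (X k))) = ereal (a t + f x)"
        by (rule lim_imp_Liminf[OF sequentially_bot])
      then show "ereal (a t + f x) \<le> liminf (\<lambda>k. ereal (a (\<tau> k) + f (X k)))" by simp
    qed
  next
    fix \<epsilon> :: real assume e: "\<epsilon> > 0"
    show "uniformly_continuous_on ({\<epsilon>..T - \<epsilon>} \<times> UNIV) (\<lambda>(t, x). a t + f x)"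
      by (rule uniformly_continuous_on_separated[OF a_uc(1)[OF e] uc_f])
    show "uniformly_continuous_on ({\<epsilon>..T - \<epsilon>} \<times> UNIV) (\<lambda>(t, x::'a). a' t)"
      using uniformly_continuous_on_separated[OF a_uc(2)[OF e] uniformly_continuous_on_const[of UNIV 0]] by simp
    show "uniformly_continuous_on ({\<epsilon>..T - \<epsilon>} \<times> UNIV) (\<lambda>(t, x). f' x)"
      using uniformly_continuous_on_separated[OF uniformly_continuous_on_const[of _ 0] uc_f'(1)] by simp
    show "uniformly_continuous_on ({\<epsilon>..T - \<epsilon>} \<times> UNIV) (\<lambda>(t, x). adj_op D A (f' x))"
      using uniformly_continuous_on_separated[OF uniformly_continuous_on_const[of _ 0] uc_f'(2)] by simp
    fix r
    have "bounded (a ` {\<epsilon>..T - \<epsilon>})"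
      by (intro compact_imp_bounded compact_continuous_image continuous_on_subset[OF a_cont] sub[OF e]) simp
    then obtain Ka where Ka: "\<And>t. t \<in> {\<epsilon>..T - \<epsilon>} \<Longrightarrow> \<bar>a t\<bar> \<le> Ka"
      unfolding bounded_iff by (metis imageI real_norm_def)
    have "\<bar>a t + f x\<bar> \<le> Ka + \<bar>K\<bar> * (1 + b * r)" if "t \<in> {\<epsilon>..T - \<epsilon>}" "norm_m1 B x \<le> r" for t x
    proof -
      have "norm (B x) \<le> b * r"
        using B_norm_le_nm[of x] mult_left_mono[OF that(2)[unfolded norm_m1_nm] less_imp_le[OF b_pos(1)]] by linarith
      then have "K * (1 + norm (B x)) \<le> \<bar>K\<bar> * (1 + b * r)"
        by (intro mult_mono) auto
      then show ?thesis using Ka[OF that(1)] K[of x] by linarith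
    qed
    then show "bounded ((\<lambda>(t, x). a t + f x) ` ({\<epsilon>..T - \<epsilon>} \<times> {x. norm_m1 B x \<le> r}))"
      unfolding bounded_iff by (intro exI[of _ "Ka + \<bar>K\<bar> * (1 + b * r)"]) auto
  qed
  moreover have "continuous_on ({0<..<T} \<times> UNIV) (\<lambda>(t, x). D2 x)"
    using continuous_on_separated[OF continuous_on_const[of _ 0] D2(2)] by simp
  moreover have "uniformly_continuous_on ({\<epsilon>..T - \<epsilon>} \<times> UNIV) (\<lambda>(t, x). D2 x)" for \<epsilon>
    using uniformly_continuous_on_separated[OF uniformly_continuous_on_const[of _ 0] D2(2)] by simp
  ultimately show ?thesis unfolding test_fun2_def using D2(1)
    by (intro exI[of _ "\<lambda>t x. a' t"] exI[of _ "\<lambda>t x. f' x"] exI[of _ "\<lambda>t x. D2 x"]) simp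
qed

end

section \<open>The Hamiltonian and approximate solutions\<close>

lemma exp_diff_le:
  fixes a b c :: real
  assumes "\<bar>a\<bar> \<le> c" "\<bar>b\<bar> \<le> c"
  shows "\<bar>exp a - exp b\<bar> \<le> exp c * \<bar>a - b\<bar>"
proof -
  have "norm (exp a - exp b) \<le> exp c * norm (a - b)"
    by (rule field_differentiable_bound[of "{-c..c}" exp exp])
       (use assms in \<open>auto intro: DERIV_subset[OF DERIV_exp]\<close>)
  then show ?thesis by simp
qed

lemma exp_minus_linear_diff_le:
  fixes a b c :: real
  assumes "\<bar>a\<bar> \<le> c" "\<bar>b\<bar> \<le> c"
  shows "\<bar>(exp a - 1 - a) - (exp b - 1 - b)\<bar> \<le> c * exp c * \<bar>a - b\<bar>"
proof -
  have "norm ((exp a - 1 - a) - (exp b - 1 - b)) \<le> c * exp c * norm (a - b)"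
  proof (rule field_differentiable_bound[of "{-c..c}" _ "\<lambda>s. exp s - 1"])
    fix s assume s: "s \<in> {-c..c}"
    show "((\<lambda>a. exp a - 1 - a) has_field_derivative exp s - 1) (at s within {-c..c})"
      by (auto intro!: derivative_eq_intros)
    have "\<bar>exp s - exp 0\<bar> \<le> exp c * \<bar>s - 0\<bar>" using s by (intro exp_diff_le) auto
    also have "\<dots> \<le> exp c * c" using s by (intro mult_left_mono) auto
    finally show "norm (exp s - 1) \<le> c * exp c" by (simp add: mult.commute)
  qed (use assms in auto)
  then show ?thesis by simp
qed

locale equation = setting B D A c0 for B :: "'a::{real_inner,polish_space} \<Rightarrow>\<^sub>L 'a" and D A c0 +
  fixes F :: "'a \<Rightarrow> 'a" and G :: "'a \<Rightarrow> 'a \<Rightarrow>\<^sub>L 'a" and \<nu> :: "'a measure" and M :: real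
  assumes nu_borel: "sets \<nu> = sets borel"
    and M: "0 \<le> M"
    and F_zero: "norm (F 0) \<le> M"
    and F_lip: "\<And>x y. norm (F x - F y) \<le> M * norm_m1 B (x - y)"
    and G_lip: "\<And>x y. norm (G x - G y) \<le> M * norm_m1 B (x - y)"
    and G_bound: "\<And>x. norm (G x) \<le> M"
    and nu_exp: "\<And>K. 0 < K \<Longrightarrow> (\<integral>\<^sup>+ z. ennreal ((norm z)\<^sup>2 * exp (K * norm z)) \<partial>\<nu>) < \<infinity>"
begin

lemma measurable_continuous: "continuous_on UNIV f \<Longrightarrow> f \<in> borel_measurable \<nu>" for f :: "'a \<Rightarrow> real"
  using borel_measurable_continuous_onI measurable_cong_sets[OF nu_borel refl] by blast

text \<open>The dominating function for all integrands below, integrable by the exponential moments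
  of \<nu>; \<open>k\<close> is the slope of the exponent.\<close>

definition "weight k z = (norm z)\<^sup>2 * exp (k * norm z)" for z :: 'a

definition "Iw k = (LINT z|\<nu>. weight k z)"

lemma weight_nonneg: "0 \<le> weight k z" by (simp add: weight_def)

lemma weight_integrable: "0 < k \<Longrightarrow> integrable \<nu> (weight k)"
proof (rule integrableI_nonneg)
  show "weight k \<in> borel_measurable \<nu>"
    unfolding weight_def by (intro measurable_continuous continuous_intros)
qed (use nu_exp weight_nonneg in \<open>auto simp: weight_def\<close>)

lemma Iw_nonneg: "0 \<le> Iw k" unfolding Iw_def by (rule Bochner_Integration.integral_nonneg) (rule weight_nonneg)

text \<open>This is \<open>H\<^sub>0(G\<^sup>*(x) p)\<close>, written without the adjoint.\<close>

definition "HG x p = (LINT z|\<nu>. exp (p \<bullet> G x z) - 1 - p \<bullet> G x z)"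

lemma levy_H0_eq: "levy_H0 \<nu> (adjoint (blinfun_apply (G x)) p) = HG x p"
proof -
  have "adjoint (blinfun_apply (G x)) p \<bullet> z = p \<bullet> G x z" for z
    using adjoint_works_hilbert[of z "G x" p] by (simp add: inner_commute)
  then show ?thesis by (simp add: levy_H0_def HG_def)
qed

lemma G_norm: "norm (G x z) \<le> M * norm z"
  using norm_blinfun[of "G x" z] mult_right_mono[OF G_bound[of x], of "norm z"] by simp

lemma G_pair_le: "norm p * M \<le> K \<Longrightarrow> \<bar>p \<bullet> G x z\<bar> \<le> K * norm z"
proof -
  assume K: "norm p * M \<le> K"
  have "\<bar>p \<bullet> G x z\<bar> \<le> norm p * norm (G x z)" by (rule Cauchy_Schwarz_ineq2)
  also have "\<dots> \<le> norm p * (M * norm z)" by (intro mult_left_mono G_norm) auto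
  also have "\<dots> = (norm p * M) * norm z" by simp
  also have "\<dots> \<le> K * norm z" using K by (intro mult_right_mono) auto
  finally show ?thesis .
qed

lemma HG_integrable:
  assumes "norm p * M \<le> K" "0 < K"
  shows "integrable \<nu> (\<lambda>z. exp (p \<bullet> G x z) - 1 - p \<bullet> G x z)"
proof (rule Bochner_Integration.integrable_bound)
  show "integrable \<nu> (\<lambda>z. K\<^sup>2 * weight K z)" by (intro integrable_mult_right weight_integrable assms)
  show "(\<lambda>z. exp (p \<bullet> G x z) - 1 - p \<bullet> G x z) \<in> borel_measurable \<nu>"
    by (intro measurable_continuous continuous_intros)
  show "AE z in \<nu>. norm (exp (p \<bullet> G x z) - 1 - p \<bullet> G x z) \<le> norm (K\<^sup>2 * weight K z)"
  proof (intro AE_I2)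
    fix z
    have "\<bar>(exp (p \<bullet> G x z) - 1 - p \<bullet> G x z) - (exp 0 - 1 - 0)\<bar> \<le> (K * norm z) * exp (K * norm z) * \<bar>p \<bullet> G x z - 0\<bar>"
      using assms by (intro exp_minus_linear_diff_le G_pair_le) auto
    also have "\<dots> \<le> (K * norm z) * exp (K * norm z) * (K * norm z)"
      using assms G_pair_le[OF assms(1), of x z] by (intro mult_left_mono) auto
    also have "\<dots> = K\<^sup>2 * weight K z" by (simp add: weight_def power2_eq_square)
    finally have "\<bar>exp (p \<bullet> G x z) - 1 - p \<bullet> G x z\<bar> \<le> K\<^sup>2 * weight K z" by simp
    then show "norm (exp (p \<bullet> G x z) - 1 - p \<bullet> G x z) \<le> norm (K\<^sup>2 * weight K z)"
      unfolding real_norm_def by (rule order.trans[OF _ abs_ge_self])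
  qed
qed

text \<open>One estimate for simultaneous changes of the point and of the momentum: \<open>d\<close>
  measures the change of the linear exponent and \<open>K\<close> bounds its slope, so that the
  moment \<open>Iw K\<close> appears.\<close>

lemma HG_lip:
  assumes "norm p * M \<le> K" "norm q * M \<le> K" "0 < K" and d: "\<And>z. \<bar>p \<bullet> G x z - q \<bullet> G y z\<bar> \<le> d * norm z"
  shows "\<bar>HG x p - HG y q\<bar> \<le> d * K * Iw K"
proof -
  have int_w: "integrable \<nu> (\<lambda>z. (d * K) * weight K z)"
    by (rule integrable_mult_right) (rule weight_integrable[OF \<open>0 < K\<close>])
  have pt: "\<bar>(exp (p \<bullet> G x z) - 1 - p \<bullet> G x z) - (exp (q \<bullet> G y z) - 1 - q \<bullet> G y z)\<bar> \<le> (d * K) * weight K z" for z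
  proof -
    have "\<bar>(exp (p \<bullet> G x z) - 1 - p \<bullet> G x z) - (exp (q \<bullet> G y z) - 1 - q \<bullet> G y z)\<bar>
        \<le> (K * norm z) * exp (K * norm z) * \<bar>p \<bullet> G x z - q \<bullet> G y z\<bar>"
      by (rule exp_minus_linear_diff_le[OF G_pair_le[OF assms(1)] G_pair_le[OF assms(2)]])
    also have "\<dots> \<le> (K * norm z) * exp (K * norm z) * (d * norm z)"
      using \<open>0 < K\<close> by (intro mult_left_mono d) auto
    also have "\<dots> = (d * K) * weight K z" by (simp add: weight_def power2_eq_square)
    finally show ?thesis .
  qed
  have int: "integrable \<nu> (\<lambda>z. (exp (p \<bullet> G x z) - 1 - p \<bullet> G x z) - (exp (q \<bullet> G y z) - 1 - q \<bullet> G y z))"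
    by (intro Bochner_Integration.integrable_diff HG_integrable[OF assms(1,3)] HG_integrable[OF assms(2,3)])
  let ?d = "\<lambda>z. (exp (p \<bullet> G x z) - 1 - p \<bullet> G x z) - (exp (q \<bullet> G y z) - 1 - q \<bullet> G y z)"
  have "HG x p - HG y q = integral\<^sup>L \<nu> ?d"
    unfolding HG_def
    by (rule Bochner_Integration.integral_diff[symmetric, OF HG_integrable[OF assms(1,3)] HG_integrable[OF assms(2,3)]])
  moreover have "\<bar>integral\<^sup>L \<nu> ?d\<bar> \<le> (LINT z|\<nu>. \<bar>?d z\<bar>)" by (rule integral_abs_bound)
  moreover have "(LINT z|\<nu>. \<bar>?d z\<bar>) \<le> (LINT z|\<nu>. (d * K) * weight K z)"
    using integrable_abs[OF int] int_w by (rule Bochner_Integration.integral_mono) (rule pt)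
  moreover have "(LINT z|\<nu>. (d * K) * weight K z) = d * K * Iw K" by (simp add: Iw_def)
  ultimately show ?thesis by linarith
qed

text \<open>Both integrands have the compensator \<open>p \<bullet> G x z\<close>, so only two
  exponentials are compared. Their exponents differ by \<open>n\<close> times the second-order
  remainder at the jump \<open>G x z / n\<close>, that is by order
  \<open>(norm z)\<^sup>2 / n\<close>; the growth of the exponentials is absorbed by the moment
  \<open>Iw\<close>.\<close>

lemma jump_HG_diff:
  assumes n: "1 \<le> n" and lip: "\<And>y. \<bar>w (x + y) - w x\<bar> \<le> K0 * norm y" and K0: "0 \<le> K0"
    and rem: "\<And>y. \<bar>w (x + y) - w x - p \<bullet> y\<bar> \<le> L * (norm y)\<^sup>2" and L: "0 \<le> L" and p: "norm p \<le> K0"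
    and cont: "continuous_on UNIV w"
  shows "\<bar>nonlin_jump F G \<nu> n t x p w - (F x \<bullet> p + HG x p)\<bar> \<le> L * M\<^sup>2 / real n * Iw (K0 * M + 1)"
proof -
  \<comment> \<open>The 1 keeps \<open>K\<close> positive when \<open>K0 * M = 0\<close>, as
    \<open>weight_integrable\<close> requires.\<close>
  define K where "K = K0 * M + 1"
  define r where "r = real n"
  have r: "0 < r" "1 \<le> r" using n by (auto simp: r_def)
  have K: "0 < K" "norm p * M \<le> K"
    using K0 M mult_right_mono[OF p M] by (auto simp: K_def add_nonneg_pos)
  define a where "a z = r * (w (x + (1 / r) *\<^sub>R G x z) - w x)" for z
  define bb where "bb z = p \<bullet> G x z" for z
  have Gr: "norm ((1 / r) *\<^sub>R G x z) \<le> M * norm z / r" for z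
    using G_norm[of x z] r by (simp add: divide_right_mono)
  have a_le: "\<bar>a z\<bar> \<le> K * norm z" for z
  proof -
    have "\<bar>a z\<bar> \<le> r * (K0 * norm ((1 / r) *\<^sub>R G x z))"
      unfolding a_def abs_mult using mult_left_mono[OF lip[of "(1 / r) *\<^sub>R G x z"], of r] r by simp
    also have "\<dots> \<le> r * (K0 * (M * norm z / r))" using r K0 by (intro mult_left_mono Gr) auto
    also have "\<dots> = (K0 * M) * norm z" using r by simp
    also have "\<dots> \<le> K * norm z" by (intro mult_right_mono) (auto simp: K_def)
    finally show ?thesis .
  qed
  have ab: "\<bar>a z - bb z\<bar> \<le> L * M\<^sup>2 / r * (norm z)\<^sup>2" for z
  proof -
    have "a z - bb z = r * (w (x + (1 / r) *\<^sub>R G x z) - w x - p \<bullet> ((1 / r) *\<^sub>R G x z))"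
      using r by (simp add: a_def bb_def algebra_simps)
    then have "\<bar>a z - bb z\<bar> = r * \<bar>w (x + (1 / r) *\<^sub>R G x z) - w x - p \<bullet> ((1 / r) *\<^sub>R G x z)\<bar>"
      using r by (simp add: abs_mult)
    also have "\<dots> \<le> r * (L * (norm ((1 / r) *\<^sub>R G x z))\<^sup>2)" using r by (intro mult_left_mono rem) auto
    also have "\<dots> \<le> r * (L * (M * norm z / r)\<^sup>2)"
      using r L by (intro mult_left_mono power_mono Gr) auto
    also have "\<dots> = L * M\<^sup>2 / r * (norm z)\<^sup>2" using r by (simp add: power2_eq_square)
    finally show ?thesis .
  qed
  have e: "\<bar>exp (a z) - exp (bb z)\<bar> \<le> (L * M\<^sup>2 / r) * weight K z" for z
  proof -
    have "\<bar>exp (a z) - exp (bb z)\<bar> \<le> exp (K * norm z) * \<bar>a z - bb z\<bar>"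
      unfolding bb_def using K by (intro exp_diff_le a_le G_pair_le)
    also have "\<dots> \<le> exp (K * norm z) * (L * M\<^sup>2 / r * (norm z)\<^sup>2)" by (intro mult_left_mono ab) auto
    finally show ?thesis by (simp add: weight_def algebra_simps)
  qed
  have int: "integrable \<nu> (\<lambda>z. exp (a z) - exp (bb z))"
  proof (rule Bochner_Integration.integrable_bound)
    show "integrable \<nu> (\<lambda>z. (L * M\<^sup>2 / r) * weight K z)" by (intro integrable_mult_right weight_integrable K)
    have "continuous_on UNIV (\<lambda>z. w (x + (1 / r) *\<^sub>R G x z))"
      by (rule continuous_on_compose2[OF cont]) (auto intro!: continuous_intros)
    then show "(\<lambda>z. exp (a z) - exp (bb z)) \<in> borel_measurable \<nu>"
      unfolding a_def bb_def by (intro measurable_continuous continuous_intros)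
    show "AE z in \<nu>. norm (exp (a z) - exp (bb z)) \<le> norm ((L * M\<^sup>2 / r) * weight K z)"
      unfolding real_norm_def by (intro AE_I2 order.trans[OF e abs_ge_self])
  qed
  have "(exp (a z) - exp (bb z)) + (exp (bb z) - 1 - bb z) = exp (a z) - 1 - bb z" for z by simp
  then have "nonlin_jump F G \<nu> n t x p w - F x \<bullet> p = (LINT z|\<nu>. (exp (a z) - exp (bb z)) + (exp (bb z) - 1 - bb z))"
    by (simp only: nonlin_jump_def a_def bb_def r_def add_diff_cancel_left')
  also have "\<dots> = (LINT z|\<nu>. exp (a z) - exp (bb z)) + HG x p"
    unfolding HG_def bb_def[symmetric]
    by (rule Bochner_Integration.integral_add[OF int]) (use HG_integrable[OF K(2,1), of x] in \<open>simp add: bb_def\<close>)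
  finally have "nonlin_jump F G \<nu> n t x p w - (F x \<bullet> p + HG x p) = (LINT z|\<nu>. exp (a z) - exp (bb z))" by simp
  also have "\<bar>\<dots>\<bar> \<le> (LINT z|\<nu>. \<bar>exp (a z) - exp (bb z)\<bar>)" by (rule integral_abs_bound)
  also have "\<dots> \<le> (LINT z|\<nu>. (L * M\<^sup>2 / r) * weight K z)"
    by (rule integral_mono) (use int K e in \<open>auto intro!: integrable_mult_right weight_integrable\<close>)
  also have "\<dots> = L * M\<^sup>2 / real n * Iw (K0 * M + 1)" by (simp add: Iw_def K_def r_def)
  finally show ?thesis .
qed

text \<open>The gradient of \<open>\<delta> * h0 (norm x)\<close>.\<close>

definition rad :: "real \<Rightarrow> 'a \<Rightarrow> 'a" where
  "rad \<delta> x = \<delta> *\<^sub>R ((1 / (1 + (norm x)\<^sup>2)) *\<^sub>R x)"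

lemma rad_norm_le: "0 \<le> \<delta> \<Longrightarrow> norm (rad \<delta> x) \<le> \<delta>"
proof -
  assume \<delta>: "0 \<le> \<delta>"
  have "norm (rad \<delta> x) = \<delta> * \<bar>norm x / (1 + (norm x)\<^sup>2)\<bar>"
    using \<delta> by (simp add: rad_def abs_divide)
  also have "\<dots> \<le> \<delta> * 1" by (intro mult_left_mono h0_deriv_le \<delta>)
  finally show ?thesis by simp
qed

text \<open>A common form for both equations: the first order inequality with defect
  \<open>\<eta>\<close>, demanded only of test functions with the fixed bounds \<open>L1\<close>,
  \<open>L2\<close>. For \<open>v\<close> any \<open>\<eta> \<ge> 0\<close> works, for
  \<open>v\<^sub>n\<close> one of order \<open>1 / n\<close>. The cap
  \<open>\<delta> \<le> 1\<close> lets the radial term add at most 1 to the bounds.\<close>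

definition approx_sub :: "real \<Rightarrow> real \<Rightarrow> real \<Rightarrow> real \<Rightarrow> (real \<Rightarrow> 'a \<Rightarrow> real) \<Rightarrow> bool" where
  "approx_sub T \<eta> L1 L2 u \<longleftrightarrow> B_usc_on B ({0<..<T} \<times> UNIV) u \<and>
     (\<forall>a a' f f' \<delta>. 0 \<le> \<delta> \<and> \<delta> \<le> 1 \<and> time_test T a a' \<and> stest L1 L2 f f' \<longrightarrow>
       (\<forall>t\<in>{0<..<T}. \<forall>x.
         (\<forall>s\<in>{0<..<T}. \<forall>y. u s y - (a s + f y) - \<delta> * h0 (norm y) \<le> u t x - (a t + f x) - \<delta> * h0 (norm x)) \<longrightarrow>
         - \<eta> \<le> a' t - x \<bullet> adj_op D A (f' x) + F x \<bullet> (f' x + rad \<delta> x) + HG x (f' x + rad \<delta> x)))"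

definition approx_super :: "real \<Rightarrow> real \<Rightarrow> real \<Rightarrow> real \<Rightarrow> (real \<Rightarrow> 'a \<Rightarrow> real) \<Rightarrow> bool" where
  "approx_super T \<eta> L1 L2 w \<longleftrightarrow> B_lsc_on B ({0<..<T} \<times> UNIV) w \<and>
     (\<forall>a a' f f' \<delta>. 0 \<le> \<delta> \<and> \<delta> \<le> 1 \<and> time_test T a a' \<and> stest L1 L2 f f' \<longrightarrow>
       (\<forall>t\<in>{0<..<T}. \<forall>x.
         (\<forall>s\<in>{0<..<T}. \<forall>y. w t x + (a t + f x) + \<delta> * h0 (norm x) \<le> w s y + (a s + f y) + \<delta> * h0 (norm y)) \<longrightarrow>
         - a' t + x \<bullet> adj_op D A (f' x) - F x \<bullet> (f' x + rad \<delta> x) + HG x (- (f' x + rad \<delta> x)) \<le> \<eta>))"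

lemma test_sum_bounds:
  fixes c :: real
  assumes f: "stest L1 L2 f f'" and \<delta>: "0 \<le> \<delta>" "\<delta> \<le> 1"
  defines "\<psi> \<equiv> \<lambda>y. c + f y + \<delta> * h0 (norm y)"
  shows "\<bar>\<psi> (x + y) - \<psi> x\<bar> \<le> (L1 + 1) * norm y"
    and "\<bar>\<psi> (x + y) - \<psi> x - (f' x + rad \<delta> x) \<bullet> y\<bar> \<le> (L2 + 1) * (norm y)\<^sup>2"
    and "norm (f' x + rad \<delta> x) \<le> L1 + 1"
    and "continuous_on UNIV \<psi>" and "GDERIV \<psi> x :> f' x + rad \<delta> x" and "0 \<le> L1"
proof -
  have 1: "\<bar>\<delta> * (h0 (norm (x + y)) - h0 (norm x))\<bar> \<le> 1 * norm y" for x y :: 'a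
    unfolding abs_mult using \<delta> h0_norm_lip[of x y] by (intro mult_mono) auto
  have 2: "\<bar>\<delta> * (h0 (norm (x + y)) - h0 (norm x) - ((1 / (1 + (norm x)\<^sup>2)) *\<^sub>R x) \<bullet> y)\<bar> \<le> 1 * (norm y)\<^sup>2" for x y :: 'a
    unfolding abs_mult using \<delta> h0_norm_remainder[of x y] by (intro mult_mono) auto
  show lip: "\<bar>\<psi> (x + y) - \<psi> x\<bar> \<le> (L1 + 1) * norm y" for x y
    using 1[of x y] stestD(1)[OF f, of x y] by (simp add: \<psi>_def algebra_simps)
  show rem: "\<bar>\<psi> (x + y) - \<psi> x - (f' x + rad \<delta> x) \<bullet> y\<bar> \<le> (L2 + 1) * (norm y)\<^sup>2" for x y
    using 2[of x y] stestD(2)[OF f, of x y] by (simp add: \<psi>_def rad_def inner_add_left algebra_simps)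
  show "norm (f' x + rad \<delta> x) \<le> L1 + 1"
    using norm_triangle_ineq[of "f' x" "rad \<delta> x"] stestD(3)[OF f, of x] rad_norm_le[OF \<delta>(1), of x] \<delta>(2) by linarith
  have "uniformly_continuous_on UNIV \<psi>"
    by (rule lipschitz_imp_uniformly_continuous[where K="L1 + 1"])
       (use lip[of y "x - y" for x y] in \<open>simp add: dist_norm\<close>)
  then show "continuous_on UNIV \<psi>" by (rule uniformly_continuous_imp_continuous)
  show "GDERIV \<psi> x :> f' x + rad \<delta> x" by (rule GDERIV_quadraticI[OF rem])
  show "0 \<le> L1" using stestD(3)[OF f, of x] norm_ge_zero order.trans by blast
qed

text \<open>The test classes and the nonlinearity stay abstract so that both equations share the
  computation; what is left to check is a one-sided bound on \<open>\<F>\<close> along the functions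
  that are tested.\<close>

lemma approx_subI:
  assumes sub: "viscosity_subsolution T D A B \<Phi> \<H> \<F> u"
    and \<Phi>: "\<And>\<phi>. test_fun2 T D A B \<phi> \<Longrightarrow> \<Phi> \<phi>" and \<H>: "\<And>h. radial_fun2 h \<Longrightarrow> \<H> h"
    and \<F>: "\<And>t x f f' c \<delta>. stest L1 L2 f f' \<Longrightarrow> 0 \<le> \<delta> \<Longrightarrow> \<delta> \<le> 1 \<Longrightarrow>
      \<F> t x (f' x + rad \<delta> x) (\<lambda>y. c + f y + \<delta> * h0 (norm y))
        \<le> F x \<bullet> (f' x + rad \<delta> x) + HG x (f' x + rad \<delta> x) + \<eta>"
  shows "approx_sub T \<eta> L1 L2 u"
  unfolding approx_sub_def
proof (intro conjI allI impI ballI)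
  show "B_usc_on B ({0<..<T} \<times> UNIV) u" using sub by (simp add: viscosity_subsolution_def)
next
  fix a a' f f' \<delta> t x
  assume asm: "0 \<le> \<delta> \<and> \<delta> \<le> 1 \<and> time_test T a a' \<and> stest L1 L2 f f'" and t: "t \<in> {0<..<T}"
    and max: "\<forall>s\<in>{0<..<T}. \<forall>y. u s y - (a s + f y) - \<delta> * h0 (norm y) \<le> u t x - (a t + f x) - \<delta> * h0 (norm x)"
  then have \<delta>: "0 \<le> \<delta>" "\<delta> \<le> 1" and a: "time_test T a a'" and f: "stest L1 L2 f f'" by auto
  define \<psi> where "\<psi> s y = a s + f y + \<delta> * h0 (norm y)" for s y
  have "deriv (\<lambda>s. \<psi> s x) t - x \<bullet> adj_op D A (gradient (\<lambda>y. a t + f y) x) + \<F> t x (gradient (\<psi> t) x) (\<psi> t) \<ge> 0"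
    using sub max t \<Phi>[OF test_fun2_separated[OF a f]] \<H>[OF radial_fun2_h0[OF \<delta>(1)]]
    unfolding viscosity_subsolution_def Let_def \<psi>_def[abs_def] by blast
  moreover have "deriv (\<lambda>s. \<psi> s x) t = a' t"
  proof (rule DERIV_imp_deriv)
    have "((\<lambda>s. a s + (f x + \<delta> * h0 (norm x))) has_real_derivative a' t + 0) (at t)"
      using a t by (intro DERIV_add DERIV_const) (simp add: time_test_def)
    then show "((\<lambda>s. \<psi> s x) has_real_derivative a' t) (at t)" by (simp add: \<psi>_def add.assoc)
  qed
  moreover have "gradient (\<lambda>y. a t + f y) x = f' x"
    using GDERIV_add[OF GDERIV_const stest_GDERIV[OF f], of "a t" x] by (intro gradient_eq) simp
  moreover have "gradient (\<psi> t) x = f' x + rad \<delta> x"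
    unfolding \<psi>_def[abs_def] by (rule gradient_eq[OF test_sum_bounds(5)[OF f \<delta>]])
  moreover have "\<F> t x (f' x + rad \<delta> x) (\<psi> t) \<le> F x \<bullet> (f' x + rad \<delta> x) + HG x (f' x + rad \<delta> x) + \<eta>"
    unfolding \<psi>_def[abs_def] by (rule \<F>[OF f \<delta>])
  ultimately show "- \<eta> \<le> a' t - x \<bullet> adj_op D A (f' x) + F x \<bullet> (f' x + rad \<delta> x) + HG x (f' x + rad \<delta> x)"
    by simp
qed

lemma approx_superI:
  assumes super: "viscosity_supersolution T D A B \<Phi> \<H> \<F> w"
    and \<Phi>: "\<And>\<phi>. test_fun2 T D A B \<phi> \<Longrightarrow> \<Phi> \<phi>" and \<H>: "\<And>h. radial_fun2 h \<Longrightarrow> \<H> h"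
    and \<F>: "\<And>t x f f' c \<delta>. stest L1 L2 f f' \<Longrightarrow> 0 \<le> \<delta> \<Longrightarrow> \<delta> \<le> 1 \<Longrightarrow>
      F x \<bullet> (- (f' x + rad \<delta> x)) + HG x (- (f' x + rad \<delta> x)) - \<eta>
        \<le> \<F> t x (- (f' x + rad \<delta> x)) (\<lambda>y. - (c + f y + \<delta> * h0 (norm y)))"
  shows "approx_super T \<eta> L1 L2 w"
  unfolding approx_super_def
proof (intro conjI allI impI ballI)
  show "B_lsc_on B ({0<..<T} \<times> UNIV) w" using super by (simp add: viscosity_supersolution_def)
next
  fix a a' f f' \<delta> t x
  assume asm: "0 \<le> \<delta> \<and> \<delta> \<le> 1 \<and> time_test T a a' \<and> stest L1 L2 f f'" and t: "t \<in> {0<..<T}"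
    and min: "\<forall>s\<in>{0<..<T}. \<forall>y. w t x + (a t + f x) + \<delta> * h0 (norm x) \<le> w s y + (a s + f y) + \<delta> * h0 (norm y)"
  then have \<delta>: "0 \<le> \<delta>" "\<delta> \<le> 1" and a: "time_test T a a'" and f: "stest L1 L2 f f'" by auto
  define \<psi> where "\<psi> s y = - (a s + f y) - \<delta> * h0 (norm y)" for s y
  have "deriv (\<lambda>s. \<psi> s x) t + x \<bullet> adj_op D A (gradient (\<lambda>y. a t + f y) x) + \<F> t x (gradient (\<psi> t) x) (\<psi> t) \<le> 0"
    using super min t \<Phi>[OF test_fun2_separated[OF a f]] \<H>[OF radial_fun2_h0[OF \<delta>(1)]]
    unfolding viscosity_supersolution_def Let_def \<psi>_def[abs_def] by blast
  moreover have "deriv (\<lambda>s. \<psi> s x) t = - a' t"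
  proof (rule DERIV_imp_deriv)
    have "((\<lambda>s. - a s + (- f x - \<delta> * h0 (norm x))) has_real_derivative - a' t + 0) (at t)"
      using a t by (intro DERIV_add DERIV_const DERIV_minus) (simp add: time_test_def)
    then show "((\<lambda>s. \<psi> s x) has_real_derivative - a' t) (at t)" by (simp add: \<psi>_def algebra_simps)
  qed
  moreover have "gradient (\<lambda>y. a t + f y) x = f' x"
    using GDERIV_add[OF GDERIV_const stest_GDERIV[OF f], of "a t" x] by (intro gradient_eq) simp
  moreover have \<psi>: "\<psi> t = (\<lambda>y. - (a t + f y + \<delta> * h0 (norm y)))" by (rule ext) (simp add: \<psi>_def)
  moreover have "gradient (\<psi> t) x = - (f' x + rad \<delta> x)"
    unfolding \<psi> by (rule gradient_eq[OF GDERIV_minus[OF test_sum_bounds(5)[OF f \<delta>]]])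
  moreover have "F x \<bullet> (- (f' x + rad \<delta> x)) + HG x (- (f' x + rad \<delta> x)) - \<eta> \<le> \<F> t x (- (f' x + rad \<delta> x)) (\<psi> t)"
    unfolding \<psi> by (rule \<F>[OF f \<delta>])
  ultimately show "- a' t + x \<bullet> adj_op D A (f' x) - F x \<bullet> (f' x + rad \<delta> x) + HG x (- (f' x + rad \<delta> x)) \<le> \<eta>"
    by (simp only: inner_minus_right)
qed

lemma approx_first:
  assumes "viscosity_solution_first T D A B F G \<nu> v" "0 \<le> \<eta>"
  shows "approx_sub T \<eta> L1 L2 v" "approx_super T \<eta> L1 L2 v"
proof -
  have sub: "viscosity_subsolution T D A B (test_fun1 T D A B) radial_fun1 (nonlin_first F G \<nu>) v"
    and super: "viscosity_supersolution T D A B (test_fun1 T D A B) radial_fun1 (nonlin_first F G \<nu>) v"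
    using assms(1) by (auto simp: viscosity_solution_first_def)
  show "approx_sub T \<eta> L1 L2 v"
    by (rule approx_subI[OF sub test_fun2_imp_test_fun1 radial_fun2_imp_radial_fun1])
       (use assms(2) in \<open>simp_all add: nonlin_first_def levy_H0_eq\<close>)
  show "approx_super T \<eta> L1 L2 v"
    by (rule approx_superI[OF super test_fun2_imp_test_fun1 radial_fun2_imp_radial_fun1])
       (use assms(2) in \<open>simp_all add: nonlin_first_def levy_H0_eq\<close>)
qed

lemma approx_jump:
  assumes v: "viscosity_solution_jump T D A B F G \<nu> n v" and n: "1 \<le> n" and L2: "0 \<le> L2"
    and \<eta>: "(L2 + 1) * M\<^sup>2 / real n * Iw ((L1 + 1) * M + 1) \<le> \<eta>"
  shows "approx_sub T \<eta> L1 L2 v" "approx_super T \<eta> L1 L2 v"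
proof -
  have sub: "viscosity_subsolution T D A B (test_fun2 T D A B) radial_fun2 (nonlin_jump F G \<nu> n) v"
    and super: "viscosity_supersolution T D A B (test_fun2 T D A B) radial_fun2 (nonlin_jump F G \<nu> n) v"
    using v by (auto simp: viscosity_solution_jump_def)
  show "approx_sub T \<eta> L1 L2 v"
  proof (rule approx_subI[OF sub])
    fix t x f f' and c \<delta> :: real assume f: "stest L1 L2 f f'" and \<delta>: "0 \<le> \<delta>" "\<delta> \<le> 1"
    note b = test_sum_bounds(1,2)[OF f \<delta>, where c=c] test_sum_bounds(3)[OF f \<delta>]
      test_sum_bounds(4,5)[OF f \<delta>, where c=c] test_sum_bounds(6)[OF f \<delta>]
    have "\<bar>nonlin_jump F G \<nu> n t x (f' x + rad \<delta> x) (\<lambda>y. c + f y + \<delta> * h0 (norm y))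
        - (F x \<bullet> (f' x + rad \<delta> x) + HG x (f' x + rad \<delta> x))\<bar> \<le> (L2 + 1) * M\<^sup>2 / real n * Iw ((L1 + 1) * M + 1)"
      by (rule jump_HG_diff[OF n b(1) _ b(2) _ b(3,4)]) (use b(6) L2 in auto)
    then show "nonlin_jump F G \<nu> n t x (f' x + rad \<delta> x) (\<lambda>y. c + f y + \<delta> * h0 (norm y))
        \<le> F x \<bullet> (f' x + rad \<delta> x) + HG x (f' x + rad \<delta> x) + \<eta>" using \<eta> by linarith
  qed auto
  show "approx_super T \<eta> L1 L2 v"
  proof (rule approx_superI[OF super])
    fix t x f f' and c \<delta> :: real assume f: "stest L1 L2 f f'" and \<delta>: "0 \<le> \<delta>" "\<delta> \<le> 1"
    note b = test_sum_bounds(1,2)[OF f \<delta>, where c=c] test_sum_bounds(3)[OF f \<delta>]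
      test_sum_bounds(4,5)[OF f \<delta>, where c=c] test_sum_bounds(6)[OF f \<delta>]
    have "\<bar>nonlin_jump F G \<nu> n t x (- (f' x + rad \<delta> x)) (\<lambda>y. - (c + f y + \<delta> * h0 (norm y)))
        - (F x \<bullet> (- (f' x + rad \<delta> x)) + HG x (- (f' x + rad \<delta> x)))\<bar>
        \<le> (L2 + 1) * M\<^sup>2 / real n * Iw ((L1 + 1) * M + 1)"
    proof (rule jump_HG_diff[OF n])
      fix y
      show "\<bar>- (c + f (x + y) + \<delta> * h0 (norm (x + y))) - - (c + f x + \<delta> * h0 (norm x))\<bar> \<le> (L1 + 1) * norm y"
        using b(1)[of x y] unfolding minus_diff_minus abs_minus_cancel .
      show "\<bar>- (c + f (x + y) + \<delta> * h0 (norm (x + y))) - - (c + f x + \<delta> * h0 (norm x)) - - (f' x + rad \<delta> x) \<bullet> y\<bar>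
          \<le> (L2 + 1) * (norm y)\<^sup>2"
        using b(2)[of x y] unfolding inner_minus_left minus_diff_minus abs_minus_cancel .
      show "norm (- (f' x + rad \<delta> x)) \<le> L1 + 1" using b(3) by (simp only: norm_minus_cancel)
      show "continuous_on UNIV (\<lambda>y. - (c + f y + \<delta> * h0 (norm y)))" by (intro continuous_on_minus b(4))
    qed (use b(6) L2 in auto)
    then show "F x \<bullet> (- (f' x + rad \<delta> x)) + HG x (- (f' x + rad \<delta> x)) - \<eta>
        \<le> nonlin_jump F G \<nu> n t x (- (f' x + rad \<delta> x)) (\<lambda>y. - (c + f y + \<delta> * h0 (norm y)))" using \<eta> by linarith
  qed auto
qed

end

section \<open>A variational principle\<close>

lemma geometric_Cauchy:
  fixes X :: "nat \<Rightarrow> 'e::{real_normed_vector,complete_space}"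
  assumes "\<And>k. norm (X (Suc k) - X k) \<le> K / 2 ^ k"
  obtains l where "X \<longlonglongrightarrow> l" "norm (l - X 0) \<le> 2 * K"
proof -
  have K: "0 \<le> K" using order.trans[OF norm_ge_zero assms[of 0]] by simp
  have *: "norm (X n - X m) \<le> 2 * K / 2 ^ m - 2 * K / 2 ^ n" if "m \<le> n" for m n
    using that
  proof (induction n rule: dec_induct)
    case (step n)
    have "norm (X (Suc n) - X m) \<le> norm (X (Suc n) - X n) + norm (X n - X m)"
      using norm_triangle_ineq[of "X (Suc n) - X n" "X n - X m"] by simp
    moreover have "K / 2 ^ n = 2 * K / 2 ^ n - 2 * K / 2 ^ Suc n" by simp
    ultimately show ?case using assms[of n] step.IH by linarith
  qed simp
  have le: "norm (X n - X m) \<le> 2 * K / 2 ^ m" if "m \<le> n" for m n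
  proof -
    have "0 \<le> 2 * K / 2 ^ n" using K by simp
    then show ?thesis using *[OF that] by linarith
  qed
  have "Cauchy X"
  proof (rule metric_CauchyI)
    fix e :: real assume e: "0 < e"
    have "(\<lambda>m. 2 * K / 2 ^ m) \<longlonglongrightarrow> 0"
      using LIMSEQ_divide_realpow_zero[of 2 "2 * K"] by simp
    then have "\<forall>\<^sub>F m in sequentially. 2 * K / 2 ^ m < e" using e by (rule order_tendstoD(2))
    then obtain N where N: "\<And>m. m \<ge> N \<Longrightarrow> 2 * K / 2 ^ m < e" by (auto simp: eventually_sequentially)
    show "\<exists>M. \<forall>m\<ge>M. \<forall>n\<ge>M. dist (X m) (X n) < e"
    proof (intro exI[of _ N] allI impI)
      fix m n assume "N \<le> m" "N \<le> n"
      then show "dist (X m) (X n) < e"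
        using le[of m n] le[of n m] N[of m] N[of n]
        by (cases "m \<le> n") (auto simp: dist_norm norm_minus_commute)
    qed
  qed
  then obtain l where l: "X \<longlonglongrightarrow> l" using Cauchy_convergent convergent_def by blast
  have "norm (l - X 0) \<le> 2 * K"
    by (rule LIMSEQ_le_const2[OF tendsto_norm[OF tendsto_diff[OF l tendsto_const]]]) (use le[of 0] in auto)
  with l show ?thesis by (rule that)
qed

text \<open>The perturbations \<open>\<Sum>\<^sub>i w\<^sub>i \<parallel>N z - N z\<^sub>i\<parallel>\<^sup>2\<close> of Borwein and Preiss are, up to a constant, the quadratic
  \<open>W \<parallel>N z\<parallel>\<^sup>2 - 2 \<langle>V, N z\<rangle>\<close>, so that only the vectors \<open>V = \<Sum>\<^sub>i w\<^sub>i N z\<^sub>i\<close> have to be tracked.\<close>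

lemma quadratic_variational_principle:
  fixes N :: "'z \<Rightarrow> 'e::{real_inner,complete_space}" and \<Psi> :: "'z \<Rightarrow> real"
  assumes z0: "z0 \<in> S" and bdN: "\<And>z. z \<in> S \<Longrightarrow> norm (N z) \<le> R" and ub: "\<And>z. z \<in> S \<Longrightarrow> \<Psi> z \<le> U"
    and usc: "\<And>Z e. (\<And>k. Z k \<in> S) \<Longrightarrow> (\<lambda>k. N (Z k)) \<longlonglongrightarrow> e \<Longrightarrow>
      \<exists>z\<in>S. N z = e \<and> (\<forall>\<epsilon>>0. \<forall>\<^sub>F k in sequentially. \<Psi> (Z k) \<le> \<Psi> z + \<epsilon>)"
    and \<sigma>: "0 < \<sigma>"
  shows "\<exists>P z. z \<in> S \<and> norm P \<le> \<sigma> \<and>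
    (\<forall>y\<in>S. \<Psi> y - P \<bullet> (N y - N z) - \<sigma> * (norm (N y - N z))\<^sup>2 \<le> \<Psi> z)"
proof -
  have R: "0 \<le> R" using bdN[OF z0] norm_ge_zero order.trans by blast
  \<comment> \<open>The weights below sum to \<open>2 * c\<close>, which must not exceed
    \<open>\<sigma>\<close>, and the linear part will satisfy \<open>norm P \<le> 8 * c * R\<close>;
    this \<open>c\<close> serves both.\<close>
  define c where "c = \<sigma> / (8 * (R + 1))"
  have c: "0 < c" "2 * c \<le> \<sigma>" "8 * c * R \<le> \<sigma>"
    using \<sigma> R by (auto simp: c_def field_simps)
  \<comment> \<open>\<open>W k\<close> is the sum of the first \<open>k\<close> weights. The
    tolerances satisfy \<open>2 * \<epsilon> k = w k / 4 ^ k\<close>, which yields consecutive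
    distances of at most \<open>1 / 2 ^ k\<close>.\<close>
  define w where "w k = c / 2 ^ k" for k :: nat
  define W where "W k = 2 * c - 2 * c / 2 ^ k" for k :: nat
  define \<epsilon> where "\<epsilon> k = (c / 2) / 8 ^ k" for k :: nat
  have w: "0 < w k" and \<epsilon>: "0 < \<epsilon> k" and W: "W (Suc k) = W k + w k" "0 \<le> W k" for k
    using c by (auto simp: w_def \<epsilon>_def W_def field_simps)
  define g where "g k V y = \<Psi> y - W k * (norm (N y))\<^sup>2 + 2 * (V \<bullet> N y)" for k V y
  define sel where "sel k V = (SOME z. z \<in> S \<and> (\<forall>y\<in>S. g k V y \<le> g k V z + \<epsilon> k))" for k V
  have sel: "sel k V \<in> S" "y \<in> S \<Longrightarrow> g k V y \<le> g k V (sel k V) + \<epsilon> k" for k V y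
  proof -
    have "g k V y \<le> U + 2 * (norm V * R)" if "y \<in> S" for y
    proof -
      have "V \<bullet> N y \<le> norm V * norm (N y)" by (rule norm_cauchy_schwarz)
      also have "\<dots> \<le> norm V * R" using bdN[OF that] by (intro mult_left_mono) auto
      finally have "V \<bullet> N y \<le> norm V * R" .
      moreover have "0 \<le> W k * (norm (N y))\<^sup>2" using W(2)[of k] by simp
      ultimately show ?thesis unfolding g_def using ub[OF that] by linarith
    qed
    then have bdd: "bdd_above (g k V ` S)" by (rule bdd_aboveI2)
    have "Sup (g k V ` S) - \<epsilon> k < Sup (g k V ` S)" using \<epsilon>[of k] by simp
    then obtain z where z: "z \<in> S" "Sup (g k V ` S) - \<epsilon> k < g k V z"
      using less_cSup_iff[OF _ bdd] z0 by blast
    have "\<forall>y\<in>S. g k V y \<le> g k V z + \<epsilon> k"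
    proof
      fix y assume "y \<in> S"
      then have "g k V y \<le> Sup (g k V ` S)" using bdd by (intro cSup_upper) auto
      then show "g k V y \<le> g k V z + \<epsilon> k" using z(2) by linarith
    qed
    then have "\<exists>z. z \<in> S \<and> (\<forall>y\<in>S. g k V y \<le> g k V z + \<epsilon> k)" using z(1) by blast
    from someI_ex[OF this] show "sel k V \<in> S" "y \<in> S \<Longrightarrow> g k V y \<le> g k V (sel k V) + \<epsilon> k"
      unfolding sel_def[symmetric] by auto
  qed
  define V where "V = rec_nat 0 (\<lambda>k v. v + w k *\<^sub>R N (sel k v))"
  define z where "z k = sel k (V k)" for k
  have V: "V 0 = 0" "V (Suc k) = V k + w k *\<^sub>R N (z k)" for k by (auto simp: V_def z_def)
  have zS: "z k \<in> S" and z_max: "y \<in> S \<Longrightarrow> g k (V k) y \<le> g k (V k) (z k) + \<epsilon> k" for k y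
    unfolding z_def by (rule sel, rule sel(2))
  \<comment> \<open>Up to a constant, passing to the next functional subtracts the Borwein-Preiss
    term centred at \<open>z k\<close>.\<close>
  have g_Suc: "g (Suc k) (V (Suc k)) y = g k (V k) y - w k * (norm (N y - N (z k)))\<^sup>2 + w k * (norm (N (z k)))\<^sup>2" for k y
    unfolding g_def W V by (simp add: power2_norm_eq_inner inner_simps inner_commute algebra_simps)
  have step: "norm (N (z (Suc k)) - N (z k)) \<le> 1 / 2 ^ k" for k
  proof (rule power2_le_imp_le)
    have "g (Suc k) (V (Suc k)) (z k) \<le> g (Suc k) (V (Suc k)) (z (Suc k)) + \<epsilon> (Suc k)"
      by (rule z_max[OF zS])
    moreover have "g k (V k) (z (Suc k)) \<le> g k (V k) (z k) + \<epsilon> k" by (rule z_max[OF zS])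
    ultimately have "w k * (norm (N (z (Suc k)) - N (z k)))\<^sup>2 \<le> \<epsilon> k + \<epsilon> (Suc k)"
      unfolding g_Suc by simp
    also have "\<dots> \<le> 2 * \<epsilon> k" using c by (simp add: \<epsilon>_def field_simps)
    also have "\<dots> = w k * (1 / 2 ^ k)\<^sup>2"
    proof -
      have "(8::real) ^ k = 2 ^ k * (2 ^ k * 2 ^ k)" by (simp flip: power_mult_distrib)
      then show ?thesis by (simp add: \<epsilon>_def w_def power2_eq_square)
    qed
    finally show "(norm (N (z (Suc k)) - N (z k)))\<^sup>2 \<le> (1 / 2 ^ k)\<^sup>2" using w[of k] by simp
  qed simp
  obtain e where e: "(\<lambda>k. N (z k)) \<longlonglongrightarrow> e" using geometric_Cauchy[OF step] by blast
  have "norm (V (Suc k) - V k) \<le> (c * R) / 2 ^ k" for k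
  proof -
    have "norm (V (Suc k) - V k) = w k * norm (N (z k))" using w[of k] by (simp add: V)
    also have "\<dots> \<le> w k * R" using bdN[OF zS[of k]] w[of k] by (intro mult_left_mono) auto
    finally show ?thesis by (simp add: w_def)
  qed
  then obtain Vl where Vl: "V \<longlonglongrightarrow> Vl" "norm (Vl - V 0) \<le> 2 * (c * R)"
    using geometric_Cauchy by blast
  \<comment> \<open>Completeness is used in the target space of \<open>N\<close>; the semicontinuity
    hypothesis turns the limit \<open>e\<close> back into a point of \<open>S\<close>.\<close>
  obtain zh where zh: "zh \<in> S" "N zh = e" and usc_z: "\<And>\<epsilon>. \<epsilon> > 0 \<Longrightarrow> \<forall>\<^sub>F k in sequentially. \<Psi> (z k) \<le> \<Psi> zh + \<epsilon>"
    using usc[OF zS e] by blast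
  have W_lim: "W \<longlonglongrightarrow> 2 * c"
  proof -
    have "(\<lambda>k. 2 * c - 2 * c / 2 ^ k) \<longlonglongrightarrow> 2 * c - 0"
      by (intro tendsto_diff tendsto_const LIMSEQ_divide_realpow_zero) auto
    then show ?thesis unfolding W_def by simp
  qed
  have \<epsilon>_lim: "\<epsilon> \<longlonglongrightarrow> 0" unfolding \<epsilon>_def by (intro LIMSEQ_divide_realpow_zero) auto
  define H where "H y = - (2 * c) * (norm (N y))\<^sup>2 + 2 * (Vl \<bullet> N y)" for y
  have max: "\<Psi> y + H y \<le> \<Psi> zh + H zh" if y: "y \<in> S" for y
  proof (rule field_le_epsilon)
    fix d :: real assume d: "0 < d"
    have "(\<lambda>k. g k (V k) y) \<longlonglongrightarrow> \<Psi> y - (2 * c) * (norm (N y))\<^sup>2 + 2 * (Vl \<bullet> N y)"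
      unfolding g_def by (intro tendsto_intros W_lim Vl)
    moreover have "(\<lambda>k. (\<Psi> zh + d) - W k * (norm (N (z k)))\<^sup>2 + 2 * (V k \<bullet> N (z k)) + \<epsilon> k)
        \<longlonglongrightarrow> (\<Psi> zh + d) - (2 * c) * (norm e)\<^sup>2 + 2 * (Vl \<bullet> e) + 0"
      by (intro tendsto_intros W_lim Vl e \<epsilon>_lim)
    moreover have "\<forall>\<^sub>F k in sequentially. g k (V k) y \<le> (\<Psi> zh + d) - W k * (norm (N (z k)))\<^sup>2 + 2 * (V k \<bullet> N (z k)) + \<epsilon> k"
      using usc_z[OF d]
    proof eventually_elim
      case (elim k)
      then show ?case using z_max[OF y, of k] by (simp add: g_def)
    qed
    ultimately have "\<Psi> y - (2 * c) * (norm (N y))\<^sup>2 + 2 * (Vl \<bullet> N y) \<le> (\<Psi> zh + d) - (2 * c) * (norm e)\<^sup>2 + 2 * (Vl \<bullet> e) + 0"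
      by (intro tendsto_le[OF trivial_limit_sequentially]) auto
    then show "\<Psi> y + H y \<le> \<Psi> zh + H zh + d" by (simp add: H_def zh(2))
  qed
  \<comment> \<open>The gradient of \<open>- H\<close> at \<open>zh\<close> in the variable
    \<open>N y\<close>: \<open>H zh - H y\<close> is exactly this linear part plus
    \<open>2 * c\<close> times the squared distance.\<close>
  define P where "P = (4 * c) *\<^sub>R e - 2 *\<^sub>R Vl"
  have "norm P \<le> \<sigma>"
  proof -
    have "norm P \<le> 4 * c * norm e + 2 * norm Vl"
      using norm_triangle_ineq4[of "(4 * c) *\<^sub>R e" "2 *\<^sub>R Vl"] c by (simp add: P_def)
    also have "\<dots> \<le> 4 * c * R + 2 * (2 * (c * R))"
      using bdN[OF zh(1)] Vl(2) c by (intro add_mono mult_left_mono) (auto simp: zh(2) V)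
    also have "\<dots> \<le> \<sigma>" using c(3) by (simp add: algebra_simps)
    finally show ?thesis .
  qed
  moreover have "\<Psi> y - P \<bullet> (N y - N zh) - \<sigma> * (norm (N y - N zh))\<^sup>2 \<le> \<Psi> zh" if y: "y \<in> S" for y
  proof -
    have "P \<bullet> (N y - N zh) + (2 * c) * (norm (N y - N zh))\<^sup>2 = H zh - H y"
      unfolding H_def P_def zh(2) by (simp add: power2_norm_eq_inner inner_simps inner_commute algebra_simps)
    moreover have "(2 * c) * (norm (N y - N zh))\<^sup>2 \<le> \<sigma> * (norm (N y - N zh))\<^sup>2"
      using c by (intro mult_right_mono) auto
    ultimately show ?thesis using max[OF y] by linarith
  qed
  ultimately show ?thesis using zh(1) by blast
qed

section \<open>Admissible perturbations\<close>

context setting begin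

lemma stest_const: "stest 0 0 (\<lambda>x. k) (\<lambda>x. 0)"
  unfolding stest_def
proof (intro conjI allI impI)
  show "\<exists>D2. (\<forall>x. ((\<lambda>x. 0) has_derivative blinfun_apply (D2 x)) (at x)) \<and> uniformly_continuous_on UNIV D2"
    by (intro exI[of _ "\<lambda>x. 0"]) (auto simp: zero_blinfun.rep_eq uniformly_continuous_on_const)
  show "0 \<in> adj_dom D A" using adj_B_scaleR(1)[of 0 0] by simp
  show "\<exists>K. \<forall>x. \<bar>k\<bar> \<le> K * (1 + norm (B x))"
  proof (intro exI[of _ "\<bar>k\<bar>"] allI)
    fix x
    show "\<bar>k\<bar> \<le> \<bar>k\<bar> * (1 + norm (B x))" by (simp add: distrib_left)
  qed
qed (auto simp: uniformly_continuous_on_const)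

text \<open>Outside the ball of radius \<open>R\<close> only the lower bound on \<open>f\<close> is
  asked: there, subtracting \<open>f\<close> can raise a functional by at most
  \<open>\<sigma>\<close>.\<close>

definition pert_ok :: "real \<Rightarrow> real \<Rightarrow> real \<Rightarrow> (real \<Rightarrow> real) \<Rightarrow> (real \<Rightarrow> real) \<Rightarrow> ('a \<Rightarrow> real) \<Rightarrow> ('a \<Rightarrow> 'a) \<Rightarrow> bool" where
  "pert_ok \<sigma> T R a a' f f' \<longleftrightarrow> time_test T a a' \<and> (\<forall>t\<in>{0<..<T}. \<bar>a t\<bar> \<le> \<sigma> \<and> \<bar>a' t\<bar> \<le> \<sigma>) \<and>
     stest \<sigma> \<sigma> f f' \<and> (\<forall>x. norm (adj_op D A (f' x)) \<le> \<sigma>) \<and> (\<forall>x. - \<sigma> \<le> f x) \<and> (\<forall>x. norm x \<le> R \<longrightarrow> f x \<le> \<sigma>)"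

text \<open>The linear and quadratic perturbations of the variational principle are not uniformly continuous or not
  bounded below. They are dominated by a sine and a smoothed norm that touch them at the maximum point.\<close>

lemma pert_bounds:
  fixes T R :: real
  assumes T: "0 < T" and R: "0 \<le> R"
  shows "\<exists>Q\<ge>1. \<forall>s p c p1 t0. 0 < s \<longrightarrow> norm p \<le> s \<longrightarrow> norm c \<le> R \<longrightarrow> \<bar>p1\<bar> \<le> s \<longrightarrow> t0 \<in> {0<..<T} \<longrightarrow>
    (\<exists>a a' f f'. pert_ok (Q * s) T R a a' f f' \<and> a t0 = 0 \<and> f c = 0 \<and>
      (\<forall>t. p1 * (t - t0) + 2 * s * (t - t0)\<^sup>2 \<le> a t) \<and>
      (\<forall>x. norm x \<le> R \<longrightarrow> p \<bullet> B (x - c) + 2 * s * (norm (B (x - c)))\<^sup>2 \<le> f x))"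
proof -
  define \<rho> where "\<rho> = 2 * \<beta> * R"
  \<comment> \<open>Since \<open>r\<^sup>2 = (sqrt (1 + r\<^sup>2) - 1) * (sqrt (1 + r\<^sup>2) +
    1)\<close>, this factor makes \<open>\<kappa> * (sqrt (1 + r\<^sup>2) - 1)\<close> at least
    \<open>3 * r\<^sup>2\<close> for \<open>r \<le> \<rho>\<close>: 2 for the quadratic term and 1
    for the defect of the sine.\<close>
  define \<kappa> where "\<kappa> = 3 * (2 + \<rho>)"
  have \<rho>: "0 \<le> \<rho>" "0 \<le> \<kappa>" using R \<beta>_pos by (auto simp: \<rho>_def \<kappa>_def)
  define Q where "Q = 1 + T + 2 * T\<^sup>2 + 4 * T + (1 + \<kappa>) * (1 + \<beta> + \<beta>\<^sup>2 + KAB + \<rho>)"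
  have nn: "0 \<le> \<kappa> * \<beta>" "0 \<le> \<kappa> * \<beta>\<^sup>2" "0 \<le> \<kappa> * KAB" "0 \<le> \<kappa> * \<rho>" "0 \<le> \<beta>\<^sup>2" "0 \<le> T\<^sup>2" "0 < KAB"
    using \<rho> \<beta>_pos KAB(1) by auto
  have Q: "1 \<le> Q" "T + 2 * T\<^sup>2 \<le> Q" "1 + 4 * T \<le> Q" "\<beta> + \<kappa> * \<beta> \<le> Q" "\<beta>\<^sup>2 + \<kappa> * \<beta>\<^sup>2 \<le> Q"
    "KAB + \<kappa> * KAB \<le> Q" "1 + \<kappa> * \<rho> \<le> Q"
    using T \<rho> \<beta>_pos nn by (auto simp: Q_def algebra_simps)
  show ?thesis
  proof (rule exI[of _ Q], rule conjI, rule Q(1), intro allI impI)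
    fix s p1 t0 :: real and p c :: 'a
    assume s: "0 < s" and p: "norm p \<le> s" and cR: "norm c \<le> R" and p1: "\<bar>p1\<bar> \<le> s" and t0: "t0 \<in> {0<..<T}"
    have Qs: "s \<le> Q * s" "s * \<beta> + s * \<kappa> * \<beta> \<le> Q * s" "s * \<beta>\<^sup>2 + s * \<kappa> * \<beta>\<^sup>2 \<le> Q * s"
      "s * KAB + s * \<kappa> * KAB \<le> Q * s" "s + s * \<kappa> * \<rho> \<le> Q * s"
      using mult_right_mono[OF Q(1), of s] mult_right_mono[OF Q(4), of s] mult_right_mono[OF Q(5), of s]
        mult_right_mono[OF Q(6), of s] mult_right_mono[OF Q(7), of s] s by (simp_all add: algebra_simps)
    define a where "a t = p1 * (t - t0) + 2 * s * (t - t0)\<^sup>2" for t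
    define a' where "a' t = p1 + 4 * s * (t - t0)" for t
    \<comment> \<open>With amplitude \<open>s\<close> and direction \<open>q\<close> the sine has
      slope \<open>B p\<close> at \<open>c\<close>, and as \<open>norm q \<le> 1\<close>, its size
      and its derivatives are of order \<open>s\<close>.\<close>
    define q where "q = (1 / s) *\<^sub>R p"
    have q: "norm q \<le> 1" using p s by (simp add: q_def)
    define f where "f x = sin_fn s q c x + (root_fn id_blinfun (s * \<kappa>) c x + (- (s * \<kappa>)))" for x
    define f' where "f' x = sin_grad s q c x + (root_grad id_blinfun (s * \<kappa>) c x + 0)" for x
    have Bn: "norm (B x) \<le> \<beta> * norm x" for x
      using norm_blinfun[of B x] mult_right_mono[of "norm B" \<beta> "norm x"] by (simp add: \<beta>_def)
    have psd_id: "psd (id_blinfun :: 'a \<Rightarrow>\<^sub>L 'a)" by (simp add: psd_def self_adjoint_def)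
    have Bq: "norm (B q) \<le> \<beta>" using Bn[of q] mult_left_mono[OF q, of \<beta>] \<beta>_pos by linarith
    have Bxc: "norm (B (x - c)) \<le> \<rho>" if "norm x \<le> R" for x
    proof -
      have "norm (x - c) \<le> 2 * R" using norm_triangle_ineq4[of x c] that cR by linarith
      then have "\<beta> * norm (x - c) \<le> \<beta> * (2 * R)" using \<beta>_pos by (intro mult_left_mono) auto
      then show ?thesis using Bn[of "x - c"] by (simp add: \<rho>_def algebra_simps)
    qed
    have tt: "time_test T a a'"
      unfolding time_test_def a_def a'_def by (auto intro!: derivative_eq_intros continuous_intros)
    have at: "\<bar>a t\<bar> \<le> Q * s" "\<bar>a' t\<bar> \<le> Q * s" if "t \<in> {0<..<T}" for t
    proof -
      have d: "\<bar>t - t0\<bar> \<le> T" using that t0 by auto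
      have "\<bar>p1 * (t - t0)\<bar> \<le> s * T" unfolding abs_mult using d p1 s by (intro mult_mono) auto
      moreover have "\<bar>2 * s * (t - t0)\<^sup>2\<bar> \<le> 2 * s * T\<^sup>2"
        using d s power_mono[OF d, of 2] by (simp add: abs_mult)
      moreover have "\<bar>4 * s * (t - t0)\<bar> \<le> 4 * s * T" unfolding abs_mult using d s by (intro mult_mono) auto
      ultimately have "\<bar>a t\<bar> \<le> s * T + 2 * s * T\<^sup>2" "\<bar>a' t\<bar> \<le> s + 4 * s * T"
        using p1 unfolding a_def a'_def by linarith+
      then have "\<bar>a t\<bar> \<le> (T + 2 * T\<^sup>2) * s" "\<bar>a' t\<bar> \<le> (1 + 4 * T) * s"
        by (simp_all add: algebra_simps)
      then show "\<bar>a t\<bar> \<le> Q * s" "\<bar>a' t\<bar> \<le> Q * s"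
        using mult_right_mono[OF Q(2), of s] mult_right_mono[OF Q(3), of s] s by linarith+
    qed
    have st: "stest (Q * s) (Q * s) f f'"
    proof (rule stest_mono)
      have "stest (s * \<kappa> * \<beta>) (s * \<kappa> * \<beta>\<^sup>2) (root_fn id_blinfun (s * \<kappa>) c) (root_grad id_blinfun (s * \<kappa>) c)"
      proof (rule stest_root[OF psd_id])
        fix y
        show "id_blinfun (B y) \<bullet> B y \<le> \<beta>\<^sup>2 * (norm y)\<^sup>2"
          using power_mono[OF Bn[of y] norm_ge_zero, of 2] by (simp add: power2_norm_eq_inner[symmetric] power_mult_distrib)
      qed (use \<beta>_pos s \<rho> in auto)
      from stest_add[OF stest_sin[of s q c] stest_add[OF this stest_const[of "- (s * \<kappa>)"]]]
      show "stest (s * norm (B q) + (s * \<kappa> * \<beta> + 0)) (s * (norm (B q))\<^sup>2 + (s * \<kappa> * \<beta>\<^sup>2 + 0)) f f'"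
        using s by (simp add: f_def[abs_def] f'_def[abs_def])
      have "s * norm (B q) \<le> s * \<beta>" "s * (norm (B q))\<^sup>2 \<le> s * \<beta>\<^sup>2"
        using Bq s by (auto intro!: mult_left_mono power_mono)
      then show "s * norm (B q) + (s * \<kappa> * \<beta> + 0) \<le> Q * s" "s * (norm (B q))\<^sup>2 + (s * \<kappa> * \<beta>\<^sup>2 + 0) \<le> Q * s"
        using Qs(2,3) by linarith+
    qed
    have ad: "norm (adj_op D A (f' x)) \<le> Q * s" for x
    proof -
      have "adj_op D A (f' x) = adj_op D A (sin_grad s q c x) + adj_op D A (root_grad id_blinfun (s * \<kappa>) c x)"
        unfolding f'_def add_0_right by (rule adj_add) (auto simp: sin_grad_def root_grad_def adj_B_scaleR(1))
      then have "norm (adj_op D A (f' x)) \<le> norm (adj_op D A (sin_grad s q c x)) + norm (adj_op D A (root_grad id_blinfun (s * \<kappa>) c x))"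
        by (simp add: norm_triangle_ineq)
      moreover have "norm (adj_op D A (sin_grad s q c x)) \<le> s * KAB * norm q" using s by (intro sin_adj_le) auto
      moreover have "s * KAB * norm q \<le> s * KAB * 1" using s KAB(1) q by (intro mult_left_mono) auto
      moreover have "norm (adj_op D A (root_grad id_blinfun (s * \<kappa>) c x)) \<le> (s * \<kappa>) * KAB * sqrt 1"
        using s \<rho> by (intro root_adj_le psd_id) (auto simp: power2_norm_eq_inner)
      ultimately show ?thesis using Qs(4) by simp
    qed
    have root_eq: "root_fn id_blinfun (s * \<kappa>) c x - s * \<kappa> = s * \<kappa> * (sqrt (1 + (norm (B (x - c)))\<^sup>2) - 1)" for x
      by (simp add: root_fn_def power2_norm_eq_inner algebra_simps)
    have f_eq: "f x = s * sin (q \<bullet> B (x - c)) + s * \<kappa> * (sqrt (1 + (norm (B (x - c)))\<^sup>2) - 1)" for x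
      using root_eq[of x] by (simp add: f_def sin_fn_def)
    have sin_b: "- s \<le> s * sin r" "s * sin r \<le> s" for r
      using mult_left_mono[OF sin_ge_minus_one[of r], of s] mult_left_mono[OF sin_le_one[of r], of s] s by auto
    have lo: "- (Q * s) \<le> f x" for x
    proof -
      have "0 \<le> s * \<kappa> * (sqrt (1 + (norm (B (x - c)))\<^sup>2) - 1)" using s \<rho> by auto
      then show ?thesis using sin_b(1)[of "q \<bullet> B (x - c)"] Qs(1) unfolding f_eq by linarith
    qed
    have hi: "f x \<le> Q * s" if "norm x \<le> R" for x
    proof -
      have "sqrt (1 + (norm (B (x - c)))\<^sup>2) \<le> 1 + norm (B (x - c))"
        by (rule real_le_lsqrt) (auto simp: power2_sum)
      then have "s * \<kappa> * (sqrt (1 + (norm (B (x - c)))\<^sup>2) - 1) \<le> s * \<kappa> * \<rho>"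
        using Bxc[OF that] s \<rho> by (intro mult_left_mono) auto
      then show ?thesis using sin_b(2)[of "q \<bullet> B (x - c)"] Qs(5) unfolding f_eq by linarith
    qed
    have dom: "p \<bullet> B (x - c) + 2 * s * (norm (B (x - c)))\<^sup>2 \<le> f x" if "norm x \<le> R" for x
    proof -
      define r where "r = norm (B (x - c))"
      define l where "l = q \<bullet> B (x - c)"
      have r: "0 \<le> r" "r \<le> \<rho>" using Bxc[OF that] by (auto simp: r_def)
      have "\<bar>l\<bar> \<le> norm q * r" unfolding l_def r_def by (rule Cauchy_Schwarz_ineq2)
      also have "\<dots> \<le> r" using q r by (simp add: mult_left_le_one_le)
      finally have "l\<^sup>2 \<le> r\<^sup>2" by (simp add: abs_le_square_iff[symmetric] r)
      moreover have "l - sin l \<le> l\<^sup>2" using sin_remainder[of 0 l] by simp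
      ultimately have "s * (l - r\<^sup>2) \<le> s * sin l" using s by (intro mult_left_mono) auto
      moreover have "s * l = p \<bullet> B (x - c)" using s by (simp add: l_def q_def)
      moreover have "s * (3 * r\<^sup>2) \<le> s * \<kappa> * (sqrt (1 + r\<^sup>2) - 1)"
      proof -
        have sq: "(sqrt (1 + r\<^sup>2) - 1) * (sqrt (1 + r\<^sup>2) + 1) = r\<^sup>2"
          by (simp add: algebra_simps flip: power2_eq_square)
        have "sqrt (1 + r\<^sup>2) \<le> 1 + r" by (rule real_le_lsqrt) (use r in \<open>auto simp: power2_sum\<close>)
        then have "(sqrt (1 + r\<^sup>2) - 1) * (sqrt (1 + r\<^sup>2) + 1) \<le> (sqrt (1 + r\<^sup>2) - 1) * (2 + \<rho>)"
          using r by (intro mult_left_mono) auto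
        then have "r\<^sup>2 \<le> (sqrt (1 + r\<^sup>2) - 1) * (2 + \<rho>)" by (simp only: sq)
        then have "s * 3 * r\<^sup>2 \<le> s * 3 * ((sqrt (1 + r\<^sup>2) - 1) * (2 + \<rho>))" using s by (intro mult_left_mono) auto
        then show ?thesis by (simp add: \<kappa>_def algebra_simps)
      qed
      ultimately show ?thesis unfolding f_eq r_def[symmetric] l_def[symmetric] by (simp add: algebra_simps)
    qed
    have f0: "f c = 0" by (simp add: f_eq)
    have "pert_ok (Q * s) T R a a' f f'"
      unfolding pert_ok_def using tt at st ad lo hi by blast
    then show "\<exists>a a' f f'. pert_ok (Q * s) T R a a' f f' \<and> a t0 = 0 \<and> f c = 0 \<and>
      (\<forall>t. p1 * (t - t0) + 2 * s * (t - t0)\<^sup>2 \<le> a t) \<and>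
      (\<forall>x. norm x \<le> R \<longrightarrow> p \<bullet> B (x - c) + 2 * s * (norm (B (x - c)))\<^sup>2 \<le> f x)"
      using f0 dom by (intro exI[of _ a] exI[of _ a'] exI[of _ f] exI[of _ f']) (simp add: a_def)
  qed
qed

text \<open>The variational principle is applied in the coordinates \<open>(t, B x, s, B y)\<close>,
  for which \<open>S\<close> is complete because balls contain the weak limits.
  \<open>pert_bounds\<close> dominates twice the quadratic term of the principle; the surplus is the
  term with \<open>c\<close>, which makes the maximum strict.\<close>

lemma admissible_perturbation:
  fixes \<Psi> :: "real \<Rightarrow> 'a \<Rightarrow> real \<Rightarrow> 'a \<Rightarrow> real" and S :: "(real \<times> 'a \<times> real \<times> 'a) set"
    and al be R T :: real
  defines "S \<equiv> {al..be} \<times> cball 0 R \<times> {al..be} \<times> cball 0 R"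
  assumes z0: "(t0, x0, s0, y0) \<in> S" and ab: "0 < al" "be < T"
    and ub: "\<And>t x s y. (t, x, s, y) \<in> S \<Longrightarrow> \<Psi> t x s y \<le> U"
    and usc: "\<And>\<tau> X \<tau>' Y t x s y \<epsilon>. (\<And>k. (\<tau> k, X k, \<tau>' k, Y k) \<in> S) \<Longrightarrow> (t, x, s, y) \<in> S \<Longrightarrow> \<tau> \<longlonglongrightarrow> t \<Longrightarrow>
      (\<lambda>k. B (X k)) \<longlonglongrightarrow> B x \<Longrightarrow> \<tau>' \<longlonglongrightarrow> s \<Longrightarrow> (\<lambda>k. B (Y k)) \<longlonglongrightarrow> B y \<Longrightarrow> 0 < \<epsilon> \<Longrightarrow>
      \<forall>\<^sub>F k in sequentially. \<Psi> (\<tau> k) (X k) (\<tau>' k) (Y k) \<le> \<Psi> t x s y + \<epsilon>"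
    and \<sigma>: "0 < \<sigma>"
  shows "\<exists>a1 a1' f1 f1' a2 a2' f2 f2' th xh sh yh c. pert_ok \<sigma> T R a1 a1' f1 f1' \<and> pert_ok \<sigma> T R a2 a2' f2 f2' \<and>
    (th, xh, sh, yh) \<in> S \<and> a1 th = 0 \<and> f1 xh = 0 \<and> a2 sh = 0 \<and> f2 yh = 0 \<and> 0 < c \<and>
    (\<forall>t x s y. (t, x, s, y) \<in> S \<longrightarrow> \<Psi> t x s y - (a1 t + f1 x + a2 s + f2 y)
      + c * ((t - th)\<^sup>2 + (norm (B (x - xh)))\<^sup>2 + (s - sh)\<^sup>2 + (norm (B (y - yh)))\<^sup>2) \<le> \<Psi> th xh sh yh)"
proof -
  have R: "0 \<le> R" and T: "0 < T"
    using z0 ab norm_ge_zero[of x0] unfolding S_def by (auto simp del: norm_ge_zero)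
  obtain Q where Q: "1 \<le> Q" and pert: "\<And>s p c p1 t0. 0 < s \<Longrightarrow> norm p \<le> s \<Longrightarrow> norm c \<le> R \<Longrightarrow> \<bar>p1\<bar> \<le> s \<Longrightarrow> t0 \<in> {0<..<T} \<Longrightarrow>
    (\<exists>a a' f f'. pert_ok (Q * s) T R a a' f f' \<and> a t0 = 0 \<and> f c = 0 \<and>
      (\<forall>t. p1 * (t - t0) + 2 * s * (t - t0)\<^sup>2 \<le> a t) \<and>
      (\<forall>x. norm x \<le> R \<longrightarrow> p \<bullet> B (x - c) + 2 * s * (norm (B (x - c)))\<^sup>2 \<le> f x))"
    using pert_bounds[OF T R] by metis
  define s where "s = \<sigma> / Q"
  have s: "0 < s" "Q * s = \<sigma>" using \<sigma> Q by (auto simp: s_def)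
  define N :: "real \<times> 'a \<times> real \<times> 'a \<Rightarrow> real \<times> 'a \<times> real \<times> 'a"
    where "N = (\<lambda>(t, x, r, y). (t, B x, r, B y))"
  define \<Psi>' where "\<Psi>' = (\<lambda>(t, x, r, y). \<Psi> t x r y)"
  have Bn: "norm (B x) \<le> \<beta> * R" if "norm x \<le> R" for x
    using norm_blinfun[of B x] mult_mono[of "norm B" \<beta> "norm x" R] that \<beta>_pos by (simp add: \<beta>_def)
  have "\<exists>P z. z \<in> S \<and> norm P \<le> s \<and> (\<forall>y\<in>S. \<Psi>' y - P \<bullet> (N y - N z) - s * (norm (N y - N z))\<^sup>2 \<le> \<Psi>' z)"
  proof (rule quadratic_variational_principle[OF z0 _ _ _ s(1)])
    fix z assume z: "z \<in> S"
    obtain t x r y where zz: "z = (t, x, r, y)" by (metis prod.exhaust)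
    have "norm (N z) \<le> norm t + (norm (B x) + (norm r + norm (B y)))"
      unfolding N_def zz by (auto intro!: order.trans[OF norm_Pair_le] add_left_mono)
    also have "\<dots> \<le> T + (\<beta> * R + (T + \<beta> * R))"
      using z ab unfolding zz S_def by (intro add_mono Bn) auto
    finally show "norm (N z) \<le> T + (\<beta> * R + (T + \<beta> * R))" .
    show "\<Psi>' z \<le> U" using ub z by (simp add: zz \<Psi>'_def)
  next
    fix Z e assume ZS: "\<And>k. Z k \<in> S" and Ze: "(\<lambda>k. N (Z k)) \<longlonglongrightarrow> e"
    define \<tau> X \<tau>' Y where "\<tau> k = fst (Z k)" and "X k = fst (snd (Z k))"
      and "\<tau>' k = fst (snd (snd (Z k)))" and "Y k = snd (snd (snd (Z k)))" for k
    have Z: "Z k = (\<tau> k, X k, \<tau>' k, Y k)" for k by (simp add: \<tau>_def X_def \<tau>'_def Y_def)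
    obtain t x' r y' where e: "e = (t, x', r, y')" by (metis prod.exhaust)
    have NZ: "(\<lambda>k. (\<tau> k, B (X k), \<tau>' k, B (Y k))) \<longlonglongrightarrow> (t, x', r, y')" using Ze by (simp add: N_def Z e)
    have c1: "\<tau> \<longlonglongrightarrow> t" using tendsto_fst[OF NZ] by simp
    have c2: "(\<lambda>k. B (X k)) \<longlonglongrightarrow> x'" using tendsto_fst[OF tendsto_snd[OF NZ]] by simp
    have c3: "\<tau>' \<longlonglongrightarrow> r" using tendsto_fst[OF tendsto_snd[OF tendsto_snd[OF NZ]]] by simp
    have c4: "(\<lambda>k. B (Y k)) \<longlonglongrightarrow> y'" using tendsto_snd[OF tendsto_snd[OF tendsto_snd[OF NZ]]] by simp
    have mem: "al \<le> \<tau> k" "\<tau> k \<le> be" "al \<le> \<tau>' k" "\<tau>' k \<le> be" "norm (X k) \<le> R" "norm (Y k) \<le> R" for k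
      using ZS[of k] by (auto simp: Z S_def)
    obtain x where x: "B x = x'" "norm x \<le> R" using weak_limit_exists[OF mem(5) c2] by blast
    obtain y where y: "B y = y'" "norm y \<le> R" using weak_limit_exists[OF mem(6) c4] by blast
    have "al \<le> t" "t \<le> be" "al \<le> r" "r \<le> be"
      using LIMSEQ_le_const[OF c1] LIMSEQ_le_const2[OF c1] LIMSEQ_le_const[OF c3] LIMSEQ_le_const2[OF c3] mem by blast+
    then have zS: "(t, x, r, y) \<in> S" using x y by (simp add: S_def)
    show "\<exists>z\<in>S. N z = e \<and> (\<forall>\<epsilon>>0. \<forall>\<^sub>F k in sequentially. \<Psi>' (Z k) \<le> \<Psi>' z + \<epsilon>)"
    proof (intro bexI[OF _ zS] conjI allI impI)
      show "N (t, x, r, y) = e" by (simp add: N_def e x y)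
      fix \<epsilon> :: real assume "0 < \<epsilon>"
      with usc[of \<tau> X \<tau>' Y t x r y \<epsilon>] ZS zS c1 c2 c3 c4
      show "\<forall>\<^sub>F k in sequentially. \<Psi>' (Z k) \<le> \<Psi>' (t, x, r, y) + \<epsilon>" by (simp add: \<Psi>'_def Z x y)
    qed
  qed
  then obtain P zh where zh: "zh \<in> S" "norm P \<le> s"
    and max: "\<And>y. y \<in> S \<Longrightarrow> \<Psi>' y - P \<bullet> (N y - N zh) - s * (norm (N y - N zh))\<^sup>2 \<le> \<Psi>' zh" by blast
  obtain p1 p2 p3 p4 where P: "P = (p1, p2, p3, p4)" by (metis prod.exhaust)
  obtain th xh sh yh where zz: "zh = (th, xh, sh, yh)" by (metis prod.exhaust)
  have pn: "\<bar>p1\<bar> \<le> s" "norm p2 \<le> s" "\<bar>p3\<bar> \<le> s" "norm p4 \<le> s"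
    using zh(2) order.trans[OF norm_fst_le[of P]] order.trans[OF norm_snd_le[of P]]
      order.trans[OF norm_fst_le[of "snd P"]] order.trans[OF norm_snd_le[of "snd P"]]
      order.trans[OF norm_fst_le[of "snd (snd P)"]] order.trans[OF norm_snd_le[of "snd (snd P)"]]
    unfolding P fst_conv snd_conv real_norm_def by (metis fst_conv snd_conv norm_fst_le norm_snd_le order.trans real_norm_def)+
  have mh: "th \<in> {0<..<T}" "sh \<in> {0<..<T}" "norm xh \<le> R" "norm yh \<le> R"
    using zh(1) ab by (auto simp: zz S_def)
  obtain a1 a1' f1 f1' where A1: "pert_ok \<sigma> T R a1 a1' f1 f1'" "a1 th = 0" "f1 xh = 0"
    "\<And>t. p1 * (t - th) + 2 * s * (t - th)\<^sup>2 \<le> a1 t"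
    "\<And>x. norm x \<le> R \<Longrightarrow> p2 \<bullet> B (x - xh) + 2 * s * (norm (B (x - xh)))\<^sup>2 \<le> f1 x"
    using pert[OF s(1) pn(2) mh(3) pn(1) mh(1)] unfolding s(2) by blast
  obtain a2 a2' f2 f2' where A2: "pert_ok \<sigma> T R a2 a2' f2 f2'" "a2 sh = 0" "f2 yh = 0"
    "\<And>t. p3 * (t - sh) + 2 * s * (t - sh)\<^sup>2 \<le> a2 t"
    "\<And>x. norm x \<le> R \<Longrightarrow> p4 \<bullet> B (x - yh) + 2 * s * (norm (B (x - yh)))\<^sup>2 \<le> f2 x"
    using pert[OF s(1) pn(4) mh(4) pn(3) mh(2)] unfolding s(2) by blast
  have "\<Psi> t x r y - (a1 t + f1 x + a2 r + f2 y)
      + s * ((t - th)\<^sup>2 + (norm (B (x - xh)))\<^sup>2 + (r - sh)\<^sup>2 + (norm (B (y - yh)))\<^sup>2) \<le> \<Psi> th xh sh yh"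
    if m: "(t, x, r, y) \<in> S" for t x r y
  proof -
    let ?d = "N (t, x, r, y) - N zh"
    have d: "?d = (t - th, B (x - xh), r - sh, B (y - yh))" by (simp add: N_def zz blinfun.diff_right)
    have inn: "P \<bullet> ?d = p1 * (t - th) + p2 \<bullet> B (x - xh) + p3 * (r - sh) + p4 \<bullet> B (y - yh)"
      unfolding d P by (simp add: inner_Pair)
    have sq: "(norm ?d)\<^sup>2 = (t - th)\<^sup>2 + (norm (B (x - xh)))\<^sup>2 + (r - sh)\<^sup>2 + (norm (B (y - yh)))\<^sup>2"
      unfolding d power2_norm_eq_inner by (simp add: inner_Pair power2_eq_square)
    have mx: "\<Psi> t x r y - P \<bullet> ?d - s * (norm ?d)\<^sup>2 \<le> \<Psi> th xh sh yh"
      using max[OF m] by (simp add: \<Psi>'_def zz)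
    have "norm x \<le> R" "norm y \<le> R" using m by (auto simp: S_def)
    then show ?thesis
      using mx A1(4)[of t] A1(5)[of x] A2(4)[of r] A2(5)[of y] unfolding inn sq by (simp add: distrib_left)
  qed
  then show ?thesis using A1(1-3) A2(1-3) zh(1) s(1) unfolding zz by blast
qed

end

section \<open>Doubling of variables\<close>

context setting begin

lemma pert_ok_add:
  assumes "pert_ok \<sigma> T R a a' f f'" "pert_ok \<sigma>' T R c c' g g'"
  shows "pert_ok (\<sigma> + \<sigma>') T R (\<lambda>t. a t + c t) (\<lambda>t. a' t + c' t) (\<lambda>x. f x + g x) (\<lambda>x. f' x + g' x)"
  unfolding pert_ok_def
proof (intro conjI ballI allI impI)
  have st: "stest \<sigma> \<sigma> f f'" "stest \<sigma>' \<sigma>' g g'" using assms by (auto simp: pert_ok_def)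
  show "stest (\<sigma> + \<sigma>') (\<sigma> + \<sigma>') (\<lambda>x. f x + g x) (\<lambda>x. f' x + g' x)" by (rule stest_add[OF st])
  show "time_test T (\<lambda>t. a t + c t) (\<lambda>t. a' t + c' t)"
    using assms unfolding pert_ok_def time_test_def by (auto intro: DERIV_add continuous_on_add)
  fix t assume "t \<in> {0<..<T}"
  then have "\<bar>a t\<bar> \<le> \<sigma>" "\<bar>a' t\<bar> \<le> \<sigma>" "\<bar>c t\<bar> \<le> \<sigma>'" "\<bar>c' t\<bar> \<le> \<sigma>'" using assms by (auto simp: pert_ok_def)
  then show "\<bar>a t + c t\<bar> \<le> \<sigma> + \<sigma>'" "\<bar>a' t + c' t\<bar> \<le> \<sigma> + \<sigma>'" by linarith+
next
  fix x
  have "adj_op D A (f' x + g' x) = adj_op D A (f' x) + adj_op D A (g' x)"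
    using assms by (intro adj_add) (auto simp: pert_ok_def stest_def)
  moreover have "norm (adj_op D A (f' x)) \<le> \<sigma>" "norm (adj_op D A (g' x)) \<le> \<sigma>'" using assms by (auto simp: pert_ok_def)
  ultimately show "norm (adj_op D A (f' x + g' x)) \<le> \<sigma> + \<sigma>'"
    using norm_triangle_ineq[of "adj_op D A (f' x)" "adj_op D A (g' x)"] by simp
  have "- \<sigma> \<le> f x" "- \<sigma>' \<le> g x" using assms by (auto simp: pert_ok_def)
  then show "- (\<sigma> + \<sigma>') \<le> f x + g x" by simp
  assume "norm x \<le> R"
  then have "f x \<le> \<sigma>" "g x \<le> \<sigma>'" using assms by (auto simp: pert_ok_def)
  then show "f x + g x \<le> \<sigma> + \<sigma>'" by simp
qed

text \<open>\<open>Q\<close> collects all terms that converge along the sequence; the radial terms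
  are only weakly lower semicontinuous. Their weights may be 0, which later isolates a single radial
  term.\<close>

lemma usc_functional:
  assumes u: "B_usc_on B ({0<..<T} \<times> UNIV) u" and w: "B_lsc_on B ({0<..<T} \<times> UNIV) w"
    and mem: "\<And>k. \<tau> k \<in> {0<..<T}" "\<And>k. \<tau>' k \<in> {0<..<T}" "t \<in> {0<..<T}" "s \<in> {0<..<T}"
    and bd: "\<And>k. norm (X k) \<le> R" "\<And>k. norm (Y k) \<le> R"
    and cv: "\<tau> \<longlonglongrightarrow> t" "(\<lambda>k. B (X k)) \<longlonglongrightarrow> B x" "\<tau>' \<longlonglongrightarrow> s" "(\<lambda>k. B (Y k)) \<longlonglongrightarrow> B y"
    and q: "Q \<longlonglongrightarrow> q" and \<delta>: "0 \<le> \<delta>1" "\<delta>1 \<le> 1" "0 \<le> \<delta>2" "\<delta>2 \<le> 1" and \<epsilon>: "0 < \<epsilon>"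
  shows "\<forall>\<^sub>F k in sequentially. u (\<tau> k) (X k) - w (\<tau>' k) (Y k) - Q k - \<delta>1 * h0 (norm (X k)) - \<delta>2 * h0 (norm (Y k))
    \<le> u t x - w s y - q - \<delta>1 * h0 (norm x) - \<delta>2 * h0 (norm y) + \<epsilon>"
proof -
  \<comment> \<open>Five contributions: \<open>u\<close>, \<open>w\<close>, \<open>Q\<close> and the
    two radial terms.\<close>
  define d where "d = \<epsilon> / 5"
  have d: "0 < d" using \<epsilon> by (simp add: d_def)
  have wX: "weakly_to X x" and wY: "weakly_to Y y" using weakly_toI bd cv by blast+
  have "limsup (\<lambda>k. ereal (u (\<tau> k) (X k))) \<le> ereal (u t x)"
    using u mem cv wX unfolding B_usc_on_def by blast
  also have "\<dots> < ereal (u t x + d)" using d by simp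
  finally have 1: "\<forall>\<^sub>F k in sequentially. ereal (u (\<tau> k) (X k)) < ereal (u t x + d)" by (rule Limsup_lessD)
  have "ereal (w s y - d) < ereal (w s y)" using d by simp
  also have "\<dots> \<le> liminf (\<lambda>k. ereal (w (\<tau>' k) (Y k)))"
    using w mem cv wY unfolding B_lsc_on_def by blast
  finally have 2: "\<forall>\<^sub>F k in sequentially. ereal (w s y - d) < ereal (w (\<tau>' k) (Y k))" by (rule less_LiminfD)
  have 3: "\<forall>\<^sub>F k in sequentially. q - d < Q k" using q d by (intro order_tendstoD(1)) auto
  have h: "h0 a \<le> h0 c + d" if "a \<le> c + d" "0 \<le> a" "0 \<le> c" for a c
  proof -
    have "h0 a \<le> h0 (c + d)" using that by (intro h0_mono)
    also have "\<dots> \<le> h0 c + d" using h0_lip[of "c + d" c] that d by (simp add: abs_le_iff)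
    finally show ?thesis .
  qed
  have dh: "\<delta> * h0 a \<le> \<delta> * h0 c + d" if "a \<le> c + d" "0 \<le> a" "0 \<le> c" "0 \<le> \<delta>" "\<delta> \<le> 1" for a c \<delta>
  proof -
    have "\<delta> * h0 a \<le> \<delta> * (h0 c + d)" using h[OF that(1-3)] that(4) by (rule mult_left_mono)
    also have "\<dots> \<le> \<delta> * h0 c + d" using mult_right_mono[OF that(5), of d] d by (simp add: distrib_left)
    finally show ?thesis .
  qed
  show ?thesis
    using 1 2 3 weakly_norm_lsc[OF wX d] weakly_norm_lsc[OF wY d]
  proof eventually_elim
    case (elim k)
    have "\<delta>1 * h0 (norm x) \<le> \<delta>1 * h0 (norm (X k)) + d" "\<delta>2 * h0 (norm y) \<le> \<delta>2 * h0 (norm (Y k)) + d"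
      using dh elim(4,5) \<delta> by auto
    moreover have "u (\<tau> k) (X k) < u t x + d" "w s y - d < w (\<tau>' k) (Y k)" using elim(1,2) by simp_all
    ultimately show ?case using elim(3) by (simp add: d_def)
  qed
qed

lemma root_fn_symmetric: "root_fn W k x y = root_fn W k y x"
proof -
  have "B (y - x) = - B (x - y)" by (simp add: blinfun.diff_right)
  then show ?thesis by (simp add: root_fn_def blinfun.minus_right)
qed

lemma root_grad_antisymmetric: "root_grad W k x y = - root_grad W k y x"
proof -
  have "B (y - x) = - B (x - y)" by (simp add: blinfun.diff_right)
  then show ?thesis by (simp add: root_grad_def blinfun.minus_right)
qed

lemma root_adj_antisymmetric: "adj_op D A (root_grad W k x y) = - adj_op D A (root_grad W k y x)"
proof -
  have "B (y - x) = - B (x - y)" by (simp add: blinfun.diff_right)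
  moreover have "AB (- v) = - AB v" for v
    using bounded_linear_AB by (simp add: linear_neg bounded_linear.linear)
  ultimately show ?thesis by (simp add: root_grad_adj blinfun.minus_right)
qed

end

context equation begin

lemma F_growth: "norm (F x) \<le> M * (1 + b * norm x)"
proof -
  have "norm (F x) \<le> norm (F 0) + norm (F x - F 0)" using norm_triangle_ineq[of "F 0" "F x - F 0"] by simp
  also have "\<dots> \<le> M + M * nm x" using F_zero F_lip[of x 0] by (simp add: norm_m1_nm)
  also have "\<dots> \<le> M + M * (b * norm x)" using M nm_le[of x] by (intro add_left_mono mult_left_mono)
  finally show ?thesis by (simp add: algebra_simps)
qed

lemma F_rad_le:
  assumes "0 \<le> \<delta>"
  shows "F x \<bullet> rad \<delta> x \<le> M * (1 + b) * \<delta>"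
proof -
  let ?r = "norm x"
  have pos: "0 < 1 + ?r\<^sup>2" by (simp add: add_pos_nonneg)
  have "F x \<bullet> rad \<delta> x \<le> norm (F x) * norm (rad \<delta> x)" by (rule norm_cauchy_schwarz)
  also have "\<dots> \<le> (M * (1 + b * ?r)) * norm (rad \<delta> x)" by (intro mult_right_mono F_growth) auto
  also have "norm (rad \<delta> x) = \<delta> * (?r / (1 + ?r\<^sup>2))" using assms pos by (simp add: rad_def)
  also have "(M * (1 + b * ?r)) * (\<delta> * (?r / (1 + ?r\<^sup>2))) = (M * \<delta>) * ((1 + b * ?r) * ?r / (1 + ?r\<^sup>2))" by simp
  also have "\<dots> \<le> (M * \<delta>) * (1 + b)"
  proof (intro mult_left_mono)
    have "2 * ?r \<le> 1 + ?r\<^sup>2" using sum_squares_bound[of 1 ?r] by simp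
    then have "?r \<le> 1 + ?r\<^sup>2" using norm_ge_zero[of x] by linarith
    moreover have "b * ?r\<^sup>2 \<le> b * (1 + ?r\<^sup>2)" using b_pos by (intro mult_left_mono) auto
    ultimately have "(1 + b * ?r) * ?r \<le> (1 + b) * (1 + ?r\<^sup>2)" by (simp add: algebra_simps power2_eq_square)
    then show "(1 + b * ?r) * ?r / (1 + ?r\<^sup>2) \<le> 1 + b" using pos by (simp add: pos_divide_le_eq)
  qed (use M assms in auto)
  finally show ?thesis by (simp add: algebra_simps)
qed

text \<open>Freezing \<open>(s, y)\<close> gives a test function for \<open>u\<close>, freezing
  \<open>(t, x)\<close> one for \<open>w\<close>. The penalty has opposite gradients in
  \<open>x\<close> and \<open>y\<close>, so both Hamiltonians are evaluated near the same vector
  \<open>\<pi>\<close>. The derivatives of \<open>(t - s)\<^sup>2 / \<gamma>\<close> cancel, those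
  of the barriers have the favourable sign, and \<open>lam\<close> remains.\<close>

lemma doubling_inequality:
  fixes u w :: "real \<Rightarrow> 'a \<Rightarrow> real"
  assumes sub: "approx_sub T \<eta> L1 L2 u" and super: "approx_super T \<eta> L1 L2 w"
    and W: "psd W" and d: "0 \<le> d" and k: "0 \<le> k" and Wd: "\<And>y. W (B y) \<bullet> B y \<le> d\<^sup>2 * (norm y)\<^sup>2"
    and L: "k * d + \<sigma> \<le> L1" "k * d\<^sup>2 + \<sigma> \<le> L2"
    and p1: "pert_ok \<sigma> T R a1 a1' f1 f1'" and p2: "pert_ok \<sigma> T R a2 a2' f2 f2'"
    and \<delta>: "0 \<le> \<delta>1" "\<delta>1 \<le> 1" "0 \<le> \<delta>2" "\<delta>2 \<le> 1" and \<gamma>: "0 < \<gamma>" and \<mu>: "0 \<le> \<mu>"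
    and mem: "t \<in> {0<..<T}" "s \<in> {0<..<T}" "norm x \<le> R" "norm y \<le> R"
    and max: "\<And>t' x' s' y'. t' \<in> {0<..<T} \<Longrightarrow> s' \<in> {0<..<T} \<Longrightarrow>
      u t' x' - w s' y' - root_fn W k y' x' - ((t' - s')\<^sup>2 / \<gamma> + lam * (T - t') + \<mu> / t' + \<mu> / s')
        - \<delta>1 * h0 (norm x') - \<delta>2 * h0 (norm y') - (a1 t' + f1 x' + a2 s' + f2 y')
      \<le> u t x - w s y - root_fn W k y x - ((t - s)\<^sup>2 / \<gamma> + lam * (T - t) + \<mu> / t + \<mu> / s)
        - \<delta>1 * h0 (norm x) - \<delta>2 * h0 (norm y) - (a1 t + f1 x + a2 s + f2 y)"
  defines "K \<equiv> (L1 + 1) * M + 1"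
  shows "lam \<le> 2 * \<eta> - (x - y) \<bullet> adj_op D A (root_grad W k y x)
    + (1 + K * Iw K) * (k * d) * M * nm (x - y) + (M * (1 + b) + K * Iw K * M) * (\<delta>1 + \<delta>2)
    + \<sigma> * (2 + 2 * R + 2 * M * (1 + b * R) + 2 * (K * Iw K * M))"
proof -
  define \<pi> where "\<pi> = root_grad W k y x"
  have st1: "stest \<sigma> \<sigma> f1 f1'" and st2: "stest \<sigma> \<sigma> f2 f2'" using p1 p2 by (auto simp: pert_ok_def)
  have root: "stest (k * d) (k * d\<^sup>2) (root_fn W k c) (root_grad W k c)" for c
    by (rule stest_root[OF W d Wd k])
  have fu: "stest L1 L2 (\<lambda>x. root_fn W k y x + f1 x) (\<lambda>x. root_grad W k y x + f1' x)"
    by (rule stest_mono[OF stest_add[OF root st1] L])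
  have fw: "stest L1 L2 (\<lambda>y. root_fn W k x y + f2 y) (\<lambda>y. root_grad W k x y + f2' y)"
    by (rule stest_mono[OF stest_add[OF root st2] L])
  have tt1: "time_test T a1 a1'" and tt2: "time_test T a2 a2'" using p1 p2 by (auto simp: pert_ok_def)
  define au where "au r = (r - s)\<^sup>2 / \<gamma> + lam * (T - r) + \<mu> / r + a1 r" for r
  define au' where "au' r = 2 * (r - s) / \<gamma> - lam - \<mu> / r\<^sup>2 + a1' r" for r
  define aw where "aw r = (t - r)\<^sup>2 / \<gamma> + \<mu> / r + a2 r" for r
  define aw' where "aw' r = - 2 * (t - r) / \<gamma> - \<mu> / r\<^sup>2 + a2' r" for r
  have tu: "time_test T au au'"
    unfolding time_test_def
  proof (intro conjI ballI)
    show "continuous_on {0<..<T} au'"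
      unfolding au'_def using tt1 \<gamma> by (intro continuous_intros) (auto simp: time_test_def)
    fix r assume r: "r \<in> {0<..<T}"
    have "(a1 has_real_derivative a1' r) (at r)" using tt1 r by (simp add: time_test_def)
    then show "(au has_real_derivative au' r) (at r)"
      unfolding au_def au'_def using r \<gamma>
      by (auto intro!: derivative_eq_intros simp: power2_eq_square field_simps)
  qed
  have tw: "time_test T aw aw'"
    unfolding time_test_def
  proof (intro conjI ballI)
    show "continuous_on {0<..<T} aw'"
      unfolding aw'_def using tt2 \<gamma> by (intro continuous_intros) (auto simp: time_test_def)
    fix r assume r: "r \<in> {0<..<T}"
    have "(a2 has_real_derivative a2' r) (at r)" using tt2 r by (simp add: time_test_def)
    then show "(aw has_real_derivative aw' r) (at r)"
      unfolding aw_def aw'_def using r \<gamma>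
      by (auto intro!: derivative_eq_intros simp: power2_eq_square field_simps)
  qed
  have maxu: "\<forall>r\<in>{0<..<T}. \<forall>v. u r v - (au r + (root_fn W k y v + f1 v)) - \<delta>1 * h0 (norm v)
      \<le> u t x - (au t + (root_fn W k y x + f1 x)) - \<delta>1 * h0 (norm x)"
  proof (intro ballI allI)
    fix r v assume "r \<in> {0<..<T}"
    from max[OF this mem(2), of v y]
    show "u r v - (au r + (root_fn W k y v + f1 v)) - \<delta>1 * h0 (norm v)
      \<le> u t x - (au t + (root_fn W k y x + f1 x)) - \<delta>1 * h0 (norm x)" by (simp add: au_def)
  qed
  have minw: "\<forall>r\<in>{0<..<T}. \<forall>v. w s y + (aw s + (root_fn W k x y + f2 y)) + \<delta>2 * h0 (norm y)
      \<le> w r v + (aw r + (root_fn W k x v + f2 v)) + \<delta>2 * h0 (norm v)"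
  proof (intro ballI allI)
    fix r v assume "r \<in> {0<..<T}"
    from max[OF mem(1) this, of x v]
    show "w s y + (aw s + (root_fn W k x y + f2 y)) + \<delta>2 * h0 (norm y)
      \<le> w r v + (aw r + (root_fn W k x v + f2 v)) + \<delta>2 * h0 (norm v)"
      by (simp add: aw_def root_fn_symmetric[of W k x])
  qed
  define ru where "ru = f1' x + rad \<delta>1 x"
  define rw where "rw = f2' y + rad \<delta>2 y"
  have "- \<eta> \<le> au' t - x \<bullet> adj_op D A (root_grad W k y x + f1' x) + F x \<bullet> (root_grad W k y x + f1' x + rad \<delta>1 x)
      + HG x (root_grad W k y x + f1' x + rad \<delta>1 x)"
    using sub maxu mem(1) \<delta> tu fu unfolding approx_sub_def by blast
  then have ineq_u: "- \<eta> \<le> au' t - x \<bullet> (adj_op D A \<pi> + adj_op D A (f1' x)) + F x \<bullet> (\<pi> + ru) + HG x (\<pi> + ru)"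
    using adj_add(2)[OF stestD(4)[OF root] stestD(4)[OF st1]] by (simp add: \<pi>_def ru_def add.assoc)
  have "- aw' s + y \<bullet> adj_op D A (root_grad W k x y + f2' y) - F y \<bullet> (root_grad W k x y + f2' y + rad \<delta>2 y)
      + HG y (- (root_grad W k x y + f2' y + rad \<delta>2 y)) \<le> \<eta>"
    using super minw mem(2) \<delta> tw fw unfolding approx_super_def by blast
  moreover have "root_grad W k x y + f2' y + rad \<delta>2 y = rw - \<pi>"
    by (simp add: \<pi>_def rw_def root_grad_antisymmetric[of W k x y])
  moreover have "adj_op D A (root_grad W k x y + f2' y) = adj_op D A (f2' y) - adj_op D A \<pi>"
    using adj_add(2)[OF stestD(4)[OF root] stestD(4)[OF st2], of x y y]
    by (simp add: \<pi>_def root_adj_antisymmetric[of W k x y])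
  ultimately have ineq_w: "- aw' s + y \<bullet> (adj_op D A (f2' y) - adj_op D A \<pi>) - F y \<bullet> (rw - \<pi>) + HG y (\<pi> - rw) \<le> \<eta>"
    by simp
  have \<sigma>: "0 \<le> \<sigma>" using stestD(3)[OF st1, of x] norm_ge_zero order.trans by blast
  have time: "au' t + aw' s \<le> - lam + 2 * \<sigma>"
  proof -
    have "\<bar>a1' t\<bar> \<le> \<sigma>" "\<bar>a2' s\<bar> \<le> \<sigma>" using p1 p2 mem by (auto simp: pert_ok_def)
    moreover have "0 \<le> \<mu> / t\<^sup>2" "0 \<le> \<mu> / s\<^sup>2" using \<mu> by auto
    moreover have "2 * (t - s) / \<gamma> + - 2 * (t - s) / \<gamma> = 0" by (simp flip: add_divide_distrib)
    ultimately show ?thesis unfolding au'_def aw'_def by linarith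
  qed
  have inn: "\<bar>v \<bullet> v'\<bar> \<le> p * q" if "norm v \<le> p" "norm v' \<le> q" for v v' :: 'a and p q
  proof -
    have "0 \<le> p" using that(1) norm_ge_zero order.trans by blast
    then show ?thesis using Cauchy_Schwarz_ineq2[of v v'] mult_mono[OF that] by (meson norm_ge_zero order.trans)
  qed
  have A1: "- (x \<bullet> adj_op D A (f1' x)) \<le> R * \<sigma>" and A2: "- (y \<bullet> adj_op D A (f2' y)) \<le> R * \<sigma>"
    using inn[OF mem(3), of "adj_op D A (f1' x)" \<sigma>] inn[OF mem(4), of "adj_op D A (f2' y)" \<sigma>] p1 p2
    by (auto simp: pert_ok_def abs_le_iff)
  have \<pi>_le: "norm \<pi> \<le> k * d" unfolding \<pi>_def by (rule stestD(3)[OF root])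
  have FF: "(F x - F y) \<bullet> \<pi> \<le> (M * nm (x - y)) * (k * d)"
    using inn[OF F_lip[unfolded norm_m1_nm] \<pi>_le, of x y] by simp
  have Fx: "norm (F x) \<le> M * (1 + b * R)" if "norm x \<le> R" for x
  proof -
    have "M * (1 + b * norm x) \<le> M * (1 + b * R)" using that M b_pos by (intro mult_left_mono add_left_mono) auto
    then show ?thesis using F_growth[of x] by linarith
  qed
  have F1: "F x \<bullet> ru \<le> (M * (1 + b * R)) * \<sigma> + M * (1 + b) * \<delta>1"
    using inn[OF Fx[OF mem(3)] stestD(3)[OF st1, of x]] F_rad_le[OF \<delta>(1), of x]
    by (simp add: ru_def inner_add_right)
  have F2: "F y \<bullet> rw \<le> (M * (1 + b * R)) * \<sigma> + M * (1 + b) * \<delta>2"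
    using inn[OF Fx[OF mem(4)] stestD(3)[OF st2, of y]] F_rad_le[OF \<delta>(3), of y]
    by (simp add: rw_def inner_add_right)
  have ru_le: "norm ru \<le> \<sigma> + \<delta>1" and rw_le: "norm rw \<le> \<sigma> + \<delta>2"
    using norm_triangle_ineq[of "f1' x" "rad \<delta>1 x"] norm_triangle_ineq[of "f2' y" "rad \<delta>2 y"]
      stestD(3)[OF st1, of x] stestD(3)[OF st2, of y] rad_norm_le[OF \<delta>(1), of x] rad_norm_le[OF \<delta>(3), of y]
    by (simp_all add: ru_def rw_def)
  \<comment> \<open>The slope bound \<open>K\<close> applies because both momenta have norm at most
    \<open>k * d + \<sigma> + 1 \<le> L1 + 1\<close>.\<close>
  have HGd: "\<bar>HG x (\<pi> + ru) - HG y (\<pi> - rw)\<bar> \<le> (k * d * (M * nm (x - y)) + M * (\<sigma> + \<delta>1) + M * (\<sigma> + \<delta>2)) * K * Iw K"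
  proof (rule HG_lip)
    have "norm (\<pi> + ru) \<le> L1 + 1" "norm (\<pi> - rw) \<le> L1 + 1"
      using norm_triangle_ineq[of \<pi> ru] norm_triangle_ineq4[of \<pi> rw] \<pi>_le ru_le rw_le \<delta> L(1) by linarith+
    then have "norm (\<pi> + ru) * M \<le> (L1 + 1) * M" "norm (\<pi> - rw) * M \<le> (L1 + 1) * M"
      using M by (auto intro: mult_right_mono)
    then show "norm (\<pi> + ru) * M \<le> K" "norm (\<pi> - rw) * M \<le> K" by (auto simp: K_def)
    have "0 \<le> (L1 + 1) * M" using \<open>norm (\<pi> + ru) \<le> L1 + 1\<close> M norm_ge_zero order.trans by (metis mult_nonneg_nonneg)
    then show "0 < K" by (simp add: K_def)
    fix z
    have "(\<pi> + ru) \<bullet> G x z - (\<pi> - rw) \<bullet> G y z = \<pi> \<bullet> ((G x - G y) z) + ru \<bullet> G x z + rw \<bullet> G y z"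
      by (simp add: inner_simps blinfun.diff_left)
    moreover have "\<bar>\<pi> \<bullet> ((G x - G y) z)\<bar> \<le> (k * d) * (M * nm (x - y) * norm z)"
    proof (rule inn[OF \<pi>_le])
      show "norm ((G x - G y) z) \<le> M * nm (x - y) * norm z"
        using norm_blinfun[of "G x - G y" z] mult_right_mono[OF G_lip[of x y], of "norm z"] by (simp add: norm_m1_nm)
    qed
    moreover have "\<bar>ru \<bullet> G x z\<bar> \<le> (\<sigma> + \<delta>1) * (M * norm z)" "\<bar>rw \<bullet> G y z\<bar> \<le> (\<sigma> + \<delta>2) * (M * norm z)"
      by (intro inn ru_le rw_le G_norm)+
    ultimately show "\<bar>(\<pi> + ru) \<bullet> G x z - (\<pi> - rw) \<bullet> G y z\<bar> \<le> (k * d * (M * nm (x - y)) + M * (\<sigma> + \<delta>1) + M * (\<sigma> + \<delta>2)) * norm z"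
      by (simp add: algebra_simps)
  qed
  have "- 2 * \<eta> \<le> (au' t + aw' s) - (x - y) \<bullet> adj_op D A \<pi> - x \<bullet> adj_op D A (f1' x) - y \<bullet> adj_op D A (f2' y)
      + (F x - F y) \<bullet> \<pi> + F x \<bullet> ru + F y \<bullet> rw + (HG x (\<pi> + ru) - HG y (\<pi> - rw))"
    using ineq_u ineq_w by (simp add: inner_simps)
  then have "lam \<le> 2 * \<eta> + 2 * \<sigma> - (x - y) \<bullet> adj_op D A \<pi> + 2 * (R * \<sigma>) + (M * nm (x - y)) * (k * d)
      + (2 * ((M * (1 + b * R)) * \<sigma>) + M * (1 + b) * \<delta>1 + M * (1 + b) * \<delta>2)
      + (k * d * (M * nm (x - y)) + M * (\<sigma> + \<delta>1) + M * (\<sigma> + \<delta>2)) * K * Iw K"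
    using time A1 A2 FF F1 F2 HGd unfolding abs_le_iff by linarith
  also have "\<dots> = 2 * \<eta> - (x - y) \<bullet> adj_op D A \<pi>
    + (1 + K * Iw K) * (k * d) * M * nm (x - y) + (M * (1 + b) + K * Iw K * M) * (\<delta>1 + \<delta>2)
    + \<sigma> * (2 + 2 * R + 2 * M * (1 + b * R) + 2 * (K * Iw K * M))"
    by (simp add: algebra_simps)
  finally show ?thesis unfolding \<pi>_def .
qed

end

lemma square_le_inverse_tendsto_zero:
  fixes a :: "nat \<Rightarrow> real"
  assumes "\<And>k. (a k)\<^sup>2 \<le> E / (real k + 1)"
  shows "a \<longlonglongrightarrow> 0"
proof -
  have "(\<lambda>k. E * (1 / real (Suc k))) \<longlonglongrightarrow> E * 0" by (intro tendsto_intros LIMSEQ_Suc lim_1_over_n)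
  then have "(\<lambda>k. sqrt (E / (real k + 1))) \<longlonglongrightarrow> sqrt 0"
    by (intro tendsto_real_sqrt) (simp add: add.commute)
  moreover have "norm (a k) \<le> sqrt (E / (real k + 1))" for k
    using real_sqrt_le_mono[OF assms[of k]] by simp
  ultimately show ?thesis by (intro Lim_null_comparison[of a "\<lambda>k. sqrt (E / (real k + 1))"]) auto
qed

lemma h0_strict_mono: "0 \<le> r \<Longrightarrow> r < s \<Longrightarrow> h0 r < h0 s"
proof -
  assume "0 \<le> r" "r < s"
  then have "r\<^sup>2 < s\<^sup>2" by (intro power_strict_mono) auto
  then show ?thesis by (simp add: h0_def add_pos_nonneg)
qed

text \<open>Strict monotonicity of \<open>h0\<close> converts asymptotic bounds on \<open>h0\<close>
  of the norms into bounds on the norms, the form that \<open>strong_limit\<close> asks for.\<close>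

lemma h0_norm_bound:
  fixes X :: "nat \<Rightarrow> 'b::real_inner"
  assumes "\<And>\<epsilon>. 0 < \<epsilon> \<Longrightarrow> \<forall>\<^sub>F k in sequentially. h0 (norm (X k)) \<le> h0 (norm x) + \<epsilon>" and "0 < \<epsilon>"
  shows "\<forall>\<^sub>F k in sequentially. norm (X k) \<le> norm x + \<epsilon>"
proof -
  define d where "d = (h0 (norm x + \<epsilon>) - h0 (norm x)) / 2"
  have "h0 (norm x) < h0 (norm x + \<epsilon>)" using assms(2) by (intro h0_strict_mono) auto
  then have d: "0 < d" "h0 (norm x) + d < h0 (norm x + \<epsilon>)" by (auto simp: d_def field_simps)
  show ?thesis
    using assms(1)[OF d(1)]
  proof eventually_elim
    case (elim k)
    show ?case
    proof (rule ccontr)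
      assume "\<not> norm (X k) \<le> norm x + \<epsilon>"
      then have "h0 (norm x + \<epsilon>) \<le> h0 (norm (X k))" using assms(2) by (intro h0_mono) auto
      then show False using elim d(2) by linarith
    qed
  qed
qed

section \<open>The regularised penalty and its limit\<close>

context setting begin

text \<open>For \<open>e > 0\<close> the scaling makes \<open>root_fn (We e m) (L * e) y x\<close>
  equal to \<open>L * sqrt (e\<^sup>2 + \<langle>B J\<^sub>m z, z\<rangle>)\<close> with
  \<open>z = x - y\<close>.\<close>

definition "We e m = (1 / e\<^sup>2) *\<^sub>R Wm m"

text \<open>For \<open>e > 0\<close> this is
  \<open>L * sqrt (e\<^sup>2 + (nm (x - y))\<^sup>2)\<close>, the unregularised penalty with
  \<Lambda> = \<open>L\<close> and \<epsilon> = \<open>e\<close>, written so as to match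
  \<open>root_fn\<close>.\<close>

definition "Th e L x y = L * e * sqrt (1 + (nm (x - y))\<^sup>2 / e\<^sup>2)"

lemma We_B: "We e m (B z) = (1 / e\<^sup>2) *\<^sub>R (z - Cp m z)"
  by (simp add: We_def blinfun.scaleR_left Wm_B)

lemma psd_We: "psd (We e m)"
  using psdD[OF psd_Wm[of m]] by (simp add: psd_def self_adjoint_def We_def blinfun.scaleR_left)

lemma We_form: "We e m (B z) \<bullet> B z = ((nm z)\<^sup>2 - Cp m (B z) \<bullet> z) / e\<^sup>2"
  using Wm_form[of m z] by (simp add: We_def blinfun.scaleR_left nm_sq)

lemma We_form_le: "0 < e \<Longrightarrow> We e m (B z) \<bullet> B z \<le> (b / e)\<^sup>2 * (norm z)\<^sup>2"
proof -
  assume e: "0 < e"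
  have "(nm z)\<^sup>2 - Cp m (B z) \<bullet> z \<le> b\<^sup>2 * (norm z)\<^sup>2"
    using CpB_form_nonneg[of m z] B_form_le[of z] by (simp add: nm_sq b_pos)
  then show ?thesis using e by (simp add: We_form power_divide divide_right_mono)
qed

lemma root_We_eq: "root_fn (We e m) k y x = k * sqrt (1 + ((nm (x - y))\<^sup>2 - Cp m (B (x - y)) \<bullet> (x - y)) / e\<^sup>2)"
  by (simp add: root_fn_def We_form)

lemma root_We_nonneg: "0 \<le> k \<Longrightarrow> 0 \<le> root_fn W k y x" if "psd W" for W
  using psdD(2)[OF that, of "B (x - y)"] by (simp add: root_fn_def)

lemma root_We_le_Th:
  assumes "0 < e" "0 \<le> L"
  shows "root_fn (We e m) (L * e) y x \<le> Th e L x y"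
  unfolding root_We_eq Th_def using assms CpB_form_nonneg[of m "x - y"]
  by (intro mult_left_mono real_sqrt_le_mono add_left_mono divide_right_mono) auto

text \<open>For \<open>0 \<le> p \<le> q\<close>, the bound
  \<open>sqrt (1 + q) \<le> sqrt (1 + (q - p)) + p\<close> turns the defect of the form into a
  defect of the root, and \<open>CpB_form_le\<close> makes it of order \<open>1 / m\<close> on
  bounded sets.\<close>

lemma Th_le_root_We:
  assumes e: "0 < e" and L: "0 \<le> L"
  shows "Th e L x y \<le> root_fn (We e m) (L * e) y x + L / e * (\<beta> / (real m + 1)) * (norm (x - y))\<^sup>2"
proof -
  define q where "q = (nm (x - y))\<^sup>2 / e\<^sup>2"
  define p where "p = Cp m (B (x - y)) \<bullet> (x - y) / e\<^sup>2"
  have p: "0 \<le> p" using CpB_form_nonneg[of m "x - y"] by (simp add: p_def)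
  have "0 \<le> We e m (B (x - y)) \<bullet> B (x - y)" by (rule psdD(2)[OF psd_We])
  then have qp: "0 \<le> q - p" by (simp add: We_form q_def p_def diff_divide_distrib)
  have "sqrt (1 + q) \<le> sqrt (1 + (q - p)) + p"
  proof (rule real_le_lsqrt)
    define r where "r = sqrt (1 + (q - p))"
    have r: "1 \<le> r" "r\<^sup>2 = 1 + (q - p)" using qp by (auto simp: r_def)
    have "p * 1 \<le> p * r" using r(1) p by (rule mult_left_mono)
    moreover have "(r + p)\<^sup>2 = r\<^sup>2 + 2 * (p * r) + p\<^sup>2" by (simp add: power2_sum)
    ultimately show "1 + q \<le> (sqrt (1 + (q - p)) + p)\<^sup>2"
      unfolding r_def[symmetric] using r(2) p zero_le_power2[of p] by linarith
  qed (use qp p in auto)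
  then have "L * e * sqrt (1 + q) \<le> L * e * (sqrt (1 + (q - p)) + p)" using e L by (intro mult_left_mono) auto
  then have "Th e L x y \<le> root_fn (We e m) (L * e) y x + L * e * p"
    by (simp add: Th_def root_We_eq q_def p_def diff_divide_distrib distrib_left)
  also have "L * e * p = L / e * (Cp m (B (x - y)) \<bullet> (x - y))" using e by (simp add: p_def power2_eq_square)
  also have "\<dots> \<le> L / e * (\<beta> / (real m + 1) * (norm (x - y))\<^sup>2)" using e L by (intro mult_left_mono CpB_form_le) auto
  finally show ?thesis by (simp add: mult.assoc)
qed

lemma Th_ge: "0 < e \<Longrightarrow> 0 \<le> L \<Longrightarrow> L * nm (x - y) \<le> Th e L x y"
proof -
  assume e: "0 < e" and L: "0 \<le> L"
  have "nm (x - y) / e = sqrt ((nm (x - y))\<^sup>2 / e\<^sup>2)" using e nm_nonneg[of "x - y"] by (simp add: real_sqrt_divide)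
  also have "\<dots> \<le> sqrt (1 + (nm (x - y))\<^sup>2 / e\<^sup>2)" by simp
  finally have "L * e * (nm (x - y) / e) \<le> L * e * sqrt (1 + (nm (x - y))\<^sup>2 / e\<^sup>2)" using e L by (intro mult_left_mono) auto
  then show ?thesis using e by (simp add: Th_def)
qed

lemma Th_tendsto:
  assumes "\<And>k. norm (X k) \<le> R" "\<And>k. norm (Y k) \<le> R" "(\<lambda>k. B (X k)) \<longlonglongrightarrow> B x" "(\<lambda>k. B (Y k)) \<longlonglongrightarrow> B y" "0 < e"
  shows "(\<lambda>k. Th e L (X k) (Y k)) \<longlonglongrightarrow> Th e L x y"
proof -
  have "norm (X k - Y k) \<le> R + R" for k using norm_triangle_ineq4[of "X k" "Y k"] assms(1,2)[of k] by linarith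
  moreover have "(\<lambda>k. B (X k - Y k)) \<longlonglongrightarrow> B (x - y)"
    unfolding blinfun.diff_right by (intro tendsto_diff assms)
  ultimately have "(\<lambda>k. B (X k - Y k) \<bullet> (X k - Y k)) \<longlonglongrightarrow> B (x - y) \<bullet> (x - y)" by (rule B_form_tendsto)
  then show ?thesis unfolding Th_def nm_sq using assms(5)
    by (intro tendsto_mult tendsto_real_sqrt tendsto_add tendsto_divide tendsto_const) auto
qed

lemma root_tendsto:
  assumes "psd W" "0 \<le> k" "(\<lambda>n. B (X n)) \<longlonglongrightarrow> B x" "(\<lambda>n. B (Y n)) \<longlonglongrightarrow> B y"
  shows "(\<lambda>n. root_fn W k (Y n) (X n)) \<longlonglongrightarrow> root_fn W k y x"
proof -
  have c: "(\<lambda>n. B (X n - Y n)) \<longlonglongrightarrow> B (x - y)" unfolding blinfun.diff_right by (intro tendsto_diff assms)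
  have "(\<lambda>n. W (B (X n - Y n)) \<bullet> B (X n - Y n)) \<longlonglongrightarrow> W (B (x - y)) \<bullet> B (x - y)"
    by (rule tendsto_inner[OF bounded_linear.tendsto[OF blinfun.bounded_linear_right c] c])
  then show ?thesis unfolding root_fn_def by (intro tendsto_mult tendsto_real_sqrt tendsto_add tendsto_const)
qed

lemma pert_tendsto:
  assumes p: "pert_ok \<sigma> T R a a' f f'" and t: "t \<in> {0<..<T}" and c: "\<tau> \<longlonglongrightarrow> t" "(\<lambda>k. B (X k)) \<longlonglongrightarrow> B x"
  shows "(\<lambda>k. a (\<tau> k)) \<longlonglongrightarrow> a t" "(\<lambda>k. f (X k)) \<longlonglongrightarrow> f x"
proof -
  have "(a has_real_derivative a' t) (at t)" using p t by (simp add: pert_ok_def time_test_def)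
  then show "(\<lambda>k. a (\<tau> k)) \<longlonglongrightarrow> a t" by (rule isCont_tendsto_compose[OF DERIV_isCont c(1)])
  show "(\<lambda>k. f (X k)) \<longlonglongrightarrow> f x" using p c(2) unfolding pert_ok_def by (blast intro: stestD(5))
qed

lemma pertD:
  assumes "pert_ok \<sigma> T R a a' f f'"
  shows "t \<in> {0<..<T} \<Longrightarrow> - \<sigma> \<le> a t" "t \<in> {0<..<T} \<Longrightarrow> a t \<le> \<sigma>" "- \<sigma> \<le> f x" "norm x \<le> R \<Longrightarrow> f x \<le> \<sigma>"
proof -
  have a: "\<bar>a t\<bar> \<le> \<sigma>" if "t \<in> {0<..<T}" for t using assms that by (auto simp: pert_ok_def)
  show "t \<in> {0<..<T} \<Longrightarrow> - \<sigma> \<le> a t" "t \<in> {0<..<T} \<Longrightarrow> a t \<le> \<sigma>" using a[of t] by linarith+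
  show "- \<sigma> \<le> f x" "norm x \<le> R \<Longrightarrow> f x \<le> \<sigma>" using assms by (auto simp: pert_ok_def)
qed

end

context equation begin

text \<open>A first perturbation makes the maximum of the limit functional \<open>\<Psi>\<close> strict. A second, vanishing one yields
  exact maximum points of the functionals \<open>\<Psi>\<^sub>m\<close> with the regularised form; these are maximising for \<open>\<Psi>\<close>. The
  radial terms turn their weak convergence into strong convergence.\<close>

lemma doubling_limit:
  fixes u w :: "real \<Rightarrow> 'a \<Rightarrow> real" and T \<eta> L1 L2 L e \<delta>1 \<delta>2 \<gamma> \<mu> lam \<sigma> Cb al bt R \<kappa> t0 s0 :: real and x0 y0 :: 'a
  assumes sub: "approx_sub T \<eta> L1 L2 u" and super: "approx_super T \<eta> L1 L2 w"
    and L1: "L * b + 2 \<le> L1" and L2: "L * \<beta> / e + 2 \<le> L2" and L: "0 \<le> L" and e: "0 < e"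
    and \<delta>: "0 < \<delta>1" "\<delta>1 \<le> 1" "0 < \<delta>2" "\<delta>2 \<le> 1" and \<gamma>: "0 < \<gamma>" and \<mu>: "0 \<le> \<mu>" and lam: "0 \<le> lam"
    and \<sigma>: "0 < \<sigma>" "\<sigma> \<le> 1"
    and bound: "\<And>t x. t \<in> {0<..<T} \<Longrightarrow> u t x \<le> Cb \<and> - Cb \<le> w t x"
    and ab: "0 < al" "bt < T"
  defines "\<Psi> \<equiv> \<lambda>t x s y. u t x - w s y - (Th e L x y + ((t - s)\<^sup>2 / \<gamma> + lam * (T - t) + \<mu> / t + \<mu> / s)) - \<delta>1 * h0 (norm x) - \<delta>2 * h0 (norm y)"
    and "\<Psi>m \<equiv> \<lambda>m t x s y. u t x - w s y - (root_fn (We e m) (L * e) y x + ((t - s)\<^sup>2 / \<gamma> + lam * (T - t) + \<mu> / t + \<mu> / s)) - \<delta>1 * h0 (norm x) - \<delta>2 * h0 (norm y)"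
    and "S \<equiv> {al..bt} \<times> cball 0 R \<times> {al..bt} \<times> cball (0::'a) R"
    and "K \<equiv> (L1 + 1) * M + 1"
  assumes out: "\<And>m t x s y. m0 \<le> m \<Longrightarrow> t \<in> {0<..<T} \<Longrightarrow> s \<in> {0<..<T} \<Longrightarrow> (t, x, s, y) \<notin> S \<Longrightarrow> \<Psi>m m t x s y \<le> \<kappa>"
    and z0: "(t0, x0, s0, y0) \<in> S" "\<kappa> + 16 * \<sigma> < \<Psi> t0 x0 s0 y0"
  shows "\<exists>th xh sh yh. (th, xh, sh, yh) \<in> S \<and> (\<forall>t x s y. (t, x, s, y) \<in> S \<longrightarrow> \<Psi> t x s y - 4 * \<sigma> \<le> \<Psi> th xh sh yh) \<and>
    lam \<le> 2 * \<eta> + (c0 + (1 + K * Iw K) * b * M) * L * nm (xh - yh) + (M * (1 + b) + K * Iw K * M) * (\<delta>1 + \<delta>2)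
      + 2 * \<sigma> * (2 + 2 * R + 2 * M * (1 + b * R) + 2 * (K * Iw K * M))"
proof -
  have mem: "t \<in> {0<..<T}" "s \<in> {0<..<T}" "norm x \<le> R" "norm y \<le> R" if "(t, x, s, y) \<in> S" for t x s y
    using that ab by (auto simp: S_def)
  have R: "0 \<le> R" using mem(3)[OF z0(1)] norm_ge_zero order.trans by blast
  define Tc where "Tc t s = (t - s)\<^sup>2 / \<gamma> + lam * (T - t) + \<mu> / t + \<mu> / s" for t s
  have Tc_nonneg: "0 \<le> Tc t s" if "t \<in> {0<..<T}" "s \<in> {0<..<T}" for t s
    using that \<gamma> \<mu> lam by (auto simp: Tc_def intro!: add_nonneg_nonneg)
  have \<Psi>: "\<Psi> t x s y = u t x - w s y - (Th e L x y + Tc t s) - \<delta>1 * h0 (norm x) - \<delta>2 * h0 (norm y)" for t x s y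
    by (simp add: \<Psi>_def Tc_def)
  have \<Psi>m: "\<Psi>m m t x s y = u t x - w s y - (root_fn (We e m) (L * e) y x + Tc t s) - \<delta>1 * h0 (norm x) - \<delta>2 * h0 (norm y)" for m t x s y
    by (simp add: \<Psi>m_def Tc_def)
  have Tc_lim: "(\<lambda>k. Tc (\<tau> k) (\<tau>' k)) \<longlonglongrightarrow> Tc t s"
    if "\<tau> \<longlonglongrightarrow> t" "\<tau>' \<longlonglongrightarrow> s" "t \<in> {0<..<T}" "s \<in> {0<..<T}" for \<tau> \<tau>' t s
    unfolding Tc_def using that \<gamma> by (intro tendsto_intros) auto
  have Le: "0 \<le> L * e" using L e by simp
  have cost_nonneg: "0 \<le> \<delta>1 * h0 (norm x)" "0 \<le> \<delta>2 * h0 (norm y)" for x y :: 'a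
    using \<delta> by (auto intro: mult_nonneg_nonneg h0_nonneg)
  have Th_nonneg: "0 \<le> Th e L x y" for x y using Th_ge[OF e L, of x y] L nm_nonneg[of "x - y"]
    by (meson mult_nonneg_nonneg order.trans)
  have usc_u: "B_usc_on B ({0<..<T} \<times> UNIV) u" and lsc_w: "B_lsc_on B ({0<..<T} \<times> UNIV) w"
    using sub super by (auto simp: approx_sub_def approx_super_def)
  have usc: "\<forall>\<^sub>F k in sequentially. u (\<tau> k) (X k) - w (\<tau>' k) (Y k) - Q k - d1 * h0 (norm (X k)) - d2 * h0 (norm (Y k))
      \<le> u t x - w s y - q - d1 * h0 (norm x) - d2 * h0 (norm y) + \<epsilon>"
    if "\<And>k. (\<tau> k, X k, \<tau>' k, Y k) \<in> S" "(t, x, s, y) \<in> S" "\<tau> \<longlonglongrightarrow> t"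
      "(\<lambda>k. B (X k)) \<longlonglongrightarrow> B x" "\<tau>' \<longlonglongrightarrow> s" "(\<lambda>k. B (Y k)) \<longlonglongrightarrow> B y" "Q \<longlonglongrightarrow> q" "0 \<le> d1" "d1 \<le> 1" "0 \<le> d2" "d2 \<le> 1" "0 < \<epsilon>"
    for \<tau> X \<tau>' Y t x s y Q q \<epsilon> d1 d2
    using usc_functional[OF usc_u lsc_w mem(1)[OF that(1)] mem(2)[OF that(1)] mem(1,2)[OF that(2)]
        mem(3)[OF that(1)] mem(4)[OF that(1)] that(3-12)] .
  have "\<exists>a1 a1' f1 f1' a2 a2' f2 f2' th xh sh yh c. pert_ok \<sigma> T R a1 a1' f1 f1' \<and> pert_ok \<sigma> T R a2 a2' f2 f2' \<and>
    (th, xh, sh, yh) \<in> S \<and> a1 th = 0 \<and> f1 xh = 0 \<and> a2 sh = 0 \<and> f2 yh = 0 \<and> 0 < c \<and>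
    (\<forall>t x s y. (t, x, s, y) \<in> S \<longrightarrow> \<Psi> t x s y - (a1 t + f1 x + a2 s + f2 y)
      + c * ((t - th)\<^sup>2 + (norm (B (x - xh)))\<^sup>2 + (s - sh)\<^sup>2 + (norm (B (y - yh)))\<^sup>2) \<le> \<Psi> th xh sh yh)"
  proof (rule admissible_perturbation[OF z0(1)[unfolded S_def] ab _ _ \<sigma>(1), folded S_def])
    fix t x s y assume z: "(t, x, s, y) \<in> S"
    show "\<Psi> t x s y \<le> Cb + Cb"
      unfolding \<Psi> using bound[OF mem(1)[OF z], of x] bound[OF mem(2)[OF z], of y] Th_nonneg[of x y]
        Tc_nonneg[OF mem(1,2)[OF z]] cost_nonneg(1)[of x] cost_nonneg(2)[of y] by linarith
  next
    fix \<tau> X \<tau>' Y t x s y \<epsilon>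
    assume zs: "\<And>k. (\<tau> k, X k, \<tau>' k, Y k) \<in> S" and z: "(t, x, s, y) \<in> S" and c: "\<tau> \<longlonglongrightarrow> t"
      "(\<lambda>k. B (X k)) \<longlonglongrightarrow> B x" "\<tau>' \<longlonglongrightarrow> s" "(\<lambda>k. B (Y k)) \<longlonglongrightarrow> B y" and \<epsilon>: "(0::real) < \<epsilon>"
    have "(\<lambda>k. Th e L (X k) (Y k) + Tc (\<tau> k) (\<tau>' k)) \<longlonglongrightarrow> Th e L x y + Tc t s"
      by (intro tendsto_add Th_tendsto[OF mem(3)[OF zs] mem(4)[OF zs] c(2,4) e] Tc_lim[OF c(1,3) mem(1,2)[OF z]])
    from usc[OF zs z c this _ _ _ _ \<epsilon>, of \<delta>1 \<delta>2] \<delta>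
    show "\<forall>\<^sub>F k in sequentially. \<Psi> (\<tau> k) (X k) (\<tau>' k) (Y k) \<le> \<Psi> t x s y + \<epsilon>" by (simp add: \<Psi>)
  qed
  then obtain a1 a1' f1 f1' a2 a2' f2 f2' th xh sh yh c where p1: "pert_ok \<sigma> T R a1 a1' f1 f1'" and p2: "pert_ok \<sigma> T R a2 a2' f2 f2'"
    and zh: "(th, xh, sh, yh) \<in> S" and p0: "a1 th = 0" "f1 xh = 0" "a2 sh = 0" "f2 yh = 0" and c: "0 < c"
    and max1: "\<And>t x s y. (t, x, s, y) \<in> S \<Longrightarrow> \<Psi> t x s y - (a1 t + f1 x + a2 s + f2 y)
      + c * ((t - th)\<^sup>2 + (norm (B (x - xh)))\<^sup>2 + (s - sh)\<^sup>2 + (norm (B (y - yh)))\<^sup>2) \<le> \<Psi> th xh sh yh"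
    by blast
  define pt where "pt t x s y = a1 t + f1 x + a2 s + f2 y" for t x s y
  have pt_ge: "- (4 * \<sigma>) \<le> pt t x s y" if "t \<in> {0<..<T}" "s \<in> {0<..<T}" for t x s y
    unfolding pt_def using pertD(1)[OF p1 that(1)] pertD(3)[OF p1, of x] pertD(1)[OF p2 that(2)] pertD(3)[OF p2, of y] by linarith
  have pt_le: "pt t x s y \<le> 4 * \<sigma>" if "(t, x, s, y) \<in> S" for t x s y
    unfolding pt_def using pertD(2)[OF p1 mem(1)[OF that]] pertD(4)[OF p1 mem(3)[OF that]]
      pertD(2)[OF p2 mem(2)[OF that]] pertD(4)[OF p2 mem(4)[OF that]] by linarith
  have near: "\<Psi> t x s y - 4 * \<sigma> \<le> \<Psi> th xh sh yh" if "(t, x, s, y) \<in> S" for t x s y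
  proof -
    have "0 \<le> c * ((t - th)\<^sup>2 + (norm (B (x - xh)))\<^sup>2 + (s - sh)\<^sup>2 + (norm (B (y - yh)))\<^sup>2)" using c by simp
    then show ?thesis using max1[OF that] pt_le[OF that] unfolding pt_def by linarith
  qed
  define Cs where "Cs = 2 + 2 * R + 2 * M * (1 + b * R) + 2 * (K * Iw K * M)"
  have K: "0 < K"
  proof -
    have "0 \<le> L * b" using L b_pos by simp
    then have "0 \<le> (L1 + 1) * M" using L1 M by (intro mult_nonneg_nonneg) auto
    then show ?thesis by (simp add: K_def)
  qed
  have Cs: "0 \<le> Cs" using R M b_pos K Iw_nonneg[of K] by (auto simp: Cs_def intro!: add_nonneg_nonneg mult_nonneg_nonneg)
  define bdd where "bdd m x y = 2 * \<eta> - (x - y) \<bullet> adj_op D A (root_grad (We e m) (L * e) y x)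
    + (1 + K * Iw K) * (L * b) * M * nm (x - y) + (M * (1 + b) + K * Iw K * M) * (\<delta>1 + \<delta>2) + 2 * \<sigma> * Cs" for m x y
  have stage2: "\<exists>t x s y. (t, x, s, y) \<in> S \<and> lam \<le> bdd m x y \<and>
      \<Psi> th xh sh yh - 4 * \<sigma> / (real m + 1) \<le> \<Psi>m m t x s y - pt t x s y" if m: "m0 \<le> m" for m
  proof -
    define \<sigma>' where "\<sigma>' = \<sigma> / (real m + 1)"
    have \<sigma>': "0 < \<sigma>'" "\<sigma>' \<le> \<sigma>" using \<sigma> by (auto simp: \<sigma>'_def field_simps)
    define \<Psi>2 where "\<Psi>2 t x s y = \<Psi>m m t x s y - pt t x s y" for t x s y
    have "\<exists>b1 b1' g1 g1' b2 b2' g2 g2' t' x' s' y' c. pert_ok \<sigma>' T R b1 b1' g1 g1' \<and> pert_ok \<sigma>' T R b2 b2' g2 g2' \<and>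
      (t', x', s', y') \<in> S \<and> b1 t' = 0 \<and> g1 x' = 0 \<and> b2 s' = 0 \<and> g2 y' = 0 \<and> 0 < c \<and>
      (\<forall>t x s y. (t, x, s, y) \<in> S \<longrightarrow> \<Psi>2 t x s y - (b1 t + g1 x + b2 s + g2 y)
        + c * ((t - t')\<^sup>2 + (norm (B (x - x')))\<^sup>2 + (s - s')\<^sup>2 + (norm (B (y - y')))\<^sup>2) \<le> \<Psi>2 t' x' s' y')"
    proof (rule admissible_perturbation[OF z0(1)[unfolded S_def] ab _ _ \<sigma>'(1), folded S_def])
      fix t x s y assume z: "(t, x, s, y) \<in> S"
      show "\<Psi>2 t x s y \<le> Cb + Cb + 4 * \<sigma>"
        unfolding \<Psi>2_def \<Psi>m using bound[OF mem(1)[OF z], of x] bound[OF mem(2)[OF z], of y] root_We_nonneg[OF psd_We Le, of e m y x]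
          Tc_nonneg[OF mem(1,2)[OF z]] cost_nonneg(1)[of x] cost_nonneg(2)[of y] pt_ge[OF mem(1,2)[OF z], of x y] by linarith
    next
      fix \<tau> X \<tau>' Y t x s y \<epsilon>
      assume zs: "\<And>k. (\<tau> k, X k, \<tau>' k, Y k) \<in> S" and z: "(t, x, s, y) \<in> S" and c: "\<tau> \<longlonglongrightarrow> t"
        "(\<lambda>k. B (X k)) \<longlonglongrightarrow> B x" "\<tau>' \<longlonglongrightarrow> s" "(\<lambda>k. B (Y k)) \<longlonglongrightarrow> B y" and \<epsilon>: "(0::real) < \<epsilon>"
      have "(\<lambda>k. (root_fn (We e m) (L * e) (Y k) (X k) + Tc (\<tau> k) (\<tau>' k)) + pt (\<tau> k) (X k) (\<tau>' k) (Y k))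
          \<longlonglongrightarrow> (root_fn (We e m) (L * e) y x + Tc t s) + pt t x s y"
        unfolding pt_def
        by (intro tendsto_add root_tendsto[OF psd_We Le c(2,4)] Tc_lim[OF c(1,3) mem(1,2)[OF z]]
            pert_tendsto[OF p1 mem(1)[OF z] c(1,2)] pert_tendsto[OF p2 mem(2)[OF z] c(3,4)])
      from usc[OF zs z c this _ _ _ _ \<epsilon>, of \<delta>1 \<delta>2] \<delta>
      show "\<forall>\<^sub>F k in sequentially. \<Psi>2 (\<tau> k) (X k) (\<tau>' k) (Y k) \<le> \<Psi>2 t x s y + \<epsilon>"
        by (simp add: \<Psi>2_def \<Psi>m algebra_simps)
    qed
    then obtain b1 b1' g1 g1' b2 b2' g2 g2' t' x' s' y' c' where q1: "pert_ok \<sigma>' T R b1 b1' g1 g1'" and q2: "pert_ok \<sigma>' T R b2 b2' g2 g2'"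
      and z': "(t', x', s', y') \<in> S" and q0: "b1 t' = 0" "g1 x' = 0" "b2 s' = 0" "g2 y' = 0" and c': "0 < c'"
      and max2: "\<And>t x s y. (t, x, s, y) \<in> S \<Longrightarrow> \<Psi>2 t x s y - (b1 t + g1 x + b2 s + g2 y)
        + c' * ((t - t')\<^sup>2 + (norm (B (x - x')))\<^sup>2 + (s - s')\<^sup>2 + (norm (B (y - y')))\<^sup>2) \<le> \<Psi>2 t' x' s' y'"
      by blast
    define qt where "qt t x s y = b1 t + g1 x + b2 s + g2 y" for t x s y
    have qt_ge: "- (4 * \<sigma>) \<le> qt t x s y" if "t \<in> {0<..<T}" "s \<in> {0<..<T}" for t x s y
      unfolding qt_def using pertD(1)[OF q1 that(1)] pertD(3)[OF q1, of x] pertD(1)[OF q2 that(2)] pertD(3)[OF q2, of y] \<sigma>'(2) by linarith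
    have qt_le: "qt t x s y \<le> 4 * \<sigma>'" if "(t, x, s, y) \<in> S" for t x s y
      unfolding qt_def using pertD(2)[OF q1 mem(1)[OF that]] pertD(4)[OF q1 mem(3)[OF that]]
        pertD(2)[OF q2 mem(2)[OF that]] pertD(4)[OF q2 mem(4)[OF that]] by linarith
    have max2': "\<Psi>2 t x s y - qt t x s y \<le> \<Psi>2 t' x' s' y'" if "(t, x, s, y) \<in> S" for t x s y
    proof -
      have "0 \<le> c' * ((t - t')\<^sup>2 + (norm (B (x - x')))\<^sup>2 + (s - s')\<^sup>2 + (norm (B (y - y')))\<^sup>2)" using c' by simp
      then show ?thesis using max2[OF that] unfolding qt_def by linarith
    qed
    have \<Psi>_le: "\<Psi> t x s y \<le> \<Psi>m m t x s y" for t x s y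
      unfolding \<Psi> \<Psi>m using root_We_le_Th[OF e L, of m y x] by simp
    \<comment> \<open>The margin \<open>16 * \<sigma>\<close> is spent here: the two perturbations
      raise values outside \<open>S\<close> by at most \<open>8 * \<sigma>\<close> and lower the
      value at \<open>(t0, x0, s0, y0)\<close> by at most as much, so the maximum over
      \<open>S\<close> is global.\<close>
    have glob: "\<Psi>2 t x s y - qt t x s y \<le> \<Psi>2 t' x' s' y' - qt t' x' s' y'"
      if ts: "t \<in> {0<..<T}" "s \<in> {0<..<T}" for t x s y
    proof (cases "(t, x, s, y) \<in> S")
      case True
      then show ?thesis using max2'[OF True] by (simp add: qt_def q0)
    next
      case False
      have "\<Psi>2 t x s y - qt t x s y \<le> \<kappa> + 8 * \<sigma>"
        unfolding \<Psi>2_def using out[OF m ts False] pt_ge[OF ts, of x y] qt_ge[OF ts, of x y] by linarith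
      also have "\<dots> \<le> \<Psi> t0 x0 s0 y0 - 8 * \<sigma>" using z0(2) by linarith
      also have "\<dots> \<le> \<Psi>2 t0 x0 s0 y0 - qt t0 x0 s0 y0"
        unfolding \<Psi>2_def using \<Psi>_le[of t0 x0 s0 y0] pt_le[OF z0(1)] qt_le[OF z0(1)] \<sigma>' by linarith
      also have "\<dots> \<le> \<Psi>2 t' x' s' y'" by (rule max2'[OF z0(1)])
      finally show ?thesis by (simp add: qt_def q0)
    qed
    note P1 = pert_ok_add[OF p1 q1] and P2 = pert_ok_add[OF p2 q2]
    \<comment> \<open>In the gradient bound \<open>e\<close> cancels, in the second-order bound it
      does not; this is why \<open>L2\<close> has to depend on \<open>e\<close>.\<close>
    have kd: "L * e * (b / e) = L * b" "L * e * (b / e)\<^sup>2 = L * \<beta> / e"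
      using e b_pos(2) by (simp_all add: power_divide power2_eq_square)
    have "lam \<le> 2 * \<eta> - (x' - y') \<bullet> adj_op D A (root_grad (We e m) (L * e) y' x')
      + (1 + K * Iw K) * (L * e * (b / e)) * M * nm (x' - y') + (M * (1 + b) + K * Iw K * M) * (\<delta>1 + \<delta>2)
      + (\<sigma> + \<sigma>') * (2 + 2 * R + 2 * M * (1 + b * R) + 2 * (K * Iw K * M))"
      unfolding K_def
    proof (rule doubling_inequality[OF sub super psd_We _ Le We_form_le[OF e] _ _ P1 P2 _ _ _ _ \<gamma> \<mu> mem[OF z']])
      show "0 \<le> b / e" using b_pos e by simp
      show "L * e * (b / e) + (\<sigma> + \<sigma>') \<le> L1" "L * e * (b / e)\<^sup>2 + (\<sigma> + \<sigma>') \<le> L2"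
        unfolding kd using L1 L2 \<sigma> \<sigma>' by linarith+
    next
      fix t s :: real and x y :: 'a
      assume ts: "t \<in> {0<..<T}" "s \<in> {0<..<T}"
      show "u t x - w s y - root_fn (We e m) (L * e) y x - ((t - s)\<^sup>2 / \<gamma> + lam * (T - t) + \<mu> / t + \<mu> / s)
        - \<delta>1 * h0 (norm x) - \<delta>2 * h0 (norm y) - (a1 t + b1 t + (f1 x + g1 x) + (a2 s + b2 s) + (f2 y + g2 y))
        \<le> u t' x' - w s' y' - root_fn (We e m) (L * e) y' x' - ((t' - s')\<^sup>2 / \<gamma> + lam * (T - t') + \<mu> / t' + \<mu> / s')
        - \<delta>1 * h0 (norm x') - \<delta>2 * h0 (norm y') - (a1 t' + b1 t' + (f1 x' + g1 x') + (a2 s' + b2 s') + (f2 y' + g2 y'))"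
        using glob[OF ts, of x y] unfolding \<Psi>2_def \<Psi>m_def pt_def qt_def by linarith
    qed (use \<delta> in auto)
    moreover have "(\<sigma> + \<sigma>') * Cs \<le> 2 * \<sigma> * Cs" using Cs \<sigma>' by (intro mult_right_mono) auto
    ultimately have "lam \<le> bdd m x' y'" unfolding bdd_def kd Cs_def[symmetric] by linarith
    moreover have "\<Psi> th xh sh yh - 4 * \<sigma> / (real m + 1) \<le> \<Psi>m m t' x' s' y' - pt t' x' s' y'"
    proof -
      have "pt th xh sh yh = 0" by (simp add: pt_def p0)
      moreover have "4 * \<sigma> / (real m + 1) = 4 * \<sigma>'" by (simp add: \<sigma>'_def)
      ultimately show ?thesis
        using max2'[OF zh] \<Psi>_le[of th xh sh yh] qt_le[OF zh] unfolding \<Psi>2_def by linarith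
    qed
    ultimately show ?thesis using z' by blast
  qed
  define good where "good k z \<longleftrightarrow> (case z of (t, x, s, y) \<Rightarrow> (t, x, s, y) \<in> S \<and> lam \<le> bdd (m0 + k) x y \<and>
      \<Psi> th xh sh yh - 4 * \<sigma> / (real (m0 + k) + 1) \<le> \<Psi>m (m0 + k) t x s y - pt t x s y)" for k z
  have "\<exists>z. good k z" for k
    using stage2[of "m0 + k"] unfolding good_def by (simp add: split_paired_Ex)
  then have "\<forall>k. \<exists>z. good k z" by blast
  from choice[OF this] obtain Z where Z: "\<And>k. good k (Z k)" by blast
  define \<tau> X \<tau>' Y where "\<tau> k = fst (Z k)" and "X k = fst (snd (Z k))"
    and "\<tau>' k = fst (snd (snd (Z k)))" and "Y k = snd (snd (snd (Z k)))" for k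
  have zs: "(\<tau> k, X k, \<tau>' k, Y k) \<in> S" and lam_le: "lam \<le> bdd (m0 + k) (X k) (Y k)"
    and val: "\<Psi> th xh sh yh - 4 * \<sigma> / (real (m0 + k) + 1) \<le> \<Psi>m (m0 + k) (\<tau> k) (X k) (\<tau>' k) (Y k) - pt (\<tau> k) (X k) (\<tau>' k) (Y k)" for k
    using Z[of k] unfolding good_def \<tau>_def X_def \<tau>'_def Y_def case_prod_beta' by simp_all
  define E where "E = 4 * \<sigma> + L / e * \<beta> * (2 * R)\<^sup>2"
  \<comment> \<open>On the ball, replacing the regularised form by its limit costs order
    \<open>1 / m\<close>; the second perturbation is of the same order, and \<open>E\<close>
    collects both.\<close>
  have low: "\<Psi> th xh sh yh - E / (real k + 1) \<le> \<Psi> (\<tau> k) (X k) (\<tau>' k) (Y k) - pt (\<tau> k) (X k) (\<tau>' k) (Y k)" for k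
  proof -
    have "norm (X k - Y k) \<le> 2 * R" using norm_triangle_ineq4[of "X k" "Y k"] mem(3,4)[OF zs[of k]] by linarith
    then have "(norm (X k - Y k))\<^sup>2 \<le> (2 * R)\<^sup>2" by (intro power_mono) auto
    then have "L / e * (\<beta> / (real (m0 + k) + 1)) * (norm (X k - Y k))\<^sup>2 \<le> L / e * (\<beta> / (real (m0 + k) + 1)) * (2 * R)\<^sup>2"
      using L e \<beta>_pos by (intro mult_left_mono) auto
    then have "\<Psi>m (m0 + k) (\<tau> k) (X k) (\<tau>' k) (Y k) \<le> \<Psi> (\<tau> k) (X k) (\<tau>' k) (Y k) + L / e * (\<beta> / (real (m0 + k) + 1)) * (2 * R)\<^sup>2"
      unfolding \<Psi> \<Psi>m using Th_le_root_We[OF e L, of "X k" "Y k" "m0 + k"] by linarith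
    moreover have "4 * \<sigma> / (real (m0 + k) + 1) + L / e * (\<beta> / (real (m0 + k) + 1)) * (2 * R)\<^sup>2 = E / (real (m0 + k) + 1)"
      by (simp add: E_def add_divide_distrib)
    moreover have "E / (real (m0 + k) + 1) \<le> E / (real k + 1)"
      using \<sigma> L e \<beta>_pos by (intro divide_left_mono) (auto simp: E_def)
    ultimately show ?thesis using val[of k] by linarith
  qed
  \<comment> \<open>Strictness at work: the distance of the value from the maximum controls
    \<open>c\<close> times the squared distances.\<close>
  have near_sq: "(\<tau> k - th)\<^sup>2 + (norm (B (X k - xh)))\<^sup>2 + (\<tau>' k - sh)\<^sup>2 + (norm (B (Y k - yh)))\<^sup>2 \<le> (E / c) / (real k + 1)" for k
  proof -
    have "c * ((\<tau> k - th)\<^sup>2 + (norm (B (X k - xh)))\<^sup>2 + (\<tau>' k - sh)\<^sup>2 + (norm (B (Y k - yh)))\<^sup>2) \<le> E / (real k + 1)"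
      using max1[OF zs[of k]] low[of k] unfolding pt_def by linarith
    then have "(\<tau> k - th)\<^sup>2 + (norm (B (X k - xh)))\<^sup>2 + (\<tau>' k - sh)\<^sup>2 + (norm (B (Y k - yh)))\<^sup>2 \<le> E / (real k + 1) / c"
      unfolding pos_le_divide_eq[OF c] by (simp only: mult.commute[of _ c])
    also have "\<dots> = E / c / (real k + 1)" by (simp add: divide_divide_eq_left mult.commute)
    finally show ?thesis .
  qed
  have comp: "(\<tau> k - th)\<^sup>2 \<le> (E / c) / (real k + 1)" "(norm (B (X k - xh)))\<^sup>2 \<le> (E / c) / (real k + 1)"
    "(\<tau>' k - sh)\<^sup>2 \<le> (E / c) / (real k + 1)" "(norm (B (Y k - yh)))\<^sup>2 \<le> (E / c) / (real k + 1)" for k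
    using near_sq[of k] zero_le_power2[of "\<tau> k - th"] zero_le_power2[of "\<tau>' k - sh"]
      zero_le_power2[of "norm (B (X k - xh))"] zero_le_power2[of "norm (B (Y k - yh))"] by linarith+
  have c1: "\<tau> \<longlonglongrightarrow> th" by (rule LIM_zero_cancel[OF square_le_inverse_tendsto_zero[OF comp(1)]])
  have c3: "\<tau>' \<longlonglongrightarrow> sh" by (rule LIM_zero_cancel[OF square_le_inverse_tendsto_zero[OF comp(3)]])
  have c2: "(\<lambda>k. B (X k)) \<longlonglongrightarrow> B xh"
    using tendsto_norm_zero_cancel[OF square_le_inverse_tendsto_zero[OF comp(2)]]
    unfolding blinfun.diff_right by (rule LIM_zero_cancel)
  have c4: "(\<lambda>k. B (Y k)) \<longlonglongrightarrow> B yh"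
    using tendsto_norm_zero_cancel[OF square_le_inverse_tendsto_zero[OF comp(4)]]
    unfolding blinfun.diff_right by (rule LIM_zero_cancel)
  have Elim: "\<forall>\<^sub>F k in sequentially. E / (real k + 1) < \<epsilon>" if "0 < \<epsilon>" for \<epsilon>
  proof -
    have "(\<lambda>k. E * (1 / real (Suc k))) \<longlonglongrightarrow> E * 0" by (intro tendsto_intros LIMSEQ_Suc lim_1_over_n)
    then have "(\<lambda>k. E / (real k + 1)) \<longlonglongrightarrow> 0" by (simp add: add.commute)
    then show ?thesis using that by (rule order_tendstoD(2))
  qed
  have Qlim: "(\<lambda>k. (Th e L (X k) (Y k) + Tc (\<tau> k) (\<tau>' k)) + pt (\<tau> k) (X k) (\<tau>' k) (Y k))
      \<longlonglongrightarrow> (Th e L xh yh + Tc th sh) + pt th xh sh yh"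
    unfolding pt_def
    by (intro tendsto_add Th_tendsto[OF mem(3)[OF zs] mem(4)[OF zs] c2 c4 e] Tc_lim[OF c1 c3 mem(1,2)[OF zh]]
        pert_tendsto[OF p1 mem(1)[OF zh] c1 c2] pert_tendsto[OF p2 mem(2)[OF zh] c3 c4])
  have pt0: "pt th xh sh yh = 0" by (simp add: pt_def p0)
  \<comment> \<open>The semicontinuity estimate is used without the radial term of \<open>x\<close>,
    the lower bound \<open>low\<close> with it. Their comparison bounds
    \<open>h0 (norm (X k))\<close> from above, which is what weak convergence lacks.\<close>
  have X_lim: "X \<longlonglongrightarrow> xh"
  proof (rule strong_limit[OF weakly_toI[OF mem(3)[OF zs] c2] h0_norm_bound])
    fix \<epsilon> :: real assume \<epsilon>: "0 < \<epsilon>"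
    then have d: "0 < \<delta>1 * \<epsilon> / 2" using \<delta> by simp
    show "\<forall>\<^sub>F k in sequentially. h0 (norm (X k)) \<le> h0 (norm xh) + \<epsilon>"
    proof -
      have "\<forall>\<^sub>F k in sequentially. u (\<tau> k) (X k) - w (\<tau>' k) (Y k) - (Th e L (X k) (Y k) + Tc (\<tau> k) (\<tau>' k) + pt (\<tau> k) (X k) (\<tau>' k) (Y k)) - 0 * h0 (norm (X k)) - \<delta>2 * h0 (norm (Y k))
          \<le> u th xh - w sh yh - (Th e L xh yh + Tc th sh + pt th xh sh yh) - 0 * h0 (norm xh) - \<delta>2 * h0 (norm yh) + \<delta>1 * \<epsilon> / 2"
        using \<delta> by (intro usc[OF zs zh c1 c2 c3 c4 Qlim _ _ _ _ d]) auto
      then show ?thesis using Elim[OF d]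
      proof eventually_elim
        case (elim k)
        then have "\<delta>1 * h0 (norm (X k)) \<le> \<delta>1 * h0 (norm xh) + \<delta>1 * \<epsilon>"
          using low[of k] unfolding \<Psi> pt0 by linarith
        then show ?case
          using \<delta>(1) by (simp flip: distrib_left)
      qed
    qed
  qed
  have Y_lim: "Y \<longlonglongrightarrow> yh"
  proof (rule strong_limit[OF weakly_toI[OF mem(4)[OF zs] c4] h0_norm_bound])
    fix \<epsilon> :: real assume \<epsilon>: "0 < \<epsilon>"
    then have d: "0 < \<delta>2 * \<epsilon> / 2" using \<delta> by simp
    show "\<forall>\<^sub>F k in sequentially. h0 (norm (Y k)) \<le> h0 (norm yh) + \<epsilon>"
    proof -
      have "\<forall>\<^sub>F k in sequentially. u (\<tau> k) (X k) - w (\<tau>' k) (Y k) - (Th e L (X k) (Y k) + Tc (\<tau> k) (\<tau>' k) + pt (\<tau> k) (X k) (\<tau>' k) (Y k)) - \<delta>1 * h0 (norm (X k)) - 0 * h0 (norm (Y k))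
          \<le> u th xh - w sh yh - (Th e L xh yh + Tc th sh + pt th xh sh yh) - \<delta>1 * h0 (norm xh) - 0 * h0 (norm yh) + \<delta>2 * \<epsilon> / 2"
        using \<delta> by (intro usc[OF zs zh c1 c2 c3 c4 Qlim _ _ _ _ d]) auto
      then show ?thesis using Elim[OF d]
      proof eventually_elim
        case (elim k)
        then have "\<delta>2 * h0 (norm (Y k)) \<le> \<delta>2 * h0 (norm yh) + \<delta>2 * \<epsilon>"
          using low[of k] unfolding \<Psi> pt0 by linarith
        then show ?case
          using \<delta>(3) by (simp flip: distrib_left)
      qed
    qed
  qed
  define z where "z = xh - yh"
  define zk where "zk k = X k - Y k" for k
  have zk: "zk \<longlonglongrightarrow> z" unfolding zk_def z_def by (intro tendsto_diff X_lim Y_lim)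
  have Bzk: "(\<lambda>k. B (zk k)) \<longlonglongrightarrow> B z" by (rule bounded_linear.tendsto[OF blinfun.bounded_linear_right zk])
  \<comment> \<open>\<open>Cp m\<close> tends to 0 only pointwise. Since the powers are
    nonexpansive, strong convergence of \<open>zk\<close> allows the argument to move along with
    \<open>m\<close>.\<close>
  have Cz: "(\<lambda>k. Cp (m0 + k) (zk k)) \<longlonglongrightarrow> 0"
  proof -
    have "(\<lambda>k. Cp (m0 + k) (zk k - z)) \<longlonglongrightarrow> 0"
    proof (rule Lim_null_comparison)
      show "\<forall>\<^sub>F k in sequentially. norm (Cp (m0 + k) (zk k - z)) \<le> norm (zk k - z)" by (simp add: Cp_norm_le)
      show "(\<lambda>k. norm (zk k - z)) \<longlonglongrightarrow> 0" using zk by (intro tendsto_norm_zero LIM_zero)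
    qed
    moreover have "(\<lambda>k. Cp (m0 + k) z) \<longlonglongrightarrow> 0"
      using LIMSEQ_ignore_initial_segment[OF Cp_tendsto_zero[of z], of m0] by (simp add: add.commute)
    ultimately have "(\<lambda>k. Cp (m0 + k) (zk k - z) + Cp (m0 + k) z) \<longlonglongrightarrow> 0 + 0" by (rule tendsto_add)
    then show ?thesis by (simp add: blinfun.diff_right)
  qed
  \<comment> \<open>\<open>J\<^sub>m\<close> acts as an approximate identity: \<open>v k\<close>
    tends strongly to \<open>z / e\<^sup>2\<close>, so the bounded operator \<open>AB\<close> passes
    to the limit.\<close>
  define v where "v k = (1 / e\<^sup>2) *\<^sub>R (zk k - Cp (m0 + k) (zk k))" for k
  have v: "v \<longlonglongrightarrow> (1 / e\<^sup>2) *\<^sub>R z"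
    unfolding v_def using tendsto_scaleR[OF tendsto_const tendsto_diff[OF zk Cz]] by simp
  have We_v: "We e (m0 + k) (B (zk k)) = v k" for k by (simp add: We_B v_def)
  define s0 where "s0 = sqrt (1 + (nm z)\<^sup>2 / e\<^sup>2)"
  have s0: "0 < s0" by (simp add: s0_def add_pos_nonneg)
  have es0: "nm z \<le> e * s0"
    using Th_ge[OF e, of 1 xh yh] by (simp add: Th_def z_def s0_def)
  have vB: "(\<lambda>k. v k \<bullet> B (zk k)) \<longlonglongrightarrow> (nm z)\<^sup>2 / e\<^sup>2"
    using tendsto_inner[OF v Bzk] by (simp add: nm_sq inner_commute)
  have sq: "(\<lambda>k. sqrt (1 + v k \<bullet> B (zk k))) \<longlonglongrightarrow> s0"
    unfolding s0_def by (intro tendsto_real_sqrt tendsto_add tendsto_const vB)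
  have ABv: "(\<lambda>k. AB (v k)) \<longlonglongrightarrow> AB ((1 / e\<^sup>2) *\<^sub>R z)" by (rule bounded_linear.tendsto[OF bounded_linear_AB v])
  have adj_eq: "(X k - Y k) \<bullet> adj_op D A (root_grad (We e (m0 + k)) (L * e) (Y k) (X k))
      = (L * e / sqrt (1 + v k \<bullet> B (zk k))) * (zk k \<bullet> AB (v k))" for k
    by (simp add: root_grad_adj zk_def[symmetric] We_v)
  have lim_adj: "(\<lambda>k. (X k - Y k) \<bullet> adj_op D A (root_grad (We e (m0 + k)) (L * e) (Y k) (X k)))
      \<longlonglongrightarrow> (L * e / s0) * (z \<bullet> AB ((1 / e\<^sup>2) *\<^sub>R z))"
    unfolding adj_eq using s0 by (intro tendsto_mult tendsto_divide tendsto_inner tendsto_const sq zk ABv) auto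
  have nm_lim: "(\<lambda>k. nm (X k - Y k)) \<longlonglongrightarrow> nm z"
    unfolding zk_def[symmetric] nm_def by (intro tendsto_real_sqrt tendsto_inner zk Bzk)
  have "(\<lambda>k. bdd (m0 + k) (X k) (Y k)) \<longlonglongrightarrow> 2 * \<eta> - (L * e / s0) * (z \<bullet> AB ((1 / e\<^sup>2) *\<^sub>R z))
    + (1 + K * Iw K) * (L * b) * M * nm z + (M * (1 + b) + K * Iw K * M) * (\<delta>1 + \<delta>2) + 2 * \<sigma> * Cs"
    unfolding bdd_def by (intro tendsto_add tendsto_diff tendsto_const tendsto_mult_left lim_adj nm_lim)
  then have "lam \<le> 2 * \<eta> - (L * e / s0) * (z \<bullet> AB ((1 / e\<^sup>2) *\<^sub>R z))
    + (1 + K * Iw K) * (L * b) * M * nm z + (M * (1 + b) + K * Iw K * M) * (\<delta>1 + \<delta>2) + 2 * \<sigma> * Cs"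
    by (rule LIMSEQ_le_const) (use lam_le in blast)
  \<comment> \<open>The form inequality gives \<open>L * c0 * (nm z)\<^sup>2 / (e * s0)\<close>, and
    one factor \<open>nm z\<close> is absorbed by the normalisation
    \<open>e * s0 \<ge> nm z\<close>.\<close>
  moreover have "- ((L * e / s0) * (z \<bullet> AB ((1 / e\<^sup>2) *\<^sub>R z))) \<le> L * c0 * nm z"
  proof -
    have "AB ((1 / e\<^sup>2) *\<^sub>R z) = (1 / e\<^sup>2) *\<^sub>R AB z"
      using bounded_linear_AB by (rule bounded_linear.linear[THEN linear_scale])
    then have "- ((L * e / s0) * (z \<bullet> AB ((1 / e\<^sup>2) *\<^sub>R z))) = L / (e * s0) * (- (z \<bullet> AB z))"
      using e s0 by (simp add: power2_eq_square)
    also have "\<dots> \<le> L / (e * s0) * (c0 * (nm z)\<^sup>2)"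
      using AB_form_ge[of z] L e s0 by (intro mult_left_mono) (auto simp: nm_sq)
    also have "\<dots> = L * c0 * nm z * (nm z / (e * s0))" by (simp add: power2_eq_square)
    also have "\<dots> \<le> L * c0 * nm z * 1"
      using es0 e s0 L c0 nm_nonneg[of z] by (intro mult_left_mono) (auto simp: divide_le_eq)
    finally show ?thesis by simp
  qed
  ultimately have "lam \<le> 2 * \<eta> + (c0 + (1 + K * Iw K) * b * M) * L * nm z + (M * (1 + b) + K * Iw K * M) * (\<delta>1 + \<delta>2) + 2 * \<sigma> * Cs"
    by (simp add: algebra_simps)
  then show ?thesis using zh near unfolding z_def Cs_def by blast
qed

end

section \<open>Comparison of approximate sub- and supersolutions\<close>

lemma small_factor: "0 \<le> a \<Longrightarrow> 0 < (c::real) \<Longrightarrow> x \<le> c / (a + 1) \<Longrightarrow> 0 \<le> x \<Longrightarrow> a * x \<le> c"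
proof -
  assume a: "0 \<le> a" and c: "0 < c" and x: "x \<le> c / (a + 1)" "0 \<le> x"
  have "(a + 1) * x \<le> c" using x(1) a by (simp add: pos_le_divide_eq mult.commute)
  then show ?thesis using x(2) by (simp add: distrib_right)
qed

context equation begin

text \<open>The constants depend on \<open>\<kappa>\<close> alone. The radial weight in the variable of the Lipschitz function is smaller
  by a factor \<open>\<iota>\<close>, so that moving this variable onto the other one at the maximum point costs little.\<close>

lemma comparison:
  fixes T D1 \<kappa> :: real
  assumes T: "0 < T" and D1: "0 \<le> D1" and \<kappa>: "0 < \<kappa>"
  shows "\<exists>L1 L2 \<eta>. 0 < \<eta> \<and> 0 \<le> L2 \<and> (\<forall>u w g. approx_sub T \<eta> L1 L2 u \<longrightarrow> approx_super T \<eta> L1 L2 w \<longrightarrow>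
    (\<exists>Cb. \<forall>t\<in>{0<..<T}. \<forall>x. \<bar>u t x\<bar> \<le> Cb \<and> \<bar>w t x\<bar> \<le> Cb) \<longrightarrow>
    (\<forall>x y. \<bar>g x - g y\<bar> \<le> D1 * nm (x - y)) \<longrightarrow>
    (\<forall>R e. 0 < e \<longrightarrow> (\<exists>\<tau>>0. \<forall>t\<in>{0<..<T}. T - \<tau> < t \<longrightarrow>
      (\<forall>x. norm x \<le> R \<longrightarrow> \<bar>u t x - g x\<bar> \<le> e \<and> \<bar>w t x - g x\<bar> \<le> e))) \<longrightarrow>
    ((\<forall>t\<in>{0<..<T}. \<forall>x y. \<bar>u t x - u t y\<bar> \<le> D1 * nm (x - y)) \<or>
     (\<forall>t\<in>{0<..<T}. \<forall>x y. \<bar>w t x - w t y\<bar> \<le> D1 * nm (x - y))) \<longrightarrow>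
    (\<forall>t\<in>{0<..<T}. \<forall>x. u t x - w t x \<le> \<kappa>))"
proof -
  \<comment> \<open>The excess 1 over the Lipschitz constant is what bounds
    \<open>nm (xh - yh)\<close> at the end.\<close>
  define L where "L = D1 + 1"
  have L: "0 < L" "0 \<le> L" using D1 by (auto simp: L_def)
  \<comment> \<open>The slope that yields the contradiction; over the whole time interval its term
    costs at most \<open>\<kappa> / 8\<close>.\<close>
  define lam where "lam = \<kappa> / (8 * T)"
  have lam: "0 < lam" "lam * T = \<kappa> / 8" using \<kappa> T by (auto simp: lam_def)
  define L1 where "L1 = L * b + 2"
  define K where "K = (L1 + 1) * M + 1"
  have "0 \<le> L * b" using L b_pos by simp
  then have K: "0 < K" using M by (simp add: K_def L1_def add_nonneg_pos)
  define C1 where "C1 = (c0 + (1 + K * Iw K) * b * M) * L"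
  define C2 where "C2 = M * (1 + b) + K * Iw K * M"
  have C1: "0 \<le> C1" and C2: "0 \<le> C2"
    using K Iw_nonneg[of K] M b_pos L c0 by (auto simp: C1_def C2_def intro!: add_nonneg_nonneg mult_nonneg_nonneg)
  \<comment> \<open>The first bound keeps \<open>C1 * L * e\<close> below an eighth of
    \<open>lam\<close>, the second keeps \<open>L * e\<close>, the penalty on the diagonal, below
    \<open>\<kappa> / 8\<close>. The 1 in such denominators guards against vanishing
    constants.\<close>
  define e where "e = min (lam / 8 / (C1 * L + 1)) (\<kappa> / 8 / (L + 1))"
  have CL: "0 \<le> C1 * L" using C1 L by simp
  have e: "0 < e" using lam \<kappa> CL L by (auto simp: e_def intro!: divide_pos_pos add_nonneg_pos)
  have e1: "C1 * L * e \<le> lam / 8" using lam CL e by (intro small_factor) (auto simp: e_def)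
  have e2: "L * e \<le> \<kappa> / 8" using \<kappa> L e by (intro small_factor) (auto simp: e_def)
  define L2 where "L2 = L * \<beta> / e + 2"
  have L2: "0 \<le> L2" using L \<beta>_pos e by (simp add: L2_def add_nonneg_nonneg)
  define \<eta> where "\<eta> = lam / 8"
  have \<eta>: "0 < \<eta>" using lam by (simp add: \<eta>_def)
  have "u t0 x0 - w t0 x0 \<le> \<kappa>"
    if sub: "approx_sub T \<eta> L1 L2 u" and super: "approx_super T \<eta> L1 L2 w"
      and bd: "\<forall>t\<in>{0<..<T}. \<forall>x. \<bar>u t x\<bar> \<le> Cb \<and> \<bar>w t x\<bar> \<le> Cb"
      and g: "\<forall>x y. \<bar>g x - g y\<bar> \<le> D1 * nm (x - y)"
      and terminal: "\<forall>R e. 0 < e \<longrightarrow> (\<exists>\<tau>>0. \<forall>t\<in>{0<..<T}. T - \<tau> < t \<longrightarrow>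
        (\<forall>x. norm x \<le> R \<longrightarrow> \<bar>u t x - g x\<bar> \<le> e \<and> \<bar>w t x - g x\<bar> \<le> e))"
      and lip: "(\<forall>t\<in>{0<..<T}. \<forall>x y. \<bar>u t x - u t y\<bar> \<le> D1 * nm (x - y)) \<or>
        (\<forall>t\<in>{0<..<T}. \<forall>x y. \<bar>w t x - w t y\<bar> \<le> D1 * nm (x - y))"
      and t0: "t0 \<in> {0<..<T}"
    for u w g Cb t0 x0
  proof (rule ccontr)
    assume "\<not> u t0 x0 - w t0 x0 \<le> \<kappa>"
    then have big: "\<kappa> < u t0 x0 - w t0 x0" by simp
    have Cb: "0 \<le> Cb" using bd t0 abs_ge_zero order.trans by blast
    define \<delta> where "\<delta> = min 1 (min (lam / 8 / (C2 * 2 + 1)) (\<kappa> / 8 / (2 * h0 (norm x0) + 1)))"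
    have \<delta>: "0 < \<delta>" "\<delta> \<le> 1"
      using lam \<kappa> C2 h0_nonneg[of "norm x0"] by (auto simp: \<delta>_def intro!: divide_pos_pos add_nonneg_pos)
    have \<delta>1: "C2 * 2 * \<delta> \<le> lam / 8" using lam C2 \<delta> by (intro small_factor) (auto simp: \<delta>_def)
    have \<delta>2: "2 * h0 (norm x0) * \<delta> \<le> \<kappa> / 8" using \<kappa> h0_nonneg[of "norm x0"] \<delta> by (intro small_factor) (auto simp: \<delta>_def)
    define \<iota> where "\<iota> = min 1 (lam / 8 / (C1 * (2 * Cb) + 1))"
    have CC: "0 \<le> C1 * (2 * Cb)" using C1 Cb by simp
    have \<iota>: "0 < \<iota>" "\<iota> \<le> 1" using lam CC by (auto simp: \<iota>_def intro!: divide_pos_pos add_nonneg_pos)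
    have \<iota>1: "C1 * (2 * Cb) * \<iota> \<le> lam / 8" using lam CC \<iota> by (intro small_factor) (auto simp: \<iota>_def)
    have \<iota>\<delta>: "0 < \<iota> * \<delta>" "\<iota> * \<delta> \<le> \<delta>" using \<iota> \<delta> by (auto simp: mult_left_le_one_le)
    define wl where "wl \<longleftrightarrow> (\<forall>t\<in>{0<..<T}. \<forall>x y. \<bar>w t x - w t y\<bar> \<le> D1 * nm (x - y))"
    define d1 where "d1 = (if wl then \<delta> else \<iota> * \<delta>)"
    define d2 where "d2 = (if wl then \<iota> * \<delta> else \<delta>)"
    have d: "0 < d1" "d1 \<le> 1" "0 < d2" "d2 \<le> 1" "d1 \<le> \<delta>" "d2 \<le> \<delta>" "\<iota> * \<delta> \<le> d1" "\<iota> * \<delta> \<le> d2"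
      using \<delta> \<iota>\<delta> by (auto simp: d1_def d2_def)
    \<comment> \<open>From \<open>ln R = 2 * Cb / (\<iota> * \<delta>)\<close>: once a variable
      leaves the ball, its radial term is at least the largest possible value of
      \<open>u - w\<close>.\<close>
    define R where "R = exp (2 * Cb / (\<iota> * \<delta>))"
    have R: "1 \<le> R" using Cb \<iota>\<delta> by (simp add: R_def)
    have far: "2 * Cb \<le> d * h0 (norm x)" if "R < norm x" "\<iota> * \<delta> \<le> d" for d and x :: 'a
    proof -
      have "2 * Cb / (\<iota> * \<delta>) = ln R" by (simp add: R_def)
      also have "\<dots> \<le> h0 R" by (rule h0_ge[OF R])
      also have "\<dots> \<le> h0 (norm x)" using R that(1) by (intro h0_mono) auto
      finally have "2 * Cb \<le> (\<iota> * \<delta>) * h0 (norm x)" using \<iota>\<delta> by (simp add: pos_divide_le_eq mult.commute)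
      also have "\<dots> \<le> d * h0 (norm x)" using that(2) h0_nonneg by (intro mult_right_mono) auto
      finally show ?thesis .
    qed
    have "0 < \<kappa> / 16" using \<kappa> by simp
    then obtain \<tau> where \<tau>: "0 < \<tau>" and near_T: "\<And>t x. t \<in> {0<..<T} \<Longrightarrow> T - \<tau> < t \<Longrightarrow> norm x \<le> R \<Longrightarrow>
        \<bar>u t x - g x\<bar> \<le> \<kappa> / 16 \<and> \<bar>w t x - g x\<bar> \<le> \<kappa> / 16"
      using terminal by blast
    \<comment> \<open>At \<open>t0\<close> each barrier costs \<open>\<kappa> / 16\<close>; before
      the time \<open>al\<close> a barrier exceeds every value of \<open>u - w\<close>.\<close>
    define \<mu> where "\<mu> = \<kappa> * t0 / 16"
    have \<mu>: "0 < \<mu>" "\<mu> / t0 = \<kappa> / 16" using \<kappa> t0 by (auto simp: \<mu>_def)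
    define al where "al = \<mu> / (2 * Cb + 1)"
    \<comment> \<open>If one of the two times exceeds \<open>bt\<close>, either they are
      \<open>\<tau> / 2\<close> apart, which costs \<open>2 * Cb + 1\<close> by the choice of
      \<open>\<gamma>\<close>, or both lie within \<open>\<tau>\<close> of \<open>T\<close>, where
      \<open>u\<close> and \<open>w\<close> are close to \<open>g\<close>.\<close>
    define bt where "bt = T - \<tau> / 2"
    have ab: "0 < al" "bt < T" using \<mu> Cb \<tau> by (auto simp: al_def bt_def)
    define \<gamma> where "\<gamma> = (\<tau> / 2)\<^sup>2 / (2 * Cb + 1)"
    have \<gamma>: "0 < \<gamma>" using \<tau> Cb by (auto simp: \<gamma>_def intro!: divide_pos_pos)
    \<comment> \<open>For \<open>m \<ge> m0\<close> the regularisation changes the penalty by at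
      most \<open>\<kappa> / 8\<close> on the ball.\<close>
    define Er where "Er = L / e * \<beta> * (2 * R)\<^sup>2"
    obtain m0 :: nat where m0: "Er / (\<kappa> / 8) < real m0" using reals_Archimedean2 by blast
    define Cs where "Cs = 2 + 2 * R + 2 * M * (1 + b * R) + 2 * (K * Iw K * M)"
    have Cs: "0 \<le> Cs" using R M b_pos K Iw_nonneg[of K] by (auto simp: Cs_def intro!: add_nonneg_nonneg mult_nonneg_nonneg)
    define \<sigma> where "\<sigma> = min 1 (min (\<kappa> / 128) (lam / 8 / (4 * C1 + 2 * Cs + 1)))"
    have \<sigma>: "0 < \<sigma>" "\<sigma> \<le> 1" "16 * \<sigma> \<le> \<kappa> / 8"
      using lam \<kappa> C1 Cs by (auto simp: \<sigma>_def intro!: divide_pos_pos add_nonneg_pos)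
    have \<sigma>1: "(4 * C1 + 2 * Cs) * \<sigma> \<le> lam / 8" using lam C1 Cs \<sigma> by (intro small_factor) (auto simp: \<sigma>_def)
    let ?\<Psi> = "\<lambda>t x s y. u t x - w s y - (Th e L x y + ((t - s)\<^sup>2 / \<gamma> + lam * (T - t) + \<mu> / t + \<mu> / s)) - d1 * h0 (norm x) - d2 * h0 (norm y)"
    let ?S = "{al..bt} \<times> cball 0 R \<times> {al..bt} \<times> cball (0::'a) R"
    have uw: "u t x - w s y \<le> 2 * Cb" if "t \<in> {0<..<T}" "s \<in> {0<..<T}" for t x s y
    proof -
      have "\<bar>u t x\<bar> \<le> Cb" "\<bar>w s y\<bar> \<le> Cb" using bd that by blast+
      then show ?thesis by linarith
    qed
    have h_nn: "0 \<le> d1 * h0 r" "0 \<le> d2 * h0 r" for r using d h0_nonneg[of r] by auto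
    have Tc_nn: "0 \<le> (t - s)\<^sup>2 / \<gamma>" "0 \<le> lam * (T - t)" "0 \<le> \<mu> / t" "0 \<le> \<mu> / s"
      if "t \<in> {0<..<T}" "s \<in> {0<..<T}" for t s using that \<gamma> lam \<mu> by auto
    have out: "u t x - w s y - (root_fn (We e m) (L * e) y x + ((t - s)\<^sup>2 / \<gamma> + lam * (T - t) + \<mu> / t + \<mu> / s))
        - d1 * h0 (norm x) - d2 * h0 (norm y) \<le> \<kappa> / 4"
      if m: "m0 \<le> m" and ts: "t \<in> {0<..<T}" "s \<in> {0<..<T}" and nS: "(t, x, s, y) \<notin> ?S" for m t x s y
    proof -
      have root0: "0 \<le> root_fn (We e m) (L * e) y x" using L e by (intro root_We_nonneg psd_We) auto
      note nn = uw[OF ts, of x y] h_nn(1)[of "norm x"] h_nn(2)[of "norm y"] Tc_nn[OF ts] root0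
      have early: "2 * Cb \<le> \<mu> / r" if "0 < r" "r < al" for r
      proof -
        have "(2 * Cb + 1) * r \<le> \<mu>" using that Cb by (simp add: al_def pos_less_divide_eq mult.commute)
        then have "2 * Cb + 1 \<le> \<mu> / r" using that by (simp add: pos_le_divide_eq)
        then show ?thesis by simp
      qed
      consider "t < al" | "s < al" | "R < norm x" | "R < norm y"
        | "al \<le> t" "al \<le> s" "norm x \<le> R" "norm y \<le> R" "bt < t \<or> bt < s"
        using nS by force
      then show ?thesis
      proof cases
        case 1
        then show ?thesis using nn early[of t] ts \<kappa> by auto
      next
        case 2
        then show ?thesis using nn early[of s] ts \<kappa> by auto
      next
        case 3
        then show ?thesis using nn far[of x d1] d \<kappa> by linarith
      next
        case 4
        then show ?thesis using nn far[of y d2] d \<kappa> by linarith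
      next
        case 5
        show ?thesis
        proof (cases "\<tau> / 2 \<le> \<bar>t - s\<bar>")
          case True
          then have "(\<tau> / 2)\<^sup>2 \<le> (t - s)\<^sup>2" using \<tau> by (metis abs_le_square_iff abs_of_pos half_gt_zero)
          then have "(\<tau> / 2)\<^sup>2 / \<gamma> \<le> (t - s)\<^sup>2 / \<gamma>" using \<gamma> by (intro divide_right_mono) auto
          moreover have "(\<tau> / 2)\<^sup>2 / \<gamma> = 2 * Cb + 1" using \<tau> Cb by (simp add: \<gamma>_def)
          ultimately show ?thesis using nn \<kappa> by linarith
        next
          case False
          then have "t - s < \<tau> / 2" "s - t < \<tau> / 2" by linarith+
          then have "T - \<tau> < t" "T - \<tau> < s" using 5(5) \<tau> unfolding bt_def by linarith+
          then have gt: "\<bar>u t x - g x\<bar> \<le> \<kappa> / 16" "\<bar>w s y - g y\<bar> \<le> \<kappa> / 16"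
            using near_T[OF ts(1) _ 5(3)] near_T[OF ts(2) _ 5(4)] by auto
          have "D1 * nm (x - y) \<le> L * nm (x - y)" using nm_nonneg by (intro mult_right_mono) (auto simp: L_def)
          moreover have "\<bar>g x - g y\<bar> \<le> D1 * nm (x - y)" using g by blast
          ultimately have gg: "g x - g y \<le> Th e L x y"
            using Th_ge[OF e L(2), of x y] by linarith
          have "norm (x - y) \<le> 2 * R" using norm_triangle_ineq4[of x y] 5 by linarith
          then have "(norm (x - y))\<^sup>2 \<le> (2 * R)\<^sup>2" by (intro power_mono) auto
          then have "L / e * (\<beta> / (real m + 1)) * (norm (x - y))\<^sup>2 \<le> L / e * (\<beta> / (real m + 1)) * (2 * R)\<^sup>2"
            using L e \<beta>_pos by (intro mult_left_mono) auto
          also have "\<dots> = Er / (real m + 1)" by (simp add: Er_def)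
          also have "\<dots> \<le> \<kappa> / 8"
          proof -
            have "Er < real m0 * (\<kappa> / 8)" using m0 \<kappa> by (simp add: pos_divide_less_eq)
            also have "\<dots> \<le> (real m + 1) * (\<kappa> / 8)" using m \<kappa> by (intro mult_right_mono) auto
            finally show ?thesis by (simp add: pos_divide_le_eq mult.commute)
          qed
          finally have "Th e L x y \<le> root_fn (We e m) (L * e) y x + \<kappa> / 8"
            using Th_le_root_We[OF e L(2), of x y m] by linarith
          \<comment> \<open>Twice \<open>\<kappa> / 16\<close> from the terminal condition and
            \<open>\<kappa> / 8\<close> from the regularisation; the increment of \<open>g\<close>
            is absorbed by the penalty.\<close>
          then show ?thesis using nn(2-) gt gg by linarith
        qed
      qed
    qed
    have Th0: "Th e L x x = L * e" for x by (simp add: Th_def nm_zero)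
    \<comment> \<open>Of the initial gap \<open>\<kappa>\<close>, at most
      \<open>\<kappa> / 8\<close> goes to each of four costs: the diagonal penalty, the slope in
      time, the two barriers together and the two radial terms together.\<close>
    have \<Psi>0: "\<kappa> / 2 < ?\<Psi> t0 x0 t0 x0"
    proof -
      have "lam * (T - t0) \<le> lam * T" using lam t0 by (intro mult_left_mono) auto
      moreover have "d1 * h0 (norm x0) \<le> \<delta> * h0 (norm x0)" "d2 * h0 (norm x0) \<le> \<delta> * h0 (norm x0)"
        using d h0_nonneg by (auto intro: mult_right_mono)
      moreover have "2 * h0 (norm x0) * \<delta> = \<delta> * h0 (norm x0) + \<delta> * h0 (norm x0)" by simp
      moreover have "(t0 - t0)\<^sup>2 / \<gamma> = 0" by simp
      ultimately show ?thesis unfolding Th0 using big lam(2) \<mu>(2) e2 \<delta>2 by linarith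
    qed
    have z0: "(t0, x0, t0, x0) \<in> ?S"
    proof (rule ccontr)
      assume "(t0, x0, t0, x0) \<notin> ?S"
      from out[OF order_refl t0 t0 this] have "u t0 x0 - w t0 x0 - (root_fn (We e m0) (L * e) x0 x0 + ((t0 - t0)\<^sup>2 / \<gamma> + lam * (T - t0) + \<mu> / t0 + \<mu> / t0))
        - d1 * h0 (norm x0) - d2 * h0 (norm x0) \<le> \<kappa> / 4" .
      moreover have "root_fn (We e m0) (L * e) x0 x0 \<le> Th e L x0 x0" by (rule root_We_le_Th[OF e L(2)])
      ultimately show False using \<Psi>0 \<kappa> by linarith
    qed
    have bound: "u t x \<le> Cb \<and> - Cb \<le> w t x" if "t \<in> {0<..<T}" for t x
    proof -
      have "\<bar>u t x\<bar> \<le> Cb" "\<bar>w t x\<bar> \<le> Cb" using bd that by blast+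
      then show ?thesis by linarith
    qed
    have "\<exists>th xh sh yh. (th, xh, sh, yh) \<in> ?S \<and> (\<forall>t x s y. (t, x, s, y) \<in> ?S \<longrightarrow> ?\<Psi> t x s y - 4 * \<sigma> \<le> ?\<Psi> th xh sh yh) \<and>
      lam \<le> 2 * \<eta> + (c0 + (1 + ((L1 + 1) * M + 1) * Iw ((L1 + 1) * M + 1)) * b * M) * L * nm (xh - yh)
        + (M * (1 + b) + ((L1 + 1) * M + 1) * Iw ((L1 + 1) * M + 1) * M) * (d1 + d2)
        + 2 * \<sigma> * (2 + 2 * R + 2 * M * (1 + b * R) + 2 * (((L1 + 1) * M + 1) * Iw ((L1 + 1) * M + 1) * M))"
    proof (rule doubling_limit[OF sub super _ _ L(2) e d(1-4) \<gamma> less_imp_le[OF \<mu>(1)] less_imp_le[OF lam(1)] \<sigma>(1,2) bound ab out z0])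
      show "L * b + 2 \<le> L1" "L * \<beta> / e + 2 \<le> L2" by (simp_all add: L1_def L2_def)
      show "\<kappa> / 4 + 16 * \<sigma> < ?\<Psi> t0 x0 t0 x0" using \<Psi>0 \<sigma>(3) \<kappa> by linarith
    qed
    then obtain th xh sh yh where zh: "(th, xh, sh, yh) \<in> ?S"
      and near: "\<And>t x s y. (t, x, s, y) \<in> ?S \<Longrightarrow> ?\<Psi> t x s y - 4 * \<sigma> \<le> ?\<Psi> th xh sh yh"
      and fin: "lam \<le> 2 * \<eta> + C1 * nm (xh - yh) + C2 * (d1 + d2) + 2 * \<sigma> * Cs"
      unfolding K_def[symmetric] C1_def[symmetric] C2_def[symmetric] Cs_def[symmetric] by blast
    have mh: "th \<in> {0<..<T}" "sh \<in> {0<..<T}" using zh ab by auto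
    have "0 \<le> ?\<Psi> th xh sh yh" using near[OF z0] \<Psi>0 \<sigma> \<kappa> by linarith
    moreover have "0 \<le> Th e L xh yh" using Th_ge[OF e L(2), of xh yh] L nm_nonneg[of "xh - yh"]
      by (meson mult_nonneg_nonneg order.trans)
    ultimately have hb: "d1 * h0 (norm xh) \<le> 2 * Cb" "d2 * h0 (norm yh) \<le> 2 * Cb"
      using uw[OF mh, of xh yh] Tc_nn[OF mh] h_nn(1)[of "norm xh"] h_nn(2)[of "norm yh"] by linarith+
    \<comment> \<open>Compare with the point at which the variable of the Lipschitz function is
      moved onto the other one: the penalty drops to \<open>L * e\<close>, the Lipschitz function
      changes by at most \<open>D1 * nm (xh - yh)\<close>, and \<open>L - D1 = 1\<close> leaves
      \<open>nm (xh - yh)\<close> itself.\<close>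
    have nz: "nm (xh - yh) \<le> L * e + 2 * Cb * \<iota> + 4 * \<sigma>"
    proof (cases wl)
      case True
      have "(th, xh, sh, xh) \<in> ?S" using zh by auto
      from near[OF this] have "Th e L xh yh \<le> L * e + (w sh xh - w sh yh) + d2 * h0 (norm xh) + 4 * \<sigma>"
        unfolding Th0 using h_nn(2)[of "norm yh"] by linarith
      moreover have "w sh xh - w sh yh \<le> D1 * nm (xh - yh)" using True mh unfolding wl_def by (meson abs_le_D1)
      moreover have "d2 * h0 (norm xh) = \<iota> * (d1 * h0 (norm xh))" using True by (simp add: d1_def d2_def)
      moreover have "\<iota> * (d1 * h0 (norm xh)) \<le> \<iota> * (2 * Cb)" using \<iota> hb(1) by (intro mult_left_mono) auto
      moreover have "L * nm (xh - yh) \<le> Th e L xh yh" by (rule Th_ge[OF e L(2)])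
      ultimately show ?thesis unfolding L_def by (simp add: algebra_simps)
    next
      case False
      then have ul: "\<forall>t\<in>{0<..<T}. \<forall>x y. \<bar>u t x - u t y\<bar> \<le> D1 * nm (x - y)" using lip unfolding wl_def by blast
      have "(th, yh, sh, yh) \<in> ?S" using zh by auto
      from near[OF this] have "Th e L xh yh \<le> L * e + (u th xh - u th yh) + d1 * h0 (norm yh) + 4 * \<sigma>"
        unfolding Th0 using h_nn(1)[of "norm xh"] by linarith
      moreover have "u th xh - u th yh \<le> D1 * nm (xh - yh)" using ul mh by (meson abs_le_D1)
      moreover have "d1 * h0 (norm yh) = \<iota> * (d2 * h0 (norm yh))" using False by (simp add: d1_def d2_def)
      moreover have "\<iota> * (d2 * h0 (norm yh)) \<le> \<iota> * (2 * Cb)" using \<iota> hb(2) by (intro mult_left_mono) auto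
      moreover have "L * nm (xh - yh) \<le> Th e L xh yh" by (rule Th_ge[OF e L(2)])
      ultimately show ?thesis unfolding L_def by (simp add: algebra_simps)
    qed
    have "C1 * nm (xh - yh) \<le> C1 * (L * e + 2 * Cb * \<iota> + 4 * \<sigma>)" using nz C1 by (rule mult_left_mono)
    also have "\<dots> = C1 * L * e + C1 * (2 * Cb) * \<iota> + 4 * C1 * \<sigma>" by (simp add: algebra_simps)
    finally have f1: "C1 * nm (xh - yh) \<le> lam / 8 + lam / 8 + 4 * C1 * \<sigma>" using e1 \<iota>1 by linarith
    have "C2 * (d1 + d2) \<le> C2 * (\<delta> + \<delta>)" using C2 d by (intro mult_left_mono add_mono)
    then have f2: "C2 * (d1 + d2) \<le> lam / 8" using \<delta>1 by (simp add: algebra_simps)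
    have f3: "4 * C1 * \<sigma> + 2 * \<sigma> * Cs \<le> lam / 8" using \<sigma>1 by (simp add: algebra_simps)
    \<comment> \<open>Everything on the right adds up to at most six eighths of
      \<open>lam\<close>.\<close>
    show False using fin f1 f2 f3 lam(1) unfolding \<eta>_def by linarith
  qed
  then show ?thesis using \<eta> L2 by (intro exI[of _ L1] exI[of _ L2] exI[of _ \<eta>]) blast
qed

end

theorem theorem5p1:
  fixes D :: "'a::{real_inner, polish_space} set"
    and A :: "'a \<Rightarrow> 'a"
    and B :: "'a \<Rightarrow>\<^sub>L 'a"
    and F :: "'a \<Rightarrow> 'a"
    and G :: "'a \<Rightarrow> 'a \<Rightarrow>\<^sub>L 'a"
    and \<nu> :: "'a measure"
    and g :: "'a \<Rightarrow> real"
    and v :: "real \<Rightarrow> 'a \<Rightarrow> real"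
    and vn :: "nat \<Rightarrow> real \<Rightarrow> 'a \<Rightarrow> real"
    and T M c0 D1 :: real
  assumes A_linear: "linear_operator_on D A"
    and A_dense: "closure D = UNIV"
    and A_maxmono: "maximal_monotone D A"
    and B_selfadj: "self_adjoint B"
    and B_pos: "\<And>x. x \<noteq> 0 \<Longrightarrow> 0 < B x \<bullet> x"
    and AB_dom: "range (blinfun_apply B) \<subseteq> adj_dom D A"
    and AB_bounded: "bounded_linear (\<lambda>x. adj_op D A (B x))"
    and c0: "0 \<le> c0"
    and AB_ge: "\<And>x. 0 \<le> (adj_op D A (B x) + c0 *\<^sub>R B x) \<bullet> x"
    and nu_borel: "sets \<nu> = sets borel"
    and nu_zero: "emeasure \<nu> {0} = 0"
    and nu_moment2: "(\<integral>\<^sup>+ z. ennreal ((norm z)\<^sup>2) \<partial>\<nu>) < \<infinity>"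
    and T: "0 < T"
    and M: "0 \<le> M"
    and F_zero: "norm (F 0) \<le> M"
    and F_lip: "\<And>x y. norm (F x - F y) \<le> M * norm_m1 B (x - y)"
    and G_lip: "\<And>x y. norm (G x - G y) \<le> M * norm_m1 B (x - y)"
    and G_bound: "\<And>x. norm (G x) \<le> M"
    and nu_exp: "\<And>K. 0 < K \<Longrightarrow> (\<integral>\<^sup>+ z. ennreal ((norm z)\<^sup>2 * exp (K * norm z)) \<partial>\<nu>) < \<infinity>"
    and g: "g \<in> Lip_b_Hm1 B"
    and vn_bounded: "\<And>n. 1 \<le> n \<Longrightarrow> bounded ((\<lambda>(t, x). vn n t x) ` ({0<..T} \<times> UNIV))"
    and vn_solution: "\<And>n. 1 \<le> n \<Longrightarrow> viscosity_solution_jump T D A B F G \<nu> n (vn n)"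
    and vn_terminal: "\<And>n x. 1 \<le> n \<Longrightarrow> vn n T x = g x"
    and v_bounded: "bounded ((\<lambda>(t, x). v t x) ` ({0<..T} \<times> UNIV))"
    and v_solution: "viscosity_solution_first T D A B F G \<nu> v"
    and v_terminal: "\<And>x. v T x = g x"
    and terminal_limit: "\<And>n S. 1 \<le> n \<Longrightarrow> bounded S \<Longrightarrow>
          uniform_limit S (\<lambda>t x. \<bar>vn n t x - g x\<bar> + \<bar>v t x - g x\<bar>) (\<lambda>x. 0) (at_left T)"
    and D1: "0 \<le> D1"
    and v_lip: "\<And>t x y. t \<in> {0<..T} \<Longrightarrow> \<bar>v t x - v t y\<bar> \<le> D1 * norm_m1 B (x - y)"
    and sup_bound: "sup_norm T v + (SUP n\<in>{1..}. sup_norm T (vn n)) < \<infinity>"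
  shows "(\<lambda>n. sup_norm T (\<lambda>t x. vn n t x - v t x)) \<longlonglongrightarrow> 0"
proof -
  interpret equation B D A c0 F G \<nu> M
    by (intro equation.intro setting.intro pos_operator.intro setting_axioms.intro equation_axioms.intro; fact)
  \<comment> \<open>Read off from the bound for \<open>v\<close> at time \<open>T\<close>, where
    \<open>v\<close> equals \<open>g\<close>.\<close>
  have g_lip: "\<bar>g x - g y\<bar> \<le> D1 * nm (x - y)" for x y
    using v_lip[of T x y] T by (simp add: v_terminal norm_m1_nm)
  have v_lip': "\<bar>v t x - v t y\<bar> \<le> D1 * nm (x - y)" if "t \<in> {0<..<T}" for t x y
    using v_lip[of t x y] that by (simp add: norm_m1_nm)
  have near_T: "\<exists>\<tau>>0. \<forall>t\<in>{0<..<T}. T - \<tau> < t \<longrightarrow> (\<forall>x. norm x \<le> R \<longrightarrow> \<bar>vn n t x - g x\<bar> \<le> e \<and> \<bar>v t x - g x\<bar> \<le> e)"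
    if n: "1 \<le> n" and e: "0 < e" for n R and e :: real
  proof -
    have "\<forall>\<^sub>F t in at_left T. \<forall>x\<in>cball 0 R. dist (\<bar>vn n t x - g x\<bar> + \<bar>v t x - g x\<bar>) 0 < e"
      using terminal_limit[OF n bounded_cball[of 0 R]] e unfolding uniform_limit_iff by blast
    then obtain t1 where t1: "t1 < T" "\<And>t x. t1 < t \<Longrightarrow> t < T \<Longrightarrow> norm x \<le> R \<Longrightarrow> \<bar>vn n t x - g x\<bar> + \<bar>v t x - g x\<bar> < e"
      unfolding eventually_at_left_field by (auto simp: dist_real_def)
    show ?thesis
    proof (intro exI[of _ "T - t1"] conjI ballI impI allI)
      show "0 < T - t1" using t1(1) by simp
      fix t and x :: 'a assume "t \<in> {0<..<T}" "T - (T - t1) < t" "norm x \<le> R"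
      then have "\<bar>vn n t x - g x\<bar> + \<bar>v t x - g x\<bar> < e" by (intro t1(2)) auto
      then show "\<bar>vn n t x - g x\<bar> \<le> e" "\<bar>v t x - g x\<bar> \<le> e"
        using abs_ge_zero[of "vn n t x - g x"] abs_ge_zero[of "v t x - g x"] by linarith+
    qed
  qed
  have bdd: "\<exists>Cb. \<forall>t\<in>{0<..<T}. \<forall>x. \<bar>vn n t x\<bar> \<le> Cb \<and> \<bar>v t x\<bar> \<le> Cb" if n: "1 \<le> n" for n
  proof -
    obtain C where C: "\<And>t x. t \<in> {0<..T} \<Longrightarrow> \<bar>vn n t x\<bar> \<le> C" using vn_bounded[OF n] unfolding bounded_iff by fastforce
    obtain C' where C': "\<And>t x. t \<in> {0<..T} \<Longrightarrow> \<bar>v t x\<bar> \<le> C'" using v_bounded unfolding bounded_iff by fastforce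
    show ?thesis
      by (intro exI[of _ "max C C'"] ballI allI conjI) (use C C' in \<open>auto simp: le_max_iff_disj\<close>)
  qed
  have main: "\<forall>\<^sub>F n in sequentially. sup_norm T (\<lambda>t x. vn n t x - v t x) \<le> ereal \<kappa>" if \<kappa>: "0 < \<kappa>" for \<kappa>
  proof -
    obtain L1 L2 \<eta> where \<eta>: "0 < \<eta>" "0 \<le> L2"
      and comp: "\<forall>u w g. approx_sub T \<eta> L1 L2 u \<longrightarrow> approx_super T \<eta> L1 L2 w \<longrightarrow>
        (\<exists>Cb. \<forall>t\<in>{0<..<T}. \<forall>x. \<bar>u t x\<bar> \<le> Cb \<and> \<bar>w t x\<bar> \<le> Cb) \<longrightarrow>
        (\<forall>x y. \<bar>g x - g y\<bar> \<le> D1 * nm (x - y)) \<longrightarrow>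
        (\<forall>R e. 0 < e \<longrightarrow> (\<exists>\<tau>>0. \<forall>t\<in>{0<..<T}. T - \<tau> < t \<longrightarrow>
          (\<forall>x. norm x \<le> R \<longrightarrow> \<bar>u t x - g x\<bar> \<le> e \<and> \<bar>w t x - g x\<bar> \<le> e))) \<longrightarrow>
        ((\<forall>t\<in>{0<..<T}. \<forall>x y. \<bar>u t x - u t y\<bar> \<le> D1 * nm (x - y)) \<or>
         (\<forall>t\<in>{0<..<T}. \<forall>x y. \<bar>w t x - w t y\<bar> \<le> D1 * nm (x - y))) \<longrightarrow>
        (\<forall>t\<in>{0<..<T}. \<forall>x. u t x - w t x \<le> \<kappa>)"
      using comparison[OF T D1 \<kappa>] by (elim exE conjE) (rule that)
    note comp = comp[THEN spec, THEN spec, THEN spec, THEN mp, THEN mp, THEN mp, THEN mp, THEN mp, THEN mp]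
    \<comment> \<open>\<open>J / n\<close> bounds the defect of \<open>vn n\<close> on test
      functions with bounds \<open>L1\<close>, \<open>L2\<close>; these were fixed before
      \<open>n\<close>, so it drops below \<open>\<eta>\<close> for large \<open>n\<close>.\<close>
    define J where "J = (L2 + 1) * M\<^sup>2 * Iw ((L1 + 1) * M + 1)"
    obtain N :: nat where N: "J / \<eta> < real N" using reals_Archimedean2 by blast
    have "sup_norm T (\<lambda>t x. vn n t x - v t x) \<le> ereal \<kappa>" if n: "max 1 N \<le> n" for n
    proof -
      have n1: "1 \<le> n" using n by simp
      have "J < real N * \<eta>" using N \<eta> by (simp add: pos_divide_less_eq)
      also have "\<dots> \<le> real n * \<eta>" using n \<eta> by (intro mult_right_mono) auto
      finally have "J / real n \<le> \<eta>" using n1 by (simp add: pos_divide_le_eq mult.commute)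
      then have "(L2 + 1) * M\<^sup>2 / real n * Iw ((L1 + 1) * M + 1) \<le> \<eta>" by (simp add: J_def)
      note jump = approx_jump[OF vn_solution[OF n1] n1 \<eta>(2) this]
      note first = approx_first[OF v_solution less_imp_le[OF \<eta>(1)], of L1 L2]
      have gl: "\<forall>x y. \<bar>g x - g y\<bar> \<le> D1 * nm (x - y)" using g_lip by blast
      have vl: "\<forall>t\<in>{0<..<T}. \<forall>x y. \<bar>v t x - v t y\<bar> \<le> D1 * nm (x - y)" using v_lip' by blast
      have near: "\<forall>R e. 0 < e \<longrightarrow> (\<exists>\<tau>>0. \<forall>t\<in>{0<..<T}. T - \<tau> < t \<longrightarrow>
          (\<forall>x. norm x \<le> R \<longrightarrow> \<bar>vn n t x - g x\<bar> \<le> e \<and> \<bar>v t x - g x\<bar> \<le> e))" using near_T[OF n1] by blast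
      have up: "\<forall>t\<in>{0<..<T}. \<forall>x. vn n t x - v t x \<le> \<kappa>"
        by (rule comp[OF jump(1) first(2) bdd[OF n1] gl near disjI2[OF vl]])
      have bdd': "\<exists>Cb. \<forall>t\<in>{0<..<T}. \<forall>x. \<bar>v t x\<bar> \<le> Cb \<and> \<bar>vn n t x\<bar> \<le> Cb"
        using bdd[OF n1] by (simp only: conj_commute)
      have near': "\<forall>R e. 0 < e \<longrightarrow> (\<exists>\<tau>>0. \<forall>t\<in>{0<..<T}. T - \<tau> < t \<longrightarrow>
          (\<forall>x. norm x \<le> R \<longrightarrow> \<bar>v t x - g x\<bar> \<le> e \<and> \<bar>vn n t x - g x\<bar> \<le> e))"
        using near by (simp only: conj_commute)
      \<comment> \<open>The roles of the two functions are exchanged; the Lipschitz alternative is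
        met by \<open>v\<close> in both applications.\<close>
      have down: "\<forall>t\<in>{0<..<T}. \<forall>x. v t x - vn n t x \<le> \<kappa>"
        by (rule comp[OF first(1) jump(2) bdd' gl near' disjI1[OF vl]])
      have "\<bar>vn n t x - v t x\<bar> \<le> \<kappa>" if "t \<in> {0<..T}" for t x
      proof (cases "t = T")
        case True
        then show ?thesis using \<kappa> by (simp add: vn_terminal[OF n1] v_terminal)
      next
        case False
        then have "t \<in> {0<..<T}" using that by auto
        then show ?thesis using up down by (simp add: abs_le_iff)
      qed
      then show ?thesis unfolding sup_norm_def by (intro SUP_least) auto
    qed
    then show ?thesis unfolding eventually_sequentially by blast
  qed
  have nonneg: "0 \<le> sup_norm T (\<lambda>t x. vn n t x - v t x)" for n
    unfolding sup_norm_def using T by (intro SUP_upper2[of "(T, 0)"]) auto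
  show ?thesis
  proof (rule order_tendstoI)
    fix a :: ereal assume "a < 0"
    then show "\<forall>\<^sub>F n in sequentially. a < sup_norm T (\<lambda>t x. vn n t x - v t x)"
      using nonneg by (intro always_eventually allI) (meson less_le_trans)
  next
    fix a :: ereal assume "0 < a"
    then obtain r where r: "0 < ereal r" "ereal r < a" using ereal_dense2 by blast
    then have "0 < r" by simp
    from main[OF this] show "\<forall>\<^sub>F n in sequentially. sup_norm T (\<lambda>t x. vn n t x - v t x) < a"
      by eventually_elim (rule le_less_trans[OF _ r(2)])
  qed
qed

end
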